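(* At least $35$ of the $751593$ triangulations (up to isomorphism) with exactly $12$ vertices (the minimal number) of the orientable closed surface $M_5$ of genus $5$ admit polyhedral realizations in $\mathbb{R}^3$ with $2$-fold rotational symmetry.
   Context: $M_g$ denotes the orientable closed surface of genus $g$. A triangulation of a closed connected surface $S$ is a finite two-dimensional simplicial complex $\Delta$ whose underlying space $|\Delta|$ is homeomorphic to $S$; triangulations are counted up to combinatorial (simplicial) isomorphism. The minimal number of vertices of a triangulation of $M_5$ is $12$, and there are exactly $751593$ triangulations of $M_5$ with $12$ vertices, from the known enumeration. Let $V$ be the vertex set of $\Delta$. Each map $\psi\colon V\to\mathbb{R}^3$ induces a simplexwise linear map $\phi_\psi\colon|\Delta|\to\mathbb{R}^3$. Since the surface is orientable, a polyhedral realization of $\Delta$ in $\mathbb{R}^3$ is a map $\phi_\psi$ that is injective (a simplexwise linear embedding). A geometric symmetry of a polyhedral realization $\phi_\psi$ is an isometry $g$ of $\mathbb{R}^3$ that maps $\phi_\psi(|\Delta|)$ to itself and is induced by an automorphism $\alpha$ of $\Delta$, i.e. $g\circ\phi_\psi=\phi_\psi\circ|\alpha|$. The realization has $2$-fold rotational symmetry if a rotation of order $2$ about a line is a geometric symmetry of it. *)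

theory Defs
  imports "HOL-Analysis.Analysis"
begin

section \<open>Abstract simplicial complexes and their underlying spaces\<close>

text \<open>
  A complex is given by its set of nonempty faces; its vertices are the elements of its faces.
  (\<^term>\<open>simplicial_complex\<close> from \<^theory>\<open>HOL-Analysis.Polytope\<close> is the embedded notion, in which
  the simplices are convex hulls in a fixed Euclidean space.)
\<close>

definition fin_complex :: "'v set set \<Rightarrow> bool" where
  "fin_complex \<Delta> \<longleftrightarrow>
     finite \<Delta> \<and> (\<forall>\<sigma>\<in>\<Delta>. finite \<sigma> \<and> \<sigma> \<noteq> {}) \<and>
     (\<forall>\<sigma>\<in>\<Delta>. \<forall>\<tau>. \<tau> \<subseteq> \<sigma> \<and> \<tau> \<noteq> {} \<longrightarrow> \<tau> \<in> \<Delta>)"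

definition two_dimensional :: "'v set set \<Rightarrow> bool" where
  "two_dimensional \<Delta> \<longleftrightarrow> (\<forall>\<sigma>\<in>\<Delta>. card \<sigma> \<le> 3) \<and> (\<exists>\<sigma>\<in>\<Delta>. card \<sigma> = 3)"

definition vertices :: "'v set set \<Rightarrow> 'v set" where
  "vertices \<Delta> = \<Union>\<Delta>"

definition simplicial_iso :: "'v set set \<Rightarrow> 'w set set \<Rightarrow> ('v \<Rightarrow> 'w) \<Rightarrow> bool" where
  "simplicial_iso \<Delta> \<Gamma> f \<longleftrightarrow> bij_betw f (vertices \<Delta>) (vertices \<Gamma>) \<and> (\<lambda>\<sigma>. f ` \<sigma>) ` \<Delta> = \<Gamma>"

definition isomorphic_complexes :: "'v set set \<Rightarrow> 'w set set \<Rightarrow> bool" where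
  "isomorphic_complexes \<Delta> \<Gamma> \<longleftrightarrow> (\<exists>f. simplicial_iso \<Delta> \<Gamma> f)"

abbreviation simplicial_auto :: "'v set set \<Rightarrow> ('v \<Rightarrow> 'v) \<Rightarrow> bool" where
  "simplicial_auto \<Delta> \<equiv> simplicial_iso \<Delta> \<Delta>"

text \<open>
  Points of the underlying space are systems of barycentric coordinates, extended by zero off
  the carrying face. The topology is induced by pointwise convergence; for finite complexes this
  is the usual topology of the geometric realization.
\<close>

definition underlying_space :: "'v set set \<Rightarrow> ('v \<Rightarrow> real) set" where
  "underlying_space \<Delta> =
     {x. \<exists>\<sigma>\<in>\<Delta>. (\<forall>v. 0 \<le> x v) \<and> (\<forall>v. v \<notin> \<sigma> \<longrightarrow> x v = 0) \<and> (\<Sum>v\<in>\<sigma>. x v) = 1}"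

definition triangulates :: "'v set set \<Rightarrow> 'a topology \<Rightarrow> bool" where
  "triangulates \<Delta> S \<longleftrightarrow>
     fin_complex \<Delta> \<and> two_dimensional \<Delta> \<and> top_of_set (underlying_space \<Delta>) homeomorphic_space S"

text \<open>The map \<open>|\<alpha>|\<close> on underlying spaces induced by a simplicial map \<open>\<alpha>\<close> of \<open>\<Delta>\<close>.\<close>

definition induced_map :: "'v set set \<Rightarrow> ('v \<Rightarrow> 'w) \<Rightarrow> ('v \<Rightarrow> real) \<Rightarrow> ('w \<Rightarrow> real)" where
  "induced_map \<Delta> \<alpha> x = (\<lambda>w. \<Sum>v | v \<in> vertices \<Delta> \<and> \<alpha> v = w. x v)"

section \<open>The orientable closed surface of genus \<open>g\<close>\<close>

definition quotient_topology :: "'a topology \<Rightarrow> ('a \<Rightarrow> 'b) \<Rightarrow> 'b topology" where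
  "quotient_topology X q =
     topology (\<lambda>U. U \<subseteq> q ` topspace X \<and> openin X {x \<in> topspace X. q x \<in> U})"

lemma openin_quotient_topology:
  "openin (quotient_topology X q) U \<longleftrightarrow>
     U \<subseteq> q ` topspace X \<and> openin X {x \<in> topspace X. q x \<in> U}"
proof -
  let ?P = "\<lambda>U. U \<subseteq> q ` topspace X \<and> openin X {x \<in> topspace X. q x \<in> U}"
  have "?P (S \<inter> T)" if "?P S" "?P T" for S T
  proof -
    have "{x \<in> topspace X. q x \<in> S \<inter> T}
        = {x \<in> topspace X. q x \<in> S} \<inter> {x \<in> topspace X. q x \<in> T}" by auto
    then have "openin X {x \<in> topspace X. q x \<in> S \<inter> T}"
      using that by (simp only: openin_Int)
    then show ?thesis using that by blast
  qed
  moreover have "?P (\<Union>\<K>)" if "\<forall>K\<in>\<K>. ?P K" for \<K>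
  proof -
    have "{x \<in> topspace X. q x \<in> \<Union>\<K>} = (\<Union>K\<in>\<K>. {x \<in> topspace X. q x \<in> K})" by auto
    moreover have "openin X (\<Union>K\<in>\<K>. {x \<in> topspace X. q x \<in> K})"
      using that by (intro openin_Union) auto
    ultimately have "openin X {x \<in> topspace X. q x \<in> \<Union>\<K>}"
      by (simp only:)
    then show ?thesis using that by blast
  qed
  ultimately have "istopology ?P"
    unfolding istopology_def by (intro conjI allI impI) simp_all
  then show ?thesis
    unfolding quotient_topology_def by (simp only: topology_inverse')
qed

lemma topspace_quotient_topology: "topspace (quotient_topology X q) = q ` topspace X"
proof
  show "topspace (quotient_topology X q) \<subseteq> q ` topspace X"
    using openin_topspace[of "quotient_topology X q"]
    unfolding openin_quotient_topology by (rule conjunct1)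
  have "{x \<in> topspace X. q x \<in> q ` topspace X} = topspace X" by auto
  then have "openin (quotient_topology X q) (q ` topspace X)"
    by (simp add: openin_quotient_topology)
  then show "q ` topspace X \<subseteq> topspace (quotient_topology X q)"
    by (rule openin_subset)
qed

lemma quotient_map_quotient_topology: "quotient_map X (quotient_topology X q) q"
  unfolding quotient_map_def topspace_quotient_topology openin_quotient_topology by blast

text \<open>
  For \<open>g \<ge> 1\<close>, the surface is the quotient of a \<open>4g\<close>-gon by the boundary word
  \<open>a\<^sub>1 b\<^sub>1 a\<^sub>1\<inverse> b\<^sub>1\<inverse> \<dots> a\<^sub>g b\<^sub>g a\<^sub>g\<inverse> b\<^sub>g\<inverse>\<close>. The polygon is modelled by the closed unit disc; its side
  number \<open>k\<close> is the arc of points \<open>cis (2 * pi * (k + s) / (4 * g))\<close> with \<open>0 \<le> s \<le> 1\<close>. Each side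
  \<open>k\<close> with \<open>k mod 4 \<in> {0, 1}\<close> is glued to side \<open>k + 2\<close> with reversed direction, so the point of
  parameter \<open>s\<close> on side \<open>k\<close> is identified with the point of parameter \<open>1 - s\<close> on side \<open>k + 2\<close>.
  (For \<open>g = 0\<close> nothing is glued, and the definition does not yield the sphere.)
\<close>

definition side_gluing :: "nat \<Rightarrow> (complex \<times> complex) set" where
  "side_gluing g =
     {(cis (2 * pi * (real k + s) / (4 * real g)),
       cis (2 * pi * (real (k + 2) + (1 - s)) / (4 * real g))) | k s.
        k < 4 * g \<and> k mod 4 \<in> {0, 1} \<and> 0 \<le> s \<and> s \<le> 1}"

definition orientable_surface :: "nat \<Rightarrow> complex set topology" where
  "orientable_surface g =
     quotient_topology (top_of_set (cball 0 1))
       (\<lambda>z. (side_gluing g \<union> (side_gluing g)\<inverse>)\<^sup>* `` {z})"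

section \<open>Polyhedral realizations and their symmetries\<close>

definition simplexwise_linear :: "'v set set \<Rightarrow> ('v \<Rightarrow> real^3) \<Rightarrow> ('v \<Rightarrow> real) \<Rightarrow> real^3" where
  "simplexwise_linear \<Delta> \<psi> x = (\<Sum>v\<in>vertices \<Delta>. x v *\<^sub>R \<psi> v)"

definition polyhedral_realization :: "'v set set \<Rightarrow> ('v \<Rightarrow> real^3) \<Rightarrow> bool" where
  "polyhedral_realization \<Delta> \<psi> \<longleftrightarrow> inj_on (simplexwise_linear \<Delta> \<psi>) (underlying_space \<Delta>)"

definition geometric_symmetry ::
    "'v set set \<Rightarrow> ('v \<Rightarrow> real^3) \<Rightarrow> (real^3 \<Rightarrow> real^3) \<Rightarrow> bool" where
  "geometric_symmetry \<Delta> \<psi> h \<longleftrightarrow>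
     (\<forall>x y. dist (h x) (h y) = dist x y) \<and>
     h ` simplexwise_linear \<Delta> \<psi> ` underlying_space \<Delta>
       = simplexwise_linear \<Delta> \<psi> ` underlying_space \<Delta> \<and>
     (\<exists>\<alpha>. simplicial_auto \<Delta> \<alpha> \<and>
       (\<forall>x\<in>underlying_space \<Delta>.
          h (simplexwise_linear \<Delta> \<psi> x) = simplexwise_linear \<Delta> \<psi> (induced_map \<Delta> \<alpha> x)))"

text \<open>Rotation about the line through \<open>p\<close> with direction \<open>u\<close>.\<close>

definition rotation_about_line :: "real^3 \<Rightarrow> real^3 \<Rightarrow> (real^3 \<Rightarrow> real^3) \<Rightarrow> bool" where
  "rotation_about_line p u h \<longleftrightarrow>
     u \<noteq> 0 \<and> (\<exists>A::real^3^3. rotation_matrix A \<and> A *v u = u \<and> (\<forall>x. h x = p + A *v (x - p)))"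

definition twofold_rotation :: "(real^3 \<Rightarrow> real^3) \<Rightarrow> bool" where
  "twofold_rotation h \<longleftrightarrow> (\<exists>p u. rotation_about_line p u h) \<and> h \<noteq> id \<and> h \<circ> h = id"

definition twofold_rotational_symmetry :: "'v set set \<Rightarrow> ('v \<Rightarrow> real^3) \<Rightarrow> bool" where
  "twofold_rotational_symmetry \<Delta> \<psi> \<longleftrightarrow> (\<exists>h. twofold_rotation h \<and> geometric_symmetry \<Delta> \<psi> h)"

end

theory Submission
  imports Defs
begin

text \<open>
  The 35 triangulations have an involution exchanging six pairs of vertices, and in the realizations the
  vertices of a pair have coordinates \<open>(x, y, z)\<close> and \<open>(- x, - y, z)\<close>; they were found by enumerating such
  triangulations and minimising the number of crossings between edges and triangles. Any two facets of a
  realization are separated by a plane through three vertices, which proves that it is embedded. The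
  triangulations are distinguished by an invariant formed from the vertex degrees. Bistellar moves are
  induced by explicit homeomorphisms of the underlying spaces, and such moves connect all these
  triangulations with one that is obtained by gluing the sides of a triangulated polygon with 20 sides.
  The latter and the surface are quotients of the same compact space with the same fibres.
\<close>
section \<open>Bistellar moves\<close>

text \<open>What has to be shown is a homeomorphism with one fixed quotient of the disc, so every
  identification of spaces is made by an explicit map. For genus 5 the polygon complex has 60 ring
  vertices, one centre and 21 glued boundary vertices. These 82 vertices are brought down to 12 only
  once: the other 34 surfaces start from a surface already treated and are reached by edge flips
  alone. With 12 vertices, the Euler characteristic -8 forces 60 edges and 40 facets, hence 20
  orbits of facets in each certificate. All numerical facts are decided by rewriting inside the
  logic, which is why the data are lists of integers and the tests stop as soon as they are decided.
  The symmetry cuts the amount of testing: one facet of each orbit is compared with its partner and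
  with the later orbits, and the half-turn transfers the result to the remaining pairs.\<close>

definition std_simplex :: "'v set \<Rightarrow> ('v \<Rightarrow> real) set" where
  "std_simplex t = {x. (\<forall>v. 0 \<le> x v) \<and> (\<forall>v. v \<notin> t \<longrightarrow> x v = 0) \<and> (\<Sum>v\<in>t. x v) = 1}"

definition generated_complex :: "'v set set \<Rightarrow> 'v set set" where
  "generated_complex F = {\<sigma>. \<sigma> \<noteq> {} \<and> (\<exists>t\<in>F. \<sigma> \<subseteq> t)}"

lemma underlying_space_generated:
  assumes "\<And>t. t \<in> F \<Longrightarrow> finite t"
  shows "underlying_space (generated_complex F) = (\<Union>t\<in>F. std_simplex t)"
proof (intro equalityI subsetI)
  fix x assume "x \<in> underlying_space (generated_complex F)"
  then obtain \<sigma> t where s: "t \<in> F" "\<sigma> \<subseteq> t" "\<forall>v. 0 \<le> x v" "\<forall>v. v \<notin> \<sigma> \<longrightarrow> x v = 0" "(\<Sum>v\<in>\<sigma>. x v) = 1"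
    by (auto simp: underlying_space_def generated_complex_def)
  moreover have "(\<Sum>v\<in>t. x v) = (\<Sum>v\<in>\<sigma>. x v)"
    using s assms by (intro sum.mono_neutral_right) auto
  ultimately show "x \<in> (\<Union>t\<in>F. std_simplex t)"
    by (auto simp: std_simplex_def)
next
  fix x assume "x \<in> (\<Union>t\<in>F. std_simplex t)"
  then obtain t where "t \<in> F" "x \<in> std_simplex t" by blast
  moreover from this have "t \<noteq> {}" by (auto simp: std_simplex_def)
  ultimately show "x \<in> underlying_space (generated_complex F)"
    unfolding underlying_space_def generated_complex_def std_simplex_def by blast
qed

text \<open>
  The bistellar move \<open>A * \<partial>B \<rightarrow> \<partial>A * B\<close> is realised by one formula on barycentric coordinates:
  the smallest weight on \<open>A\<close> is moved evenly from \<open>A\<close> to \<open>B\<close>. It vanishes off the star of \<open>A\<close>.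
\<close>

definition bistellar_map :: "'v set \<Rightarrow> 'v set \<Rightarrow> ('v \<Rightarrow> real) \<Rightarrow> 'v \<Rightarrow> real" where
  "bistellar_map A B x = (\<lambda>v. x v + Min (x ` A) *
     (if v \<in> A then - 1 else if v \<in> B then real (card A) / real (card B) else 0))"

text \<open>This is one direction of the move; the inverse move is the same predicate with
  \<open>A\<close>, \<open>B\<close> and \<open>F\<close>, \<open>F'\<close> exchanged, so a single
  lemma serves both maps. The condition that no facet of \<open>F\<close> contains \<open>B\<close>
  makes the reverse map fix the points off the star of \<open>A\<close>.\<close>

definition bistellar_pair :: "'v set \<Rightarrow> 'v set \<Rightarrow> 'v set set \<Rightarrow> 'v set set \<Rightarrow> bool" where
  "bistellar_pair A B F F' \<longleftrightarrow>
     (\<forall>t\<in>F. if A \<subseteq> t then \<exists>b\<in>B. t = A \<union> B - {b} else t \<in> F') \<and>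
     (\<forall>t\<in>F. \<not> B \<subseteq> t) \<and> (\<forall>a\<in>A. A \<union> B - {a} \<in> F')"

lemma continuous_on_Min_image:
  assumes "finite A" "A \<noteq> {}"
  shows "continuous_on UNIV (\<lambda>x::'v \<Rightarrow> real. Min (x ` A))"
  using assms
proof (induction A rule: finite_ne_induct)
  case (singleton a)
  then show ?case by (auto intro: continuous_on_product_coordinates)
next
  case (insert a A)
  have "(\<lambda>x::'v \<Rightarrow> real. Min (x ` insert a A)) = (\<lambda>x. min (x a) (Min (x ` A)))"
    using insert by auto
  then show ?case
    using insert by (auto intro!: continuous_on_min intro: continuous_on_product_coordinates)
qed

lemma continuous_on_bistellar_map:
  assumes "finite A" "A \<noteq> {}"
  shows "continuous_on S (bistellar_map A B)"
proof -
  have "continuous_on UNIV (\<lambda>x. bistellar_map A B x v)" for v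
    unfolding bistellar_map_def
    by (intro continuous_on_add continuous_on_mult continuous_on_const
        continuous_on_product_coordinates continuous_on_Min_image assms)
  then have "continuous_on UNIV (bistellar_map A B)"
    by (rule continuous_on_coordinatewise_then_product)
  then show ?thesis by (rule continuous_on_subset) simp
qed

lemma Min_image_std_simplex:
  assumes "finite A" "x \<in> std_simplex t" "\<not> A \<subseteq> t"
  shows "Min (x ` A) = 0"
proof -
  obtain a where "a \<in> A" "a \<notin> t" using assms by blast
  then have "x a = 0" using assms by (auto simp: std_simplex_def)
  then show ?thesis
    using assms \<open>a \<in> A\<close> by (intro Min_eqI) (auto simp: std_simplex_def image_iff intro: bexI[of _ a])
qed

lemma bistellar_map_off_star:
  assumes "finite A" "x \<in> std_simplex t" "\<not> A \<subseteq> t"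
  shows "bistellar_map A B x = x"
  using Min_image_std_simplex[OF assms] by (simp add: bistellar_map_def)

text \<open>Let \<open>x\<close> lie in the facet that omits \<open>b\<close>, and let
  \<open>a\<close> be a vertex of \<open>A\<close> with the least weight \<open>m\<close>. The image
  has weight 0 at \<open>a\<close>, so it lies in the facet that omits \<open>a\<close>. Its least
  weight on \<open>B\<close> is \<open>m * c\<close>, attained at \<open>b\<close> because
  \<open>x b = 0\<close>; hence the reverse map gives back exactly \<open>m\<close> to each vertex
  of \<open>A\<close>.\<close>

lemma bistellar_map_inverse:
  assumes fin: "finite A" "finite B" and ne: "A \<noteq> {}" "B \<noteq> {}" and disj: "A \<inter> B = {}"
    and p: "bistellar_pair A B F F'" and x: "x \<in> (\<Union>t\<in>F. std_simplex t)"
  shows "bistellar_map A B x \<in> (\<Union>t\<in>F'. std_simplex t) \<and> bistellar_map B A (bistellar_map A B x) = x"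
proof -
  obtain t where t: "t \<in> F" "x \<in> std_simplex t" using x by blast
  have B: "\<not> B \<subseteq> t" using p t by (auto simp: bistellar_pair_def)
  show ?thesis
  proof (cases "A \<subseteq> t")
    case False
    then have "bistellar_map A B x = x" using bistellar_map_off_star fin t by metis
    moreover have "bistellar_map B A x = x" using bistellar_map_off_star fin t B by metis
    moreover have "t \<in> F'" using p t False by (auto simp: bistellar_pair_def)
    ultimately show ?thesis using t by auto
  next
    case True
    then obtain b where b: "b \<in> B" "t = A \<union> B - {b}"
      using p t(1) unfolding bistellar_pair_def by (metis (no_types, lifting))
    define m where "m = Min (x ` A)"
    define c where "c = real (card A) / real (card B)"
    define y where "y = bistellar_map A B x"
    have cpos: "c > 0" using fin ne by (auto simp: c_def card_gt_0_iff)
    have xn: "0 \<le> x v" for v using t by (auto simp: std_simplex_def)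
    have xz: "x v = 0" if "v \<notin> t" for v using t that by (auto simp: std_simplex_def)
    have "m \<in> x ` A" unfolding m_def using fin ne by (intro Min_in) auto
    then obtain a where a: "a \<in> A" "m = x a" by blast
    have mle: "m \<le> x v" if "v \<in> A" for v unfolding m_def using fin that by (intro Min_le) auto
    have m0: "0 \<le> m" using a xn by simp
    have yA: "y v = x v - m" if "v \<in> A" for v
      using that by (simp add: y_def bistellar_map_def m_def)
    have yB: "y v = x v + m * c" if "v \<in> B" for v
      using that disj by (auto simp: y_def bistellar_map_def m_def c_def)
    have yO: "y v = x v" if "v \<notin> A" "v \<notin> B" for v
      using that disj by (auto simp: y_def bistellar_map_def m_def c_def)
    have xb: "x b = 0" using xz b by blast
    have "(\<Sum>v\<in>A \<union> B. y v) = (\<Sum>v\<in>A. x v - m) + (\<Sum>v\<in>B. x v + m * c)"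
      using fin disj by (simp add: sum.union_disjoint yA yB)
    \<comment> \<open>Each of the \<open>card A\<close> weights loses \<open>m\<close> and each of
      the \<open>card B\<close> weights gains \<open>m * c\<close>; the value
      \<open>c = card A / card B\<close> is the one that balances these.\<close>
    also have "\<dots> = (\<Sum>v\<in>A. x v) + (\<Sum>v\<in>B. x v)"
      using fin ne by (simp add: sum.distrib sum_subtractf c_def)
    also have "\<dots> = (\<Sum>v\<in>A \<union> B. x v)" using fin disj by (simp add: sum.union_disjoint)
    also have "\<dots> = (\<Sum>v\<in>t. x v)" using fin b xb by (intro sum.mono_neutral_right) auto
    finally have sumy: "(\<Sum>v\<in>A \<union> B. y v) = 1" using t by (simp add: std_simplex_def)
    have ya: "y a = 0" using yA a by simp
    have sumy': "(\<Sum>v\<in>A \<union> B - {a}. y v) = 1"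
      using fin ya sumy a by (subst sum.mono_neutral_left[of "A \<union> B"]) auto
    have "y v \<ge> 0" for v
      using yA yB yO xn mle m0 cpos by (metis add_nonneg_nonneg diff_ge_0_iff_ge less_imp_le mult_nonneg_nonneg)
    moreover have "y v = 0" if "v \<notin> A \<union> B - {a}" for v
      using that ya yO xz b by auto
    ultimately have "y \<in> std_simplex (A \<union> B - {a})"
      using sumy' by (auto simp: std_simplex_def)
    moreover have "A \<union> B - {a} \<in> F'" using p a by (auto simp: bistellar_pair_def)
    moreover have "bistellar_map B A y = x"
    proof -
      have mb: "Min (y ` B) = m * c"
      proof (rule Min_eqI)
        show "finite (y ` B)" using fin by simp
        show "m * c \<le> z" if "z \<in> y ` B" for z using that yB xn by auto
        show "m * c \<in> y ` B" using yB[OF b(1)] xb b(1) by (auto simp: image_iff intro!: bexI[of _ b])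
      qed
      have "m * c * (real (card B) / real (card A)) = m"
        using fin ne by (simp add: c_def)
      then have "bistellar_map B A y v = x v" for v
        unfolding bistellar_map_def mb using yA[of v] yB[of v] yO[of v] disj by auto
      then show ?thesis by blast
    qed
    ultimately show ?thesis unfolding y_def by blast
  qed
qed

lemma bistellar_move_homeomorphic:
  assumes "finite A" "finite B" "A \<noteq> {}" "B \<noteq> {}" "A \<inter> B = {}"
    and "bistellar_pair A B F F'" "bistellar_pair B A F' F"
  shows "(\<Union>t\<in>F. std_simplex t) homeomorphic (\<Union>t\<in>F'. std_simplex t)"
proof -
  let ?S = "\<Union>t\<in>F. std_simplex t" and ?T = "\<Union>t\<in>F'. std_simplex t"
  have 1: "bistellar_map A B x \<in> ?T \<and> bistellar_map B A (bistellar_map A B x) = x" if "x \<in> ?S" for x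
    using bistellar_map_inverse[OF assms(1-6)] that by blast
  have 2: "bistellar_map B A x \<in> ?S \<and> bistellar_map A B (bistellar_map B A x) = x" if "x \<in> ?T" for x
    using bistellar_map_inverse[OF assms(2,1,4,3) _ assms(7)] that assms(5) by blast
  have "homeomorphism ?S ?T (bistellar_map A B) (bistellar_map B A)"
    by (intro homeomorphismI continuous_on_bistellar_map) (use assms 1 2 in blast)+
  then show ?thesis unfolding homeomorphic_def by blast
qed

section \<open>The glued polygon as a simplicial complex\<close>

text \<open>
  The disc is triangulated by a centre, an inner ring of \<open>12 g\<close> vertices and \<open>12 g\<close> boundary vertices, so that
  each of the \<open>4 g\<close> sides consists of three edges: with fewer, the glued complex would not be simplicial.
  The ring is labelled \<open>0, \<dots>, 12 g - 1\<close>, the centre \<open>12 g\<close>, and the boundary vertex \<open>i\<close> becomes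
  \<open>bdry_label g i\<close> after gluing, where all corners get the label \<open>12 g + 1\<close>. Four consecutive sides form the
  word \<open>a b a\<inverse> b\<inverse>\<close>, whose twelve vertices carry the offsets \<open>0 1 2 0 4 5 0 2 1 0 5 4\<close>, with \<open>0\<close> for a corner.
\<close>

definition side_label :: "nat \<Rightarrow> nat" where
  "side_label i = 12 * (i div 12) + (let b = i mod 12 in if b < 6 then b else if b < 9 then 9 - b else 15 - b)"

definition bdry_label :: "nat \<Rightarrow> nat \<Rightarrow> nat" where
  "bdry_label g i = 12 * g + (if i mod 3 = 0 then 1 else 2 + side_label i)"

definition next_index :: "nat \<Rightarrow> nat \<Rightarrow> nat" where
  "next_index g i = Suc i mod (12 * g)"

definition polygon_facets :: "nat \<Rightarrow> nat set set" where
  "polygon_facets g = (\<Union>i<12 * g. {{12 * g, i, next_index g i}, {i, next_index g i, bdry_label g i},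
     {next_index g i, bdry_label g i, bdry_label g (next_index g i)}})"

text \<open>The range includes \<open>b = 12\<close>, the first corner of the next block, so that
  both ends of a boundary edge can be written with the same block number \<open>a\<close>.\<close>

lemma bdry_label_at:
  assumes "b \<le> 12"
  shows "bdry_label g (12 * a + b) = 12 * g + (if b \<in> {0,3,6,9,12} then 1
     else 2 + (12 * a + (if b < 6 then b else if b < 9 then 9 - b else 15 - b)))"
proof -
  have "b \<in> {0,1,2,3,4,5,6,7,8,9,10,11,12}"
    using assms by (auto simp: numeral_eq_Suc le_Suc_eq)
  moreover have "(12 * a + b) mod 3 = b mod 3" by presburger
  moreover have "(12 * a + b) mod 12 = b mod 12" by simp
  moreover have "(12 * a + b) div 12 = a" if "b < 12" using that by simp
  ultimately show ?thesis
    unfolding bdry_label_def side_label_def Let_def by (elim insertE emptyE) simp_all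
qed

lemma mod_12_split:
  obtains a b :: nat where "i = 12 * a + b" "b < 12"
  using that[of "i div 12" "i mod 12"] by simp

lemma less_12_cases: "b < 12 \<Longrightarrow> b \<in> {0,1,2,3,4,5,6,7,8,9,10,11::nat}"
  by (auto simp: numeral_eq_Suc less_Suc_eq)

locale surface_polygon =
  fixes g :: nat
  assumes g: "0 < g"
begin

abbreviation "N \<equiv> 12 * g"
abbreviation "lab \<equiv> bdry_label g"
abbreviation "nx \<equiv> next_index g"

lemma lab_gt: "N < lab i"
  by (simp add: bdry_label_def)

text \<open>Indices 0 and \<open>12 * g\<close> are both multiples of 3, that is corners, and all
  corners have one label; so the labels do not notice the wrap-around.\<close>

lemma lab_nx: "i < N \<Longrightarrow> lab (nx i) = lab (Suc i)"
  by (cases "Suc i = N") (auto simp: next_index_def bdry_label_def)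

lemma nx_less: "nx i < N"
  using g by (simp add: next_index_def)

lemma nx_eq: "i < N \<Longrightarrow> nx i = (if Suc i = N then 0 else Suc i)"
  by (simp add: next_index_def)

lemma nx_neq: "i < N \<Longrightarrow> nx i \<noteq> i"
proof -
  assume "i < N"
  moreover have "Suc i = N \<Longrightarrow> 0 < i" using g by presburger
  ultimately show ?thesis by (auto simp: nx_eq)
qed

lemma nx_nx_neq: "i < N \<Longrightarrow> nx (nx i) \<noteq> i"
proof -
  assume "i < N"
  moreover have "Suc i = N \<Longrightarrow> 1 < i" "Suc (Suc i) = N \<Longrightarrow> 0 < i" "1 < N" using g by presburger+
  ultimately show ?thesis by (auto simp: nx_eq)
qed

lemma nx_inj: "i < N \<Longrightarrow> j < N \<Longrightarrow> nx i = nx j \<Longrightarrow> i = j"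
  using nx_eq by (auto split: if_splits)

lemma lab_Suc_neq: "lab i \<noteq> lab (Suc i)"
proof -
  obtain a b where i: "i = 12 * a + b" "b < 12" by (rule mod_12_split)
  have "lab (Suc i) = lab (12 * a + (b + 1))" using i by simp
  moreover have "b + 1 \<le> 12" "b \<le> 12" using i by auto
  ultimately show ?thesis
    using less_12_cases[OF i(2)] unfolding i(1) by (simp only: bdry_label_at) (elim insertE emptyE; simp)
qed

section \<open>The gluing relation on the boundary circle\<close>

definition pos :: "real \<Rightarrow> complex" where
  "pos t = cis (2 * pi * t / real N)"

definition glued :: "real \<Rightarrow> real \<Rightarrow> bool" where
  "glued t t' \<longleftrightarrow> (pos t, pos t') \<in> (side_gluing g \<union> (side_gluing g)\<inverse>)\<^sup>*"

lemma glued_refl [simp]: "glued t t"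
  by (simp add: glued_def)

lemma glued_sym: "glued t t' \<Longrightarrow> glued t' t"
  unfolding glued_def by (meson symD sym_rtrancl sym_Un_converse)

lemma glued_trans: "glued t t' \<Longrightarrow> glued t' t'' \<Longrightarrow> glued t t''"
  unfolding glued_def by (rule rtrancl_trans)

text \<open>In the parameter of \<open>pos\<close> the circle has length \<open>N\<close> and side
  \<open>k\<close> occupies the interval from \<open>3 k\<close> to \<open>3 k + 3\<close>. With
  \<open>\<tau> = 3 s\<close>, the partner point on side \<open>k + 2\<close> has parameter
  \<open>3 (k + 2) + 3 (1 - s) = 3 k + 9 - \<tau>\<close>.\<close>

lemma side_gluing_iff:
  "(z, z') \<in> side_gluing g \<longleftrightarrow>
     (\<exists>k \<tau>. k < 4 * g \<and> k mod 4 \<in> {0, 1} \<and> 0 \<le> \<tau> \<and> \<tau> \<le> 3 \<and> z = pos (3 * real k + \<tau>) \<and> z' = pos (3 * real k + 9 - \<tau>))"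
proof -
  have *: "cis (2 * pi * (real k + s) / (4 * real g)) = pos (3 * real k + 3 * s)"
    "cis (2 * pi * (real (k + 2) + (1 - s)) / (4 * real g)) = pos (3 * real k + 9 - 3 * s)" for k s
    using g by (auto simp: pos_def field_simps intro!: arg_cong[of _ _ cis])
  have "(z, z') \<in> side_gluing g \<longleftrightarrow> (\<exists>k s. k < 4 * g \<and> k mod 4 \<in> {0, 1} \<and> 0 \<le> s \<and> s \<le> 1 \<and>
      z = pos (3 * real k + 3 * s) \<and> z' = pos (3 * real k + 9 - 3 * s))"
  proof -
    have "(z, z') \<in> side_gluing g \<longleftrightarrow> (\<exists>k s. z = cis (2 * pi * (real k + s) / (4 * real g)) \<and>
        z' = cis (2 * pi * (real (k + 2) + (1 - s)) / (4 * real g)) \<and>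
        k < 4 * g \<and> k mod 4 \<in> {0, 1} \<and> 0 \<le> s \<and> s \<le> 1)"
      unfolding side_gluing_def mem_Collect_eq prod.inject conj_assoc by (rule refl)
    moreover have "3 * real (k + 2) + 3 * (1 - s) = 3 * real k + 9 - 3 * s" for k s by simp
    ultimately show ?thesis unfolding * by (simp only: conj_ac)
  qed
  also have "\<dots> \<longleftrightarrow> (\<exists>k \<tau>. k < 4 * g \<and> k mod 4 \<in> {0, 1} \<and> 0 \<le> \<tau> \<and> \<tau> \<le> 3 \<and>
      z = pos (3 * real k + \<tau>) \<and> z' = pos (3 * real k + 9 - \<tau>))"
  proof (rule iffI; elim exE conjE)
    fix k \<tau> assume "k < 4 * g" "k mod 4 \<in> {0, 1}" "0 \<le> \<tau>" "\<tau> \<le> 3"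
      "z = pos (3 * real k + \<tau>)" "z' = pos (3 * real k + 9 - \<tau>)"
    then show "\<exists>k s. k < 4 * g \<and> k mod 4 \<in> {0, 1} \<and> 0 \<le> s \<and> s \<le> 1 \<and>
      z = pos (3 * real k + 3 * s) \<and> z' = pos (3 * real k + 9 - 3 * s)"
      by (intro exI[of _ k] exI[of _ "\<tau> / 3"]) auto
  next
    fix k s assume "k < 4 * g" "k mod 4 \<in> {0, 1}" "0 \<le> s" "s \<le> 1"
      "z = pos (3 * real k + 3 * s)" "z' = pos (3 * real k + 9 - 3 * s)"
    then show "\<exists>k \<tau>. k < 4 * g \<and> k mod 4 \<in> {0, 1} \<and> 0 \<le> \<tau> \<and> \<tau> \<le> 3 \<and>
      z = pos (3 * real k + \<tau>) \<and> z' = pos (3 * real k + 9 - \<tau>)"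
      by (intro exI[of _ k] exI[of _ "3 * s"]) auto
  qed
  finally show ?thesis .
qed

lemma glued_side:
  assumes "k < 4 * g" "k mod 4 \<in> {0, 1}" "0 \<le> \<tau>" "\<tau> \<le> 3"
  shows "glued (3 * real k + \<tau>) (3 * real k + 9 - \<tau>)"
proof -
  have "(pos (3 * real k + \<tau>), pos (3 * real k + 9 - \<tau>)) \<in> side_gluing g"
    unfolding side_gluing_iff by (intro exI[of _ k] exI[of _ \<tau>] conjI assms refl)
  then show ?thesis unfolding glued_def by (intro r_into_rtrancl UnI1)
qed

lemma glued_sides:
  assumes "a < g" "0 \<le> \<tau>" "\<tau> \<le> 3"
  shows "glued (12 * real a + \<tau>) (12 * real a + 9 - \<tau>)"
    "glued (12 * real a + 3 + \<tau>) (12 * real a + 12 - \<tau>)"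
proof -
  show "glued (12 * real a + \<tau>) (12 * real a + 9 - \<tau>)"
    using glued_side[of "4 * a" \<tau>] assms by simp
  have "(4 * a + 1) mod 4 \<in> {0, 1}" by (simp add: mod_add_eq[symmetric])
  moreover have "3 * real (4 * a + 1) = 12 * real a + 3" by simp
  ultimately show "glued (12 * real a + 3 + \<tau>) (12 * real a + 12 - \<tau>)"
    using glued_side[of "4 * a + 1" \<tau>] assms by (simp add: algebra_simps)
qed

text \<open>The ends of the two glued pairs of sides give the pairs (0,9), (3,6) and (3,12), (6,9)
  of offsets, which form the chain 0, 9, 6, 3, 12.\<close>

lemma glued_corners:
  assumes "a < g" "c \<in> {0, 3, 6, 9, 12}"
  shows "glued (12 * real a) (12 * real a + c)"
proof -
  let ?x = "12 * real a"
  have h: "glued ?x (?x + 9)" "glued (?x + 3) (?x + 6)" "glued (?x + 3) (?x + 12)" "glued (?x + 6) (?x + 9)"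
    using glued_sides[OF assms(1), of 0] glued_sides[OF assms(1), of 3] by (simp_all add: algebra_simps)
  have "glued ?x (?x + 6)" by (rule glued_trans[OF h(1) glued_sym[OF h(4)]])
  moreover from this have h3: "glued ?x (?x + 3)" by (rule glued_trans[OF _ glued_sym[OF h(2)]])
  moreover from this have "glued ?x (?x + 12)" by (rule glued_trans[OF _ h(3)])
  ultimately show ?thesis using h(1) assms(2) by auto
qed

text \<open>Offset 12 of a block is offset 0 of the next one, so the chains of the blocks join and
  all corners of the polygon become one point.\<close>

lemma glued_corner: "a \<le> g \<Longrightarrow> glued 0 (12 * real a)"
proof (induction a)
  case (Suc a)
  then have "glued (12 * real a) (12 * real a + 12)" by (intro glued_corners) auto
  then show ?case using Suc glued_trans[of 0 "12 * real a"] by (simp add: algebra_simps)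
qed simp

lemma glued_corner_offset:
  assumes "12 * a + b \<le> N" "b \<in> {0,3,6,9}"
  shows "glued 0 (real (12 * a + b))"
proof (cases "a < g")
  case True
  have "glued (12 * real a) (12 * real a + real b)"
    using assms(2) by (intro glued_corners True) auto
  then have "glued 0 (12 * real a + real b)"
    using glued_corner[of a] True glued_trans by (meson less_imp_le)
  then show ?thesis by simp
next
  case False
  then have "a = g" "b = 0" using assms(1) by linarith+
  then show ?thesis using glued_corner[of g] by simp
qed

lemma glued_side_offset:
  assumes "a < g" "(b, c) \<in> {(1,8),(2,7),(4,11),(5,10)}"
  shows "glued (real (12 * a + b)) (real (12 * a + c))"
proof -
  have "glued (12 * real a + 1) (12 * real a + 8)" "glued (12 * real a + 2) (12 * real a + 7)"
    "glued (12 * real a + 4) (12 * real a + 11)" "glued (12 * real a + 5) (12 * real a + 10)"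
    using glued_sides[OF assms(1), of 1] glued_sides[OF assms(1), of 2] by (simp_all add: algebra_simps)
  then show ?thesis using assms(2) by auto
qed

text \<open>Besides the corners, labels coincide only at mirror positions: the offsets add up to 9
  on the sides of the first letter and to 15 on those of the second. These are exactly the
  coincidences that the gluing produces.\<close>

lemma bdry_label_eq_cases:
  assumes "lab (12 * a + b) = lab (12 * a' + b')" "b < 12" "b' < 12"
  shows "(b \<in> {0,3,6,9} \<and> b' \<in> {0,3,6,9}) \<or> (b \<notin> {0,3,6,9} \<and> b' \<notin> {0,3,6,9} \<and> a = a' \<and>
     (b = b' \<or> (b, b') \<in> {(1,8),(2,7),(4,11),(5,10)} \<or> (b', b) \<in> {(1,8),(2,7),(4,11),(5,10)}))"
proof -
  define e where "e b = (if b < 6 then b else if b < 9 then 9 - b else 15 - b)" for b :: nat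
  have l: "lab (12 * a + b) = N + (if b \<in> {0,3,6,9} then 1 else 2 + (12 * a + e b))" if "b < 12" for a b
    using that by (simp add: bdry_label_at e_def)
  have e12: "b < 12 \<Longrightarrow> e b < 12" for b by (auto simp: e_def)
  have 1: "a = a' \<and> e b = e b'" if "12 * a + e b = 12 * a' + e b'"
    using that e12[OF assms(2)] e12[OF assms(3)] by presburger
  have "list_all (\<lambda>b. list_all (\<lambda>b'. e b = e b' \<longrightarrow> b \<in> {0,3,6,9} \<or> b' \<in> {0,3,6,9} \<or> b = b' \<or>
      (b, b') \<in> {(1,8),(2,7),(4,11),(5,10)} \<or> (b', b) \<in> {(1,8),(2,7),(4,11),(5,10)}) [0..<12]) [0..<12]"
    unfolding e_def by code_simp
  then have 2: "b = b' \<or> (b, b') \<in> {(1,8),(2,7),(4,11),(5,10)} \<or> (b', b) \<in> {(1,8),(2,7),(4,11),(5,10)}"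
    if "e b = e b'" "b \<notin> {0,3,6,9}" "b' \<notin> {0,3,6,9}"
    using that assms(2,3) unfolding list_all_iff set_upt by (meson atLeastLessThan_iff zero_le)
  show ?thesis
  proof (cases "b \<in> {0,3,6,9}")
    case True
    then show ?thesis using assms(1) unfolding l[OF assms(2)] l[OF assms(3)] by (simp split: if_splits)
  next
    case False
    moreover from this have n: "b' \<notin> {0,3,6,9}"
      using assms(1) unfolding l[OF assms(2)] l[OF assms(3)] by (auto split: if_splits)
    moreover have "12 * a + e b = 12 * a' + e b'"
      using False n assms(1) unfolding l[OF assms(2)] l[OF assms(3)] by simp
    ultimately have "a = a'" "e b = e b'" using 1 by auto
    then show ?thesis using False n 2[OF _ False n] by (simp only: simp_thms)
  qed
qed

lemma glued_label:
  assumes "i \<le> N" "j \<le> N" "lab i = lab j"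
  shows "glued (real i) (real j)"
proof -
  obtain a b where i: "i = 12 * a + b" "b < 12" by (rule mod_12_split)
  obtain a' b' where j: "j = 12 * a' + b'" "b' < 12" by (rule mod_12_split)
  have ag: "a < g" if "b \<notin> {0,3,6,9}"
  proof -
    have "b \<noteq> 0" using that by simp
    then show ?thesis using assms(1) i(1) by linarith
  qed
  from bdry_label_eq_cases[OF assms(3)[unfolded i(1) j(1)] i(2) j(2)]
  consider "b \<in> {0,3,6,9}" "b' \<in> {0,3,6,9}" | "a = a'" "b = b'"
    | "b \<notin> {0,3,6,9}" "a = a'" "(b, b') \<in> {(1,8),(2,7),(4,11),(5,10)}"
    | "b \<notin> {0,3,6,9}" "a = a'" "(b', b) \<in> {(1,8),(2,7),(4,11),(5,10)}"
    by argo
  then show ?thesis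
  proof cases
    case 1
    then show ?thesis
      using glued_corner_offset[of a b] glued_corner_offset[of a' b'] assms(1,2) glued_sym glued_trans
      unfolding i(1) j(1) by meson
  next
    case 2
    then show ?thesis by (simp add: i(1) j(1))
  next
    case 3
    then show ?thesis using glued_side_offset[OF ag] unfolding i(1) j(1) by meson
  next
    case 4
    then show ?thesis using glued_side_offset[OF ag] glued_sym unfolding i(1) j(1) by meson
  qed
qed


text \<open>
  The \<open>i\<close>-th sector of the disc has coordinates \<open>0 \<le> r \<le> 2\<close> and \<open>0 \<le> s \<le> 1\<close>. The part \<open>r \<le> 1\<close> is the cone from the
  centre to the ring edge; the square \<open>1 \<le> r\<close> between ring and boundary is cut by its diagonal \<open>r + s = 2\<close>.
  The weights belong to the ring vertices \<open>i\<close>, \<open>i + 1\<close> and the boundary vertices \<open>i\<close>, \<open>i + 1\<close>.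
\<close>

definition ring_weight :: "real \<Rightarrow> real \<Rightarrow> real" where "ring_weight r s = min (r * (1 - s)) (max 0 (2 - r - s))"
definition next_ring_weight :: "real \<Rightarrow> real \<Rightarrow> real" where "next_ring_weight r s = min (r * s) (min s (2 - r))"
definition bdry_weight :: "real \<Rightarrow> real \<Rightarrow> real" where "bdry_weight r s = max 0 (min (r - 1) (1 - s))"
definition next_bdry_weight :: "real \<Rightarrow> real \<Rightarrow> real" where "next_bdry_weight r s = max 0 (r + s - 2)"

text \<open>By the minima and maxima in the weights, one formula covers all three triangles of the
  sector, so continuity follows from the form of the expression without joining pieces along their
  common edges.\<close>

definition polygon_map :: "nat \<Rightarrow> real \<Rightarrow> real \<Rightarrow> nat \<Rightarrow> real" where
  "polygon_map i r s v = of_bool (v = N) * max 0 (1 - r) + of_bool (v = i) * ring_weight r s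
     + of_bool (v = nx i) * next_ring_weight r s + of_bool (v = lab i) * bdry_weight r s + of_bool (v = lab (nx i)) * next_bdry_weight r s"

definition cone_map :: "nat \<Rightarrow> real \<Rightarrow> real \<Rightarrow> complex" where
  "cone_map i r s = of_real (r / 2) * pos (real i + s)"

section \<open>Recovering sector and position from the barycentric weights\<close>

lemma weights_inner:
  assumes "0 \<le> r" "r \<le> 1" "0 \<le> s" "s \<le> 1"
  shows "ring_weight r s = r * (1 - s)" "next_ring_weight r s = r * s" "bdry_weight r s = 0" "next_bdry_weight r s = 0"
proof -
  \<comment> \<open>The product equals \<open>2 - r - s\<close> minus \<open>r * (1 - s)\<close>, so
    its sign decides the minimum in \<open>ring_weight\<close>; for \<open>1 \<le> r\<close> the
    sign is the opposite one.\<close>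
  have "0 \<le> (1 - r) * (2 - s)" "r * s \<le> s" "r * s \<le> r"
    using assms by (auto simp: mult_left_le mult_left_le_one_le)
  then show "ring_weight r s = r * (1 - s)" "next_ring_weight r s = r * s" "bdry_weight r s = 0" "next_bdry_weight r s = 0"
    using assms by (auto simp: ring_weight_def next_ring_weight_def bdry_weight_def next_bdry_weight_def algebra_simps)
qed

lemma weights_outer:
  assumes "1 \<le> r" "r \<le> 2" "0 \<le> s" "s \<le> 1"
  shows "ring_weight r s = max 0 (2 - r - s)" "next_ring_weight r s = min s (2 - r)" "bdry_weight r s = min (r - 1) (1 - s)"
    "next_bdry_weight r s = max 0 (r + s - 2)"
proof -
  have "0 \<le> (r - 1) * (2 - s)" "s \<le> r * s" "0 \<le> r * (1 - s)"
    using assms mult_right_mono[of 1 r s] by simp_all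
  then show "ring_weight r s = max 0 (2 - r - s)" "next_ring_weight r s = min s (2 - r)" "bdry_weight r s = min (r - 1) (1 - s)"
    "next_bdry_weight r s = max 0 (r + s - 2)"
    using assms by (auto simp: ring_weight_def next_ring_weight_def bdry_weight_def next_bdry_weight_def algebra_simps min_def max_def)
qed

lemma weights_nonneg:
  assumes "0 \<le> r" "r \<le> 2" "0 \<le> s" "s \<le> 1"
  shows "0 \<le> ring_weight r s" "0 \<le> next_ring_weight r s" "0 \<le> bdry_weight r s" "0 \<le> next_bdry_weight r s"
  using assms by (auto simp: ring_weight_def next_ring_weight_def bdry_weight_def next_bdry_weight_def)

lemma lab_nx_neq: "i < N \<Longrightarrow> lab (nx i) \<noteq> lab i"
  using lab_Suc_neq[of i] by (simp add: lab_nx)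

lemma polygon_map_at:
  assumes "i < N"
  shows "polygon_map i r s N = max 0 (1 - r)"
    "v < N \<Longrightarrow> polygon_map i r s v = of_bool (v = i) * ring_weight r s + of_bool (v = nx i) * next_ring_weight r s"
    "polygon_map i r s (lab j) = of_bool (lab j = lab i) * bdry_weight r s + of_bool (lab j = lab (nx i)) * next_bdry_weight r s"
  using assms nx_less[of i] lab_gt[of i] lab_gt[of "nx i"] lab_gt[of j] by (auto simp: polygon_map_def)

lemma polygon_map_right_end:
  assumes "i < N" "0 \<le> r" "r \<le> 2"
  shows "polygon_map i r 1 = polygon_map (nx i) r 0"
proof (cases "r \<le> 1")
  case True
  then show ?thesis using weights_inner[OF assms(2) True]
    by (auto simp: polygon_map_def fun_eq_iff)
next
  case False
  then show ?thesis using weights_outer[of r] assms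
    by (auto simp: polygon_map_def fun_eq_iff)
qed

lemma polygon_map_centre:
  assumes "0 \<le> s" "s \<le> 1"
  shows "polygon_map i 0 s = (\<lambda>v. of_bool (v = N))"
  using weights_inner[of 0 s] assms by (auto simp: polygon_map_def)

text \<open>On a cycle with more than two vertices, different edges share at most one vertex. Equal
  weights on two different edges must therefore sit entirely on a common vertex, and since the total
  is positive such a vertex exists.\<close>

lemma cyclic_weights_cases:
  fixes a b a' b' :: real
  assumes ij: "i < N" "j < N" and nonneg: "0 \<le> a" "0 \<le> b" "0 \<le> a'" "0 \<le> b'" and pos: "0 < a + b"
    and eq: "\<And>v. v < N \<Longrightarrow> of_bool (v = i) * a + of_bool (v = nx i) * b
        = of_bool (v = j) * a' + of_bool (v = nx j) * b'"
  shows "(i = j \<and> a = a' \<and> b = b') \<or> (j = nx i \<and> a = 0 \<and> b' = 0 \<and> b = a')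
     \<or> (i = nx j \<and> a' = 0 \<and> b = 0 \<and> a = b')"
proof -
  note n = nx_neq[OF ij(1)] nx_neq[OF ij(2)] nx_nx_neq[OF ij(1)] nx_nx_neq[OF ij(2)]
  note e = eq[OF ij(1)] eq[OF ij(2)] eq[OF nx_less[of i]] eq[OF nx_less[of j]]
  consider "i = j" | "j = nx i" | "i = nx j" | "i \<noteq> j" "j \<noteq> nx i" "i \<noteq> nx j" by blast
  then show ?thesis
  proof cases
    case 1
    then show ?thesis using e n by simp
  next
    case 2
    then show ?thesis using e n by (simp add: eq_commute[of i])
  next
    case 3
    then show ?thesis using e n by (simp add: eq_commute[of j])
  next
    case 4
    have "nx i \<noteq> nx j" using nx_inj[OF ij] 4 by blast
    then show ?thesis using e(1,3) n 4 pos by simp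
  qed
qed

lemma cone_map_right_end:
  assumes "i < N"
  shows "cone_map i r 1 = cone_map (nx i) r 0"
proof (cases "Suc i = N")
  case True
  then have "real i + 1 = real N" by simp
  then have "pos (real i + 1) = cis (2 * pi)" using g by (simp add: pos_def)
  then show ?thesis using True assms by (simp add: cone_map_def nx_eq pos_def)
next
  case False
  then show ?thesis using assms by (simp add: cone_map_def nx_eq add.commute)
qed

text \<open>The ring carries the total weight \<open>2 - r > 0\<close>, which fixes the sector up to
  a common side. Beyond the diagonal the ring weights no longer depend on \<open>s\<close>, and
  there the weight \<open>1 - s\<close> of the boundary vertex has to decide.\<close>

lemma polygon_map_eq_outer:
  assumes ij: "i < N" "j < N" and r: "1 \<le> r" "r < 2" and s: "0 \<le> s" "s \<le> 1" "0 \<le> s'" "s' \<le> 1"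
    and eq: "polygon_map i r s = polygon_map j r s'"
  shows "(i = j \<and> s = s') \<or> (j = nx i \<and> s = 1 \<and> s' = 0) \<or> (i = nx j \<and> s' = 1 \<and> s = 0)"
proof -
  note w = weights_outer[OF r(1) less_imp_le[OF r(2)] s(1,2)] weights_outer[OF r(1) less_imp_le[OF r(2)] s(3,4)]
  have E: "of_bool (v = i) * ring_weight r s + of_bool (v = nx i) * next_ring_weight r s
      = of_bool (v = j) * ring_weight r s' + of_bool (v = nx j) * next_ring_weight r s'" if "v < N" for v
    using polygon_map_at(2)[OF ij(1) that, of r s] polygon_map_at(2)[OF ij(2) that, of r s'] eq by simp
  have p: "0 < ring_weight r s + next_ring_weight r s" unfolding w using r s by (auto simp: min_def max_def)
  have "(i = j \<and> ring_weight r s = ring_weight r s' \<and> next_ring_weight r s = next_ring_weight r s') \<or> (j = nx i \<and> ring_weight r s = 0 \<and> next_ring_weight r s' = 0 \<and> next_ring_weight r s = ring_weight r s')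
     \<or> (i = nx j \<and> ring_weight r s' = 0 \<and> next_ring_weight r s = 0 \<and> ring_weight r s = next_ring_weight r s')"
    using r s p by (intro cyclic_weights_cases ij weights_nonneg E) auto
  moreover have C: "bdry_weight r s = bdry_weight r s'" if "i = j"
    using polygon_map_at(3)[OF ij(1), of r s i] polygon_map_at(3)[OF ij(1), of r s' i] eq that lab_nx_neq[OF ij(1)] by simp
  \<comment> \<open>Through the gluing, \<open>lab (nx j)\<close> may coincide with
    \<open>lab i\<close>, but its weight \<open>next_bdry_weight r 0\<close> vanishes because
    \<open>r < 2\<close>.\<close>
  moreover have C1: "bdry_weight r s = 0" if "j = nx i" "s' = 0"
    using polygon_map_at(3)[OF ij(1), of r s i] polygon_map_at(3)[OF ij(2), of r s' i] eq that
      lab_nx_neq[OF ij(1)] w(8) r by simp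
  moreover have C2: "bdry_weight r s' = 0" if "i = nx j" "s = 0"
    using polygon_map_at(3)[OF ij(2), of r s' j] polygon_map_at(3)[OF ij(1), of r s j] eq that
      lab_nx_neq[OF ij(2)] w(4) r by simp
  ultimately show ?thesis using r s unfolding w by (auto simp: min_def max_def split: if_splits)
qed

lemma polygon_map_eq_inner:
  assumes ij: "i < N" "j < N" and r: "0 < r" "r \<le> 1" and s: "0 \<le> s" "s \<le> 1" "0 \<le> s'" "s' \<le> 1"
    and eq: "polygon_map i r s = polygon_map j r s'"
  shows "(i = j \<and> s = s') \<or> (j = nx i \<and> s = 1 \<and> s' = 0) \<or> (i = nx j \<and> s' = 1 \<and> s = 0)"
proof -
  note w = weights_inner[OF less_imp_le[OF r(1)] r(2) s(1,2)] weights_inner[OF less_imp_le[OF r(1)] r(2) s(3,4)]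
  have E: "of_bool (v = i) * ring_weight r s + of_bool (v = nx i) * next_ring_weight r s
      = of_bool (v = j) * ring_weight r s' + of_bool (v = nx j) * next_ring_weight r s'" if "v < N" for v
    using polygon_map_at(2)[OF ij(1) that, of r s] polygon_map_at(2)[OF ij(2) that, of r s'] eq by simp
  have p: "0 < ring_weight r s + next_ring_weight r s" unfolding w using r by (simp add: algebra_simps)
  have "(i = j \<and> ring_weight r s = ring_weight r s' \<and> next_ring_weight r s = next_ring_weight r s') \<or> (j = nx i \<and> ring_weight r s = 0 \<and> next_ring_weight r s' = 0 \<and> next_ring_weight r s = ring_weight r s')
     \<or> (i = nx j \<and> ring_weight r s' = 0 \<and> next_ring_weight r s = 0 \<and> ring_weight r s = next_ring_weight r s')"
    using r s p by (intro cyclic_weights_cases ij weights_nonneg E) auto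
  then show ?thesis using r s unfolding w by auto
qed

lemma polygon_map_sum:
  assumes "i < N" shows "(\<Sum>v<N. polygon_map i r s v) = ring_weight r s + next_ring_weight r s"
proof -
  have "(\<Sum>v<N. polygon_map i r s v) = (\<Sum>v<N. (if v = i then ring_weight r s else 0) + (if v = nx i then next_ring_weight r s else 0))"
    using polygon_map_at(2)[OF assms] by (intro sum.cong) auto
  then show ?thesis using assms nx_less by (simp add: sum.distrib)
qed

text \<open>For \<open>r \<le> 1\<close> the centre carries the weight \<open>1 - r\<close>; for
  \<open>1 \<le> r\<close> the two ring vertices together carry \<open>2 - r\<close>. Either
  quantity determines \<open>r\<close>.\<close>

lemma polygon_map_eq_radius:
  assumes ij: "i < N" "j < N" and r: "0 \<le> r" "r \<le> 2" "0 \<le> r'" "r' \<le> 2"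
    and s: "0 \<le> s" "s \<le> 1" "0 \<le> s'" "s' \<le> 1"
    and eq: "polygon_map i r s = polygon_map j r' s'"
  shows "r = r'"
proof -
  have 1: "max 0 (1 - r) = max 0 (1 - r')"
    using polygon_map_at(1)[OF ij(1), of r s] polygon_map_at(1)[OF ij(2), of r' s'] eq by simp
  have 2: "ring_weight r s + next_ring_weight r s = ring_weight r' s' + next_ring_weight r' s'"
    using polygon_map_sum[OF ij(1), of r s] polygon_map_sum[OF ij(2), of r' s'] eq by simp
  have 3: "ring_weight r s + next_ring_weight r s = 2 - r" if "1 \<le> r" "r \<le> 2" "0 \<le> s" "s \<le> 1" for r s
    using weights_outer[OF that] that by (auto simp: min_def max_def)
  show ?thesis using 1 2 3[of r s] 3[of r' s'] r s by (auto simp: max_def split: if_splits)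
qed

end

section \<open>Boundary edges of the glued complex\<close>

definition quarter_label :: "nat \<Rightarrow> nat" where
  "quarter_label b = (if b \<in> {0,3,6,9,12} then 0 else if b < 6 then b else if b < 9 then 9 - b else 15 - b)"

context surface_polygon
begin

text \<open>A label splits into the block number and a position in the block, where all corners have
  position 0. The position takes finitely many values, so statements about it are open to
  evaluation.\<close>

lemma lab_quarter:
  "b \<le> 12 \<Longrightarrow> lab (12 * a + b) = N + (if quarter_label b = 0 then 1 else 2 + (12 * a + quarter_label b))"
  by (auto simp: bdry_label_at quarter_label_def)

lemma lab_quarter_eq:
  assumes "b \<le> 12" "b' \<le> 12" "lab (12 * a + b) = lab (12 * a' + b')"
  shows "quarter_label b = quarter_label b' \<and> (quarter_label b \<noteq> 0 \<longrightarrow> a = a')"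
proof -
  have "quarter_label b < 12" if "b \<le> 12" for b using that by (auto simp: quarter_label_def)
  from this[OF assms(1)] this[OF assms(2)] show ?thesis
    using assms(3) unfolding lab_quarter[OF assms(1)] lab_quarter[OF assms(2)]
    by (auto split: if_splits) presburger+
qed

text \<open>The word \<open>a b a\<inverse> b\<inverse>\<close> glues edges only in reversed
  direction: the edge that starts at offset \<open>b\<close> on the first side meets the one at
  \<open>8 - b\<close>, on the second side the one at \<open>14 - b\<close>. The first clause, that
  every edge has an end which is no corner, later recovers the block of an edge.\<close>

lemma quarter_label_edges:
  "\<forall>b\<in>set [0..<12]. \<forall>b'\<in>set [0..<12].
     (quarter_label b \<noteq> 0 \<or> quarter_label (Suc b) \<noteq> 0) \<and>
     (quarter_label b = quarter_label b' \<and> quarter_label (Suc b) = quarter_label (Suc b') \<longrightarrow> b = b') \<and>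
     (quarter_label b = quarter_label (Suc b') \<and> quarter_label (Suc b) = quarter_label b' \<longrightarrow>
        (b < 3 \<and> b' = 8 - b) \<or> (3 \<le> b \<and> b < 6 \<and> b' = 14 - b) \<or> (b' < 3 \<and> b = 8 - b') \<or> (3 \<le> b' \<and> b' < 6 \<and> b = 14 - b'))"
  by code_simp

lemma lab_edge_eq:
  assumes "lab i = lab j" "lab (Suc i) = lab (Suc j)"
  shows "i = j"
proof -
  obtain a b where i: "i = 12 * a + b" "b < 12" by (rule mod_12_split)
  obtain a' b' where j: "j = 12 * a' + b'" "b' < 12" by (rule mod_12_split)
  have "quarter_label b = quarter_label b' \<and> (quarter_label b \<noteq> 0 \<longrightarrow> a = a')"
    using i j assms(1) by (intro lab_quarter_eq) auto
  moreover have "quarter_label (Suc b) = quarter_label (Suc b') \<and> (quarter_label (Suc b) \<noteq> 0 \<longrightarrow> a = a')"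
    using i j assms(2) by (intro lab_quarter_eq) auto
  moreover have "b \<in> set [0..<12]" "b' \<in> set [0..<12]" using i j by auto
  \<comment> \<open>One end of the edge is not a corner, and the label of that end contains the
    block number.\<close>
  ultimately have "b = b'" "a = a'" using quarter_label_edges by blast+
  then show ?thesis using i j by simp
qed

lemma glued_edge:
  assumes "i < N" "lab i = lab (Suc j)" "lab (Suc i) = lab j" "0 \<le> s" "s \<le> 1"
  shows "glued (real i + s) (real j + (1 - s))"
proof -
  obtain a b where i: "i = 12 * a + b" "b < 12" by (rule mod_12_split)
  obtain a' b' where j: "j = 12 * a' + b'" "b' < 12" by (rule mod_12_split)
  have "quarter_label b = quarter_label (Suc b') \<and> (quarter_label b \<noteq> 0 \<longrightarrow> a = a')"
    using i j assms(2) by (intro lab_quarter_eq) auto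
  moreover have "quarter_label (Suc b) = quarter_label b' \<and> (quarter_label (Suc b) \<noteq> 0 \<longrightarrow> a = a')"
    using i j assms(3) by (intro lab_quarter_eq) auto
  moreover have "b \<in> set [0..<12]" "b' \<in> set [0..<12]" using i j by auto
  ultimately have bb: "(b < 3 \<and> b' = 8 - b) \<or> (3 \<le> b \<and> b < 6 \<and> b' = 14 - b) \<or> (b' < 3 \<and> b = 8 - b') \<or> (3 \<le> b' \<and> b' < 6 \<and> b = 14 - b')"
    and a: "a = a'" using quarter_label_edges by blast+
  have ag: "a < g" using assms(1) i by linarith
  note G = glued_sides[OF ag]
  from bb show ?thesis
  proof (elim disjE conjE)
    assume "b < 3" "b' = 8 - b"
    then show ?thesis using G(1)[of "real b + s"] assms(4,5) by (simp add: i j a algebra_simps)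
  next
    assume "3 \<le> b" "b < 6" "b' = 14 - b"
    then show ?thesis using G(2)[of "real b - 3 + s"] assms(4,5) by (simp add: i j a algebra_simps)
  next
    assume "b' < 3" "b = 8 - b'"
    then show ?thesis using G(1)[of "real b' + (1 - s)", THEN glued_sym] assms(4,5)
      by (simp add: i j a algebra_simps)
  next
    assume "3 \<le> b'" "b' < 6" "b = 14 - b'"
    then show ?thesis using G(2)[of "real b' - 3 + (1 - s)", THEN glued_sym] assms(4,5)
      by (simp add: i j a algebra_simps)
  qed
qed

lemma polygon_map_boundary:
  assumes "i < N" "0 \<le> s" "s \<le> 1"
  shows "polygon_map i 2 s v = of_bool (v = lab i) * (1 - s) + of_bool (v = lab (Suc i)) * s"
  using weights_outer[of 2 s] assms by (simp add: polygon_map_def lab_nx)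

text \<open>An inner point of an edge has positive weight at two labels and so determines the edge
  up to its direction; equal directions mean the same edge, opposite ones a glued pair. An end point
  determines only its label, which is the case of \<open>glued_label\<close>.\<close>

lemma polygon_map_eq_boundary:
  assumes ij: "i < N" "j < N" and s: "0 \<le> s" "s \<le> 1" "0 \<le> s'" "s' \<le> 1"
    and eq: "polygon_map i 2 s = polygon_map j 2 s'"
  shows "glued (real i + s) (real j + s')"
proof -
  have e: "of_bool (v = lab i) * (1 - s) + of_bool (v = lab (Suc i)) * s
      = of_bool (v = lab j) * (1 - s') + of_bool (v = lab (Suc j)) * s'" for v
    using polygon_map_boundary[OF ij(1) s(1,2), of v] polygon_map_boundary[OF ij(2) s(3,4), of v] eq by simp
  note ne = lab_Suc_neq[of i] lab_Suc_neq[of j]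
  have le: "i \<le> N" "Suc i \<le> N" "j \<le> N" "Suc j \<le> N" using ij by auto
  consider "s = 0" | "s = 1" | "0 < s" "s < 1" using s by linarith
  then show ?thesis
  proof cases
    case 1
    then have "(lab i = lab j \<and> s' = 0) \<or> (lab i = lab (Suc j) \<and> s' = 1)"
      using e[of "lab i"] ne s by (auto split: if_splits simp: of_bool_def)
    then show ?thesis using 1 glued_label[OF le(1) le(3)] glued_label[OF le(1) le(4)] by (auto simp: add.commute)
  next
    case 2
    then have "(lab (Suc i) = lab j \<and> s' = 0) \<or> (lab (Suc i) = lab (Suc j) \<and> s' = 1)"
      using e[of "lab (Suc i)"] ne s by (auto split: if_splits simp: of_bool_def)
    then show ?thesis using 2 glued_label[OF le(2) le(3)] glued_label[OF le(2) le(4)] by (auto simp: add.commute)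
  next
    case 3
    then have "(lab i = lab j \<and> lab (Suc i) = lab (Suc j) \<and> s' = s) \<or> (lab i = lab (Suc j) \<and> lab (Suc i) = lab j \<and> s' = 1 - s)"
      using e[of "lab i"] e[of "lab (Suc i)"] ne s by (auto split: if_splits simp: of_bool_def)
    then show ?thesis using lab_edge_eq[of i j] glued_edge[OF ij(1), of j s] s by auto
  qed
qed

text \<open>There are three regimes: at the centre all sectors meet, for \<open>0 < r < 2\<close>
  the map identifies only the common sides of neighbouring sectors, which are also common in the
  disc, and proper gluing happens at \<open>r = 2\<close> alone.\<close>

lemma polygon_map_eq_imp_glued:
  assumes ij: "i < N" "j < N" and r: "0 \<le> r" "r \<le> 2" "0 \<le> r'" "r' \<le> 2"
    and s: "0 \<le> s" "s \<le> 1" "0 \<le> s'" "s' \<le> 1"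
    and eq: "polygon_map i r s = polygon_map j r' s'"
  shows "(cone_map i r s, cone_map j r' s') \<in> (side_gluing g \<union> (side_gluing g)\<inverse>)\<^sup>*"
proof -
  have rr: "r' = r" using polygon_map_eq_radius[OF ij r s eq] by simp
  consider "r = 0" | "0 < r" "r \<le> 1" | "1 \<le> r" "r < 2" | "r = 2" using r by linarith
  then show ?thesis
  proof cases
    case 1
    then show ?thesis by (simp add: rr cone_map_def)
  next
    case 2
    have "(i = j \<and> s = s') \<or> (j = nx i \<and> s = 1 \<and> s' = 0) \<or> (i = nx j \<and> s' = 1 \<and> s = 0)"
      using polygon_map_eq_inner[OF ij 2 s] eq by (simp add: rr)
    then show ?thesis using cone_map_right_end ij by (auto simp: rr)
  next
    case 3
    have "(i = j \<and> s = s') \<or> (j = nx i \<and> s = 1 \<and> s' = 0) \<or> (i = nx j \<and> s' = 1 \<and> s = 0)"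
      using polygon_map_eq_outer[OF ij 3 s] eq by (simp add: rr)
    then show ?thesis using cone_map_right_end ij by (auto simp: rr)
  next
    case 4
    then have "glued (real i + s) (real j + s')"
      using polygon_map_eq_boundary[OF ij s] eq by (simp add: rr)
    then show ?thesis using 4 by (simp add: rr cone_map_def glued_def)
  qed
qed

lemma polygon_map_eq_same_position:
  assumes ij: "i < N" "j < N" and r: "0 \<le> r" "r \<le> 2" and s: "0 \<le> s" "s \<le> 1" "0 \<le> s'" "s' \<le> 1"
    and eq: "real i + s = real j + s'"
  shows "polygon_map i r s = polygon_map j r s'"
proof -
  consider "i = j" "s = s'" | "j = Suc i" "s = 1" "s' = 0" | "i = Suc j" "s' = 1" "s = 0"
  proof -
    have "real i < real j + 2" "real j < real i + 2" using eq s by linarith+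
    then have "i = j \<or> j = Suc i \<or> i = Suc j" by linarith
    then show thesis using that eq s by fastforce
  qed
  then show ?thesis
  proof cases
    case 2
    then show ?thesis using polygon_map_right_end[OF ij(1) r] ij by (simp add: nx_eq)
  next
    case 3
    then show ?thesis using polygon_map_right_end[OF ij(2) r] ij by (simp add: nx_eq)
  qed simp
qed

text \<open>The norm gives the radius, and away from the centre the angle gives \<open>i + s\<close>
  up to a multiple of \<open>N\<close>. Both positions lie between 0 and \<open>N\<close>, so that
  multiple is 0, 1 or -1, and the last two occur only at the seam between sector
  \<open>N - 1\<close> and sector 0.\<close>

lemma cone_map_eq_imp:
  assumes ij: "i < N" "j < N" and r: "0 \<le> r" "r \<le> 2" "0 \<le> r'" "r' \<le> 2"
    and s: "0 \<le> s" "s \<le> 1" "0 \<le> s'" "s' \<le> 1"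
    and eq: "cone_map i r s = cone_map j r' s'"
  shows "polygon_map i r s = polygon_map j r' s'"
proof -
  have wrap: "polygon_map i r s = polygon_map j r s'"
    if "i < N" "j < N" "0 \<le> s" "s \<le> 1" "0 \<le> s'" "s' \<le> 1" "real i + s = real j + s' + real N" for i j s s'
  proof -
    have "real i + 1 \<le> real N" using that(1) by linarith
    then have 1: "s = 1" "real i + 1 = real N" "real j = 0" "s' = 0" using that by linarith+
    then have "Suc i = N" "j = 0" by linarith+
    then show ?thesis using polygon_map_right_end[OF that(1) r(1,2)] 1 nx_eq[OF that(1)] by simp
  qed
  have "norm (cone_map i r s) = r / 2" "norm (cone_map j r' s') = r' / 2"
    using r by (auto simp: cone_map_def pos_def norm_mult)
  then have rr: "r' = r" using eq by simp
  show ?thesis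
  proof (cases "r = 0")
    case True
    then show ?thesis using polygon_map_centre s by (simp add: rr)
  next
    case False
    then have "pos (real i + s) = pos (real j + s')" using eq by (simp add: rr cone_map_def)
    then obtain n :: int where "2 * pi * (real i + s) / real N = 2 * pi * (real j + s') / real N + 2 * pi * n"
      using sin_cos_eq_iff[of "2 * pi * (real i + s) / real N"] unfolding pos_def
      by (auto simp: complex_eq_iff)
    then have "2 * pi * ((real i + s) / real N) = 2 * pi * ((real j + s') / real N + of_int n)"
      by (simp add: algebra_simps)
    then have "(real i + s) / real N = (real j + s') / real N + of_int n"
      unfolding mult_cancel_left by simp
    moreover have N0: "real N > 0" using g by simp
    ultimately have n: "real i + s = real j + s' + real N * of_int n" by (simp add: field_simps)
    have bd: "real i + 1 \<le> real N" "real j + 1 \<le> real N" using ij by linarith+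
    have "real N * of_int n \<le> real N * 1" "real N * (- 1) \<le> real N * of_int n" using n bd s by linarith+
    then have "n \<le> 1" "-1 \<le> n" using N0 by (simp_all only: mult_le_cancel_left_pos)
    then consider "n = 0" | "n = 1" | "n = -1" by linarith
    then show ?thesis
    proof cases
      case 1
      then show ?thesis using polygon_map_eq_same_position[OF ij r(1,2) s] n by (simp add: rr)
    next
      case 2
      then show ?thesis using wrap[OF ij s] n by (simp add: rr)
    next
      case 3
      then have "real j + s' = real i + s + real N" using n by simp
      from wrap[OF ij(2,1) s(3,4,1,2) this] show ?thesis by (simp add: rr)
    qed
  qed
qed

lemma side_gluing_polygon_map:
  assumes "(z, z') \<in> side_gluing g"
  obtains i j s where "i < N" "j < N" "0 \<le> s" "s \<le> 1" "cone_map i 2 s = z" "cone_map j 2 (1 - s) = z'"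
    "polygon_map i 2 s = polygon_map j 2 (1 - s)"
proof -
  obtain k \<tau> where k: "k < 4 * g" "k mod 4 \<in> {0, 1}" "0 \<le> \<tau>" "\<tau> \<le> 3"
    "z = pos (3 * real k + \<tau>)" "z' = pos (3 * real k + 9 - \<tau>)"
    using assms[unfolded side_gluing_iff] by (elim exE conjE) (rule that)
  define a where "a = k div 4"
  define c where "c = k mod 4"
  have kac: "k = 4 * a + c" "c \<in> {0, 1}" using k(2) by (auto simp: a_def c_def)
  have ag: "a < g" using k(1) kac(1) by linarith
  \<comment> \<open>\<open>e\<close> is the number of the edge within its side. The floor of
    \<open>\<tau> = 3\<close> would be 3, so this value is taken as the right end of edge 2.\<close>
  obtain e :: nat and s where es: "\<tau> = real e + s" "e < 3" "0 \<le> s" "s \<le> 1"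
  proof (cases "\<tau> = 3")
    case True
    then show thesis using that[of 2 1] by simp
  next
    case False
    then have 1: "nat \<lfloor>\<tau>\<rfloor> < 3" using k by linarith
    have 2: "\<tau> = real (nat \<lfloor>\<tau>\<rfloor>) + frac \<tau>" using k by (simp add: frac_def)
    show thesis by (rule that[OF 2 1]) (simp_all add: less_imp_le frac_lt_1)
  qed
  have e3: "e \<in> {0, 1, 2}" using es(2) by auto
  define i where "i = 12 * a + (3 * c + e)"
  define j where "j = 12 * a + (3 * c + 8 - e)"
  have ij: "i < N" "j < N" using ag kac(2) e3 by (auto simp: i_def j_def)
  have l: "lab i = lab (Suc j)" "lab (Suc i) = lab j"
  proof -
    have s: "Suc i = 12 * a + Suc (3 * c + e)" "Suc j = 12 * a + Suc (3 * c + 8 - e)" by (auto simp: i_def j_def)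
    have b: "3 * c + e \<le> 12" "Suc (3 * c + e) \<le> 12" "3 * c + 8 - e \<le> 12" "Suc (3 * c + 8 - e) \<le> 12"
      using kac(2) e3 by auto
    have q: "quarter_label (3 * c + e) = quarter_label (Suc (3 * c + 8 - e))"
      "quarter_label (Suc (3 * c + e)) = quarter_label (3 * c + 8 - e)"
      using kac(2) e3 by (elim insertE emptyE; simp add: quarter_label_def)+
    show "lab i = lab (Suc j)" "lab (Suc i) = lab j"
      unfolding s unfolding i_def j_def by (simp_all only: lab_quarter b q)
  qed
  have "polygon_map i 2 s = polygon_map j 2 (1 - s)"
    using polygon_map_boundary[OF ij(1) es(3,4)] polygon_map_boundary[OF ij(2), of "1 - s"] es(3,4) l by auto
  moreover have "cone_map i 2 s = z"
    by (simp add: cone_map_def k(5) es(1) i_def kac(1) algebra_simps)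
  moreover have "cone_map j 2 (1 - s) = z'"
    using e3 by (auto simp: cone_map_def k(6) es(1) j_def kac(1) algebra_simps)
  ultimately show thesis using that ij es(3,4) by blast
qed

lemma glued_imp_polygon_map_eq:
  assumes ij: "i < N" "j < N" and r: "0 \<le> r" "r \<le> 2" "0 \<le> r'" "r' \<le> 2"
    and s: "0 \<le> s" "s \<le> 1" "0 \<le> s'" "s' \<le> 1"
    and rel: "(cone_map i r s, cone_map j r' s') \<in> (side_gluing g \<union> (side_gluing g)\<inverse>)\<^sup>*"
  shows "polygon_map i r s = polygon_map j r' s'"
proof -
  define S where "S z \<longleftrightarrow> (\<exists>i r s. i < N \<and> 0 \<le> r \<and> r \<le> 2 \<and> 0 \<le> s \<and> s \<le> 1 \<and> cone_map i r s = z)" for z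
  \<comment> \<open>\<open>P\<close> is \<open>polygon_map\<close> pushed down to the disc; by
    \<open>cone_map_eq_imp\<close> its value does not depend on the coordinates chosen. It is
    invariant under single gluings in both directions, and induction along a chain of gluings gives
    the claim.\<close>
  define P where "P z = (SOME c. \<exists>i r s. i < N \<and> 0 \<le> r \<and> r \<le> 2 \<and> 0 \<le> s \<and> s \<le> 1 \<and> cone_map i r s = z \<and> polygon_map i r s = c)" for z
  have P: "P (cone_map i r s) = polygon_map i r s" if "i < N" "0 \<le> r" "r \<le> 2" "0 \<le> s" "s \<le> 1" for i r s
    unfolding P_def
  proof (rule some_equality)
    show "\<exists>i' r' s'. i' < N \<and> 0 \<le> r' \<and> r' \<le> 2 \<and> 0 \<le> s' \<and> s' \<le> 1 \<and> cone_map i' r' s' = cone_map i r s \<and> polygon_map i' r' s' = polygon_map i r s"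
      using that by blast
  next
    fix c assume "\<exists>i' r' s'. i' < N \<and> 0 \<le> r' \<and> r' \<le> 2 \<and> 0 \<le> s' \<and> s' \<le> 1 \<and> cone_map i' r' s' = cone_map i r s \<and> polygon_map i' r' s' = c"
    then show "c = polygon_map i r s" using cone_map_eq_imp that by metis
  qed
  have step: "P y = P z" if yz: "(y, z) \<in> side_gluing g" for y z
  proof -
    obtain i j s where h: "i < N" "j < N" "0 \<le> s" "s \<le> 1" "cone_map i 2 s = y" "cone_map j 2 (1 - s) = z"
      "polygon_map i 2 s = polygon_map j 2 (1 - s)"
      by (rule side_gluing_polygon_map[OF yz])
    then show ?thesis using P[of i 2 s] P[of j 2 "1 - s"] by simp
  qed
  have "P (cone_map i r s) = P (cone_map j r' s')"
    using rel by (induction rule: rtrancl_induct) (auto dest: step)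
  then show ?thesis using P ij r s by metis
qed

end

section \<open>Quotients of the compact strip\<close>

lemma homeomorphic_space_common_quotient:
  assumes f: "quotient_map X Y f" and h: "quotient_map X Z h"
    and fh: "\<And>x y. x \<in> topspace X \<Longrightarrow> y \<in> topspace X \<Longrightarrow> f x = f y \<longleftrightarrow> h x = h y"
  shows "Y homeomorphic_space Z"
proof -
  obtain k where k: "continuous_map Y Z k" "\<And>x. x \<in> topspace X \<Longrightarrow> k (f x) = h x"
    using quotient_map_lift_exists[OF f quotient_imp_continuous_map[OF h]] fh by metis
  obtain l where l: "continuous_map Z Y l" "\<And>x. x \<in> topspace X \<Longrightarrow> l (h x) = f x"
    using quotient_map_lift_exists[OF h quotient_imp_continuous_map[OF f]] fh by metis
  have "topspace Y = f ` topspace X" "topspace Z = h ` topspace X"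
    using f h by (auto simp: quotient_map_def)
  then have "homeomorphic_maps Y Z k l"
    using k l by (auto simp: homeomorphic_maps_def)
  then show ?thesis by (auto simp: homeomorphic_space_def)
qed

text \<open>The slices over the finitely many indices are closed and disjoint, so continuity can be
  tested on each of them.\<close>

lemma continuous_on_discrete_Times:
  fixes f :: "nat \<times> 'a::t2_space \<Rightarrow> 'b::topological_space"
  assumes "closed T" "finite I" "\<And>i. i \<in> I \<Longrightarrow> continuous_on T (\<lambda>x. f (i, x))"
  shows "continuous_on (I \<times> T) f"
proof -
  have "continuous_on (\<Union>i\<in>I. {i} \<times> T) f"
  proof (rule continuous_on_closed_Union[OF assms(2)])
    show "closed ({i} \<times> T)" if "i \<in> I" for i by (intro closed_Times assms) simp
    show "continuous_on ({i} \<times> T) f" if "i \<in> I" for i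
    proof -
      have "continuous_on ({i} \<times> T) (\<lambda>p. f (i, snd p))"
        by (rule continuous_on_compose2[OF assms(3)[OF that]]) (auto intro!: continuous_on_snd continuous_on_id)
      then show ?thesis by (rule continuous_on_eq) auto
    qed
  qed
  moreover have "(\<Union>i\<in>I. {i} \<times> T) = I \<times> T" by auto
  ultimately show ?thesis by simp
qed

context surface_polygon
begin

lemma compact_strip: "compact ({..<N} \<times> {0..2::real} \<times> {0..1::real})"
  by (simp add: compact_Times finite_imp_compact)

lemma continuous_on_polygon_map:
  "continuous_on ({..<N} \<times> {0..2} \<times> {0..1}) (\<lambda>(i, r, s). polygon_map i r s)"
proof (rule continuous_on_discrete_Times)
  fix i
  have "continuous_on ({0..2} \<times> {0..1}) (\<lambda>p. polygon_map i (fst p) (snd p) v)" for v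
    unfolding polygon_map_def ring_weight_def next_ring_weight_def bdry_weight_def next_bdry_weight_def by (intro continuous_intros)
  then show "continuous_on ({0..2} \<times> {0..1}) (\<lambda>x. case (i, x) of (i, r, s) \<Rightarrow> polygon_map i r s)"
    by (intro continuous_on_coordinatewise_then_product) (simp add: case_prod_beta)
qed (auto intro: closed_Times)

lemma continuous_on_cone_map:
  "continuous_on ({..<N} \<times> {0..2} \<times> {0..1}) (\<lambda>(i, r, s). cone_map i r s)"
proof (rule continuous_on_discrete_Times)
  fix i
  have "continuous_on ({0..2} \<times> {0..1}) (\<lambda>p. cone_map i (fst p) (snd p))"
    unfolding cone_map_def pos_def using g by (intro continuous_intros) auto
  then show "continuous_on ({0..2} \<times> {0..1}) (\<lambda>x. case (i, x) of (i, r, s) \<Rightarrow> cone_map i r s)"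
    by (simp add: case_prod_beta)
qed (auto intro: closed_Times)

lemma cone_map_onto:
  "(\<lambda>(i, r, s). cone_map i r s) ` ({..<N} \<times> {0..2} \<times> {0..1}) = cball 0 1"
proof (intro equalityI subsetI)
  fix z assume "z \<in> (\<lambda>(i, r, s). cone_map i r s) ` ({..<N} \<times> {0..2} \<times> {0..1})"
  then show "z \<in> cball 0 1" by (auto simp: cone_map_def pos_def norm_mult)
next
  fix z :: complex assume z: "z \<in> cball 0 1"
  define t where "t = Arg2pi z * real N / (2 * pi)"
  define i where "i = nat \<lfloor>t\<rfloor>"
  have N0: "real N > 0" using g by simp
  have t: "0 \<le> t" "t < real N"
    using Arg2pi_ge_0[of z] Arg2pi_lt_2pi[of z] N0 by (auto simp: t_def field_simps)
  have i: "i < N" using t by (simp add: i_def floor_less_iff nat_less_iff)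
  have "real i + frac t = t" using t by (simp add: i_def frac_def)
  moreover have "2 * pi * t / real N = Arg2pi z" using N0 by (simp add: t_def)
  ultimately have "cone_map i (2 * norm z) (frac t) = of_real (norm z) * cis (Arg2pi z)"
    by (simp add: cone_map_def pos_def)
  also have "\<dots> = z" using Arg2pi_eq[of z] by (simp add: cis_conv_exp mult.commute)
  finally have "cone_map i (2 * norm z) (frac t) = z" .
  moreover have "0 \<le> frac t" "frac t \<le> 1" using frac_lt_1[of t] by auto
  ultimately show "z \<in> (\<lambda>(i, r, s). cone_map i r s) ` ({..<N} \<times> {0..2} \<times> {0..1})"
    using i z by (intro image_eqI[of _ _ "(i, 2 * norm z, frac t)"]) auto
qed

lemma polygon_vertices_distinct:
  assumes "i < N"
  shows "i \<noteq> nx i" "N \<noteq> i" "N \<noteq> nx i" "N \<noteq> lab i" "N \<noteq> lab (nx i)" "i \<noteq> lab i" "nx i \<noteq> lab i"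
    "i \<noteq> lab (nx i)" "nx i \<noteq> lab (nx i)" "lab i \<noteq> lab (nx i)"
  using nx_neq[OF assms] assms nx_less[of i] lab_gt[of i] lab_gt[of "nx i"] lab_nx_neq[OF assms] by linarith+

lemma polygon_map_values:
  assumes "i < N"
  shows "polygon_map i r s N = max 0 (1 - r)" "polygon_map i r s i = ring_weight r s" "polygon_map i r s (nx i) = next_ring_weight r s"
    "polygon_map i r s (lab i) = bdry_weight r s" "polygon_map i r s (lab (nx i)) = next_bdry_weight r s"
    "v \<notin> {N, i, nx i, lab i, lab (nx i)} \<Longrightarrow> polygon_map i r s v = 0"
proof -
  note ne = polygon_vertices_distinct[OF assms]
  show "polygon_map i r s N = max 0 (1 - r)" "polygon_map i r s i = ring_weight r s" "polygon_map i r s (nx i) = next_ring_weight r s"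
    "polygon_map i r s (lab i) = bdry_weight r s" "polygon_map i r s (lab (nx i)) = next_bdry_weight r s"
    unfolding polygon_map_def by (simp_all only: ne ne[symmetric] of_bool_eq refl if_True simp_thms mult_1 mult_zero_left add_0 add_0_right)
  show "v \<notin> {N, i, nx i, lab i, lab (nx i)} \<Longrightarrow> polygon_map i r s v = 0"
    by (simp add: polygon_map_def)
qed

text \<open>The three ranges of \<open>(r, s)\<close> correspond to the three facets of the sector;
  in each of them two of the five weights vanish and the other three add up to 1.\<close>

lemma polygon_map_in_simplex:
  assumes i: "i < N" and r: "0 \<le> r" "r \<le> 2" and s: "0 \<le> s" "s \<le> 1"
  shows "polygon_map i r s \<in> (\<Union>t\<in>polygon_facets g. std_simplex t)"
proof -
  note ne = polygon_vertices_distinct[OF i] and v = polygon_map_values[OF i, where r = r and s = s]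
  have nn: "0 \<le> polygon_map i r s v" for v
    using weights_nonneg[OF r s] by (auto simp: polygon_map_def)
  have out: "\<forall>v. v \<notin> t \<longrightarrow> polygon_map i r s v = 0"
    if "\<forall>v\<in>{N, i, nx i, lab i, lab (nx i)} - t. polygon_map i r s v = 0" for t
    using that v(6) by blast
  consider "r \<le> 1" | "1 \<le> r" "r + s \<le> 2" | "1 \<le> r" "2 \<le> r + s" by linarith
  then obtain t where "t \<in> {{N, i, nx i}, {i, nx i, lab i}, {nx i, lab i, lab (nx i)}}"
    "\<forall>v. v \<notin> t \<longrightarrow> polygon_map i r s v = 0" "(\<Sum>v\<in>t. polygon_map i r s v) = 1"
  proof cases
    case 1
    note w = weights_inner[OF r(1) 1 s]
    show thesis
    proof (rule that[of "{N, i, nx i}"])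
      show "\<forall>v. v \<notin> {N, i, nx i} \<longrightarrow> polygon_map i r s v = 0"
        by (rule out) (auto simp: v w)
      have "(\<Sum>v\<in>{N, i, nx i}. polygon_map i r s v) = max 0 (1 - r) + (ring_weight r s + next_ring_weight r s)"
        by (simp only: sum.insert sum.empty finite.intros insert_iff empty_iff ne simp_thms not_False_eq_True v add_0_right)
      also have "\<dots> = 1" using 1 by (simp add: w algebra_simps)
      finally show "(\<Sum>v\<in>{N, i, nx i}. polygon_map i r s v) = 1" .
    qed simp
  next
    case 2
    note w = weights_outer[OF 2(1) r(2) s]
    show thesis
    proof (rule that[of "{i, nx i, lab i}"])
      show "\<forall>v. v \<notin> {i, nx i, lab i} \<longrightarrow> polygon_map i r s v = 0"
        by (rule out) (use 2 in \<open>auto simp: v w\<close>)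
      have "(\<Sum>v\<in>{i, nx i, lab i}. polygon_map i r s v) = ring_weight r s + (next_ring_weight r s + bdry_weight r s)"
        by (simp only: sum.insert sum.empty finite.intros insert_iff empty_iff ne simp_thms not_False_eq_True v add_0_right)
      also have "\<dots> = 1" using 2 by (simp add: w)
      finally show "(\<Sum>v\<in>{i, nx i, lab i}. polygon_map i r s v) = 1" .
    qed simp
  next
    case 3
    note w = weights_outer[OF 3(1) r(2) s]
    show thesis
    proof (rule that[of "{nx i, lab i, lab (nx i)}"])
      show "\<forall>v. v \<notin> {nx i, lab i, lab (nx i)} \<longrightarrow> polygon_map i r s v = 0"
        by (rule out) (use 3 in \<open>auto simp: v w\<close>)
      have "(\<Sum>v\<in>{nx i, lab i, lab (nx i)}. polygon_map i r s v) = next_ring_weight r s + (bdry_weight r s + next_bdry_weight r s)"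
        by (simp only: sum.insert sum.empty finite.intros insert_iff empty_iff ne simp_thms not_False_eq_True v add_0_right)
      also have "\<dots> = 1" using 3 by (simp add: w)
      finally show "(\<Sum>v\<in>{nx i, lab i, lab (nx i)}. polygon_map i r s v) = 1" .
    qed simp
  qed
  then have "polygon_map i r s \<in> std_simplex t" "t \<in> polygon_facets g"
    using nn i unfolding polygon_facets_def std_simplex_def by blast+
  then show ?thesis by blast
qed

lemma simplex_in_polygon_map:
  assumes i: "i < N" and t: "t \<in> {{N, i, nx i}, {i, nx i, lab i}, {nx i, lab i, lab (nx i)}}"
    and x: "x \<in> std_simplex t"
  obtains r s where "0 \<le> r" "r \<le> 2" "0 \<le> s" "s \<le> 1" "polygon_map i r s = x"
proof -
  note ne = polygon_vertices_distinct[OF i] and vals = polygon_map_values[OF i]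
  have nn: "0 \<le> x v" for v using x by (simp add: std_simplex_def)
  have z: "x v = 0" if "v \<notin> t" for v using x that by (simp add: std_simplex_def)
  have sum: "(\<Sum>v\<in>t. x v) = 1" using x by (simp add: std_simplex_def)
  have fin:  thesis if "0 \<le> r" "r \<le> 2" "0 \<le> s" "s \<le> 1" "max 0 (1 - r) = x N" "ring_weight r s = x i" "next_ring_weight r s = x (nx i)"
      "bdry_weight r s = x (lab i)" "next_bdry_weight r s = x (lab (nx i))" for r s
  proof -
    have "polygon_map i r s v = x v" for v
    proof (cases "v \<in> {N, i, nx i, lab i, lab (nx i)}")
      case True
      then show ?thesis using that(5-9) vals(1-5)[where r = r and s = s] by auto
    next
      case False
      then have "v \<notin> t" using t by auto
      then show ?thesis using False z vals(6) by simp
    qed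
    then show thesis using \<open>\<And>r s. \<lbrakk>0 \<le> r; r \<le> 2; 0 \<le> s; s \<le> 1; polygon_map i r s = x\<rbrakk> \<Longrightarrow> thesis\<close> that by blast
  qed
  from t consider "t = {N, i, nx i}" | "t = {i, nx i, lab i}" | "t = {nx i, lab i, lab (nx i)}" by blast
  then show thesis
  proof cases
    case 1
    define r where "r = 1 - x N"
    have sm: "x N + x i + x (nx i) = 1" using sum ne by (simp add: 1 add.assoc)
    have zz: "x (lab i) = 0" "x (lab (nx i)) = 0" using z ne by (auto simp: 1)
    have r: "0 \<le> r" "r \<le> 1" using sm nn[of N] nn[of i] nn[of "nx i"] by (auto simp: r_def)
    \<comment> \<open>At the centre \<open>r = 0\<close> and the quotient is 0 by convention;
      \<open>r * s = x (nx i)\<close> still holds there because both weights on the ring are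
      0.\<close>
    define s where "s = x (nx i) / r"
    have s: "0 \<le> s" "s \<le> 1" "r * s = x (nx i)"
      using sm nn[of i] nn[of "nx i"] r by (auto simp: s_def r_def divide_simps)
    note w = weights_inner[OF r s(1,2)]
    show thesis
    proof (rule fin[of r s])
      show "ring_weight r s = x i" unfolding w right_diff_distrib s(3) using sm by (simp add: r_def)
      show "next_ring_weight r s = x (nx i)" unfolding w by (rule s(3))
      show "max 0 (1 - r) = x N" using nn[of N] by (simp add: r_def)
    qed (use r s zz in \<open>simp_all add: w\<close>)
  next
    case 2
    have sm: "x i + x (nx i) + x (lab i) = 1" using sum ne by (simp add: 2 add.assoc)
    have zz: "x N = 0" "x (lab (nx i)) = 0" using z ne by (auto simp: 2)
    \<comment> \<open>The coordinates are read off the weights. Below the diagonal the boundary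
      vertex has weight \<open>r - 1\<close> and the next ring vertex weight \<open>s\<close>; above
      it, in the next case, these weights are \<open>1 - s\<close> and \<open>2 - r\<close>.\<close>
    define r s where "r = 1 + x (lab i)" and "s = x (nx i)"
    have b: "1 \<le> r" "r \<le> 2" "0 \<le> s" "s \<le> 1"
      using sm nn[of i] nn[of "nx i"] nn[of "lab i"] by (auto simp: r_def s_def)
    note w = weights_outer[OF b]
    show thesis
    proof (rule fin[of r s])
      have "x i = 2 - r - s" using sm by (simp add: r_def s_def)
      moreover from this have "r - 1 \<le> 1 - s" using nn[of i] by simp
      ultimately show "ring_weight r s = x i" "next_ring_weight r s = x (nx i)" "bdry_weight r s = x (lab i)" "next_bdry_weight r s = x (lab (nx i))"
        unfolding w zz using nn[of i] by (simp_all add: min_def max_def) (simp_all add: r_def s_def)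
    qed (use b zz in simp_all)
  next
    case 3
    have sm: "x (nx i) + x (lab i) + x (lab (nx i)) = 1" using sum ne by (simp add: 3 add.assoc)
    have zz: "x N = 0" "x i = 0" using z ne by (auto simp: 3)
    define r s where "r = 2 - x (nx i)" and "s = 1 - x (lab i)"
    have b: "1 \<le> r" "r \<le> 2" "0 \<le> s" "s \<le> 1"
      using sm nn[of "lab (nx i)"] nn[of "nx i"] nn[of "lab i"] by (auto simp: r_def s_def)
    note w = weights_outer[OF b]
    show thesis
    proof (rule fin[of r s])
      have "x (lab (nx i)) = r + s - 2" using sm by (simp add: r_def s_def)
      moreover from this have "1 - s \<le> r - 1" using nn[of "lab (nx i)"] by simp
      ultimately show "ring_weight r s = x i" "next_ring_weight r s = x (nx i)" "bdry_weight r s = x (lab i)" "next_bdry_weight r s = x (lab (nx i))"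
        unfolding w zz using nn[of "lab (nx i)"] by (simp_all add: min_def max_def) (simp_all add: r_def s_def)
    qed (use b zz in simp_all)
  qed
qed

lemma polygon_map_onto:
  "(\<lambda>(i, r, s). polygon_map i r s) ` ({..<N} \<times> {0..2} \<times> {0..1}) = (\<Union>t\<in>polygon_facets g. std_simplex t)"
proof (intro equalityI subsetI)
  fix x assume "x \<in> (\<lambda>(i, r, s). polygon_map i r s) ` ({..<N} \<times> {0..2} \<times> {0..1})"
  then show "x \<in> (\<Union>t\<in>polygon_facets g. std_simplex t)"
    using polygon_map_in_simplex by auto
next
  fix x assume "x \<in> (\<Union>t\<in>polygon_facets g. std_simplex t)"
  then obtain i t where "i < N" "t \<in> {{N, i, nx i}, {i, nx i, lab i}, {nx i, lab i, lab (nx i)}}" "x \<in> std_simplex t"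
    unfolding polygon_facets_def by blast
  then obtain r s where "0 \<le> r" "r \<le> 2" "0 \<le> s" "s \<le> 1" "polygon_map i r s = x"
    by (rule simplex_in_polygon_map)
  then show "x \<in> (\<lambda>(i, r, s). polygon_map i r s) ` ({..<N} \<times> {0..2} \<times> {0..1})"
    using \<open>i < N\<close> by (intro image_eqI[of _ _ "(i, r, s)"]) auto
qed

text \<open>A continuous surjection from a compact space onto a Hausdorff space is a quotient map.
  This applies to the maps onto the complex and onto the disc; composing the latter with the
  defining projection gives a quotient map onto the surface with the same fibres as the
  first.\<close>

lemma polygon_facets_homeomorphic:
  "top_of_set (\<Union>t\<in>polygon_facets g. std_simplex t) homeomorphic_space orientable_surface g"
proof -
  let ?K = "{..<N} \<times> {0..2::real} \<times> {0..1::real}" and ?R = "(side_gluing g \<union> (side_gluing g)\<inverse>)\<^sup>*"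
  let ?F = "\<lambda>(i, r, s). polygon_map i r s" and ?C = "\<lambda>(i, r, s). cone_map i r s"
  have F0: "?F \<in> ?K \<rightarrow> (\<Union>t\<in>polygon_facets g. std_simplex t)" using polygon_map_onto by blast
  have C0: "?C \<in> ?K \<rightarrow> cball 0 1" using cone_map_onto by blast
  have F: "quotient_map (top_of_set ?K) (top_of_set (\<Union>t\<in>polygon_facets g. std_simplex t)) ?F"
    using continuous_on_polygon_map compact_strip polygon_map_onto F0
    by (intro continuous_imp_quotient_map Hausdorff_space_subtopology Hausdorff_space_euclidean)
      (simp_all only: compact_space_subtopology compactin_euclidean_iff continuous_map_subtopology_eu
        image_subset_iff_funcset topspace_euclidean_subtopology)
  have C: "quotient_map (top_of_set ?K) (top_of_set (cball 0 1)) ?C"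
    using continuous_on_cone_map compact_strip cone_map_onto C0
    by (intro continuous_imp_quotient_map Hausdorff_space_subtopology Hausdorff_space_euclidean)
      (simp_all only: compact_space_subtopology compactin_euclidean_iff continuous_map_subtopology_eu
        image_subset_iff_funcset topspace_euclidean_subtopology)
  have Q: "quotient_map (top_of_set ?K) (orientable_surface g) ((\<lambda>z. ?R `` {z}) \<circ> ?C)"
    unfolding orientable_surface_def by (rule quotient_map_compose[OF C quotient_map_quotient_topology])
  have sym: "sym ?R" by (intro sym_rtrancl sym_Un_converse)
  have R: "?R `` {z} = ?R `` {z'} \<longleftrightarrow> (z, z') \<in> ?R" for z z'
  proof
    assume "?R `` {z} = ?R `` {z'}"
    then show "(z, z') \<in> ?R" by blast
  next
    assume "(z, z') \<in> ?R"
    then show "?R `` {z} = ?R `` {z'}" using symD[OF sym] by (blast intro: rtrancl_trans)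
  qed
  show ?thesis
  proof (rule homeomorphic_space_common_quotient[OF F Q])
    fix p q assume "p \<in> topspace (top_of_set ?K)" "q \<in> topspace (top_of_set ?K)"
    moreover obtain i r s j r' s' where pq: "p = (i, r, s)" "q = (j, r', s')"
      by (metis prod_cases3)
    ultimately have b: "i < N" "j < N" "0 \<le> r" "r \<le> 2" "0 \<le> r'" "r' \<le> 2" "0 \<le> s" "s \<le> 1" "0 \<le> s'" "s' \<le> 1"
      by auto
    have "?F p = ?F q \<longleftrightarrow> (cone_map i r s, cone_map j r' s') \<in> ?R"
      unfolding pq prod.case using polygon_map_eq_imp_glued[OF b] glued_imp_polygon_map_eq[OF b] by (rule iffI)
    then show "?F p = ?F q \<longleftrightarrow> ((\<lambda>z. ?R `` {z}) \<circ> ?C) p = ((\<lambda>z. ?R `` {z}) \<circ> ?C) q"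
      unfolding comp_apply R unfolding pq prod.case .
  qed
qed

end

section \<open>Bistellar moves on lists of facets\<close>

definition facet_body :: "'v list list \<Rightarrow> ('v \<Rightarrow> real) set" where
  "facet_body F = (\<Union>t\<in>set F. std_simplex (set t))"

text \<open>
  The functions below are evaluated on ground terms by rewriting; \<open>if\<close> takes the place of the connectives
  to stop the evaluation of decided conditions.
\<close>

primrec mem_list :: "'a \<Rightarrow> 'a list \<Rightarrow> bool" where
  "mem_list x [] = False"
| "mem_list x (y # ys) = (if x = y then True else mem_list x ys)"

primrec sub_list :: "'a list \<Rightarrow> 'a list \<Rightarrow> bool" where
  "sub_list [] ys = True"
| "sub_list (x # xs) ys = (if mem_list x ys then sub_list xs ys else False)"

text \<open>Since \<open>D\<close> has to be used up, it consists of exactly the facets that contain \<open>A\<close>.\<close>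

primrec off_star :: "'a list \<Rightarrow> 'a list \<Rightarrow> 'a list list \<Rightarrow> 'a list list \<Rightarrow> 'a list list option" where
  "off_star A B D [] = (case D of [] \<Rightarrow> Some [] | _ # _ \<Rightarrow> None)"
| "off_star A B D (t # F) =
     (if sub_list A t then if mem_list t D then off_star A B (remove1 t D) F else None
      else if sub_list B t then None else map_option ((#) t) (off_star A B D F))"

primrec omit_each :: "'a list \<Rightarrow> 'a list \<Rightarrow> 'a list list" where
  "omit_each S [] = []"
| "omit_each S (c # cs) = remove1 c S # omit_each S cs"

text \<open>Facets are kept as sorted lists, so that equal sets are equal lists and
  \<open>mem_list\<close> recognises them; removing an entry from the sorted \<open>S\<close>
  preserves this form.\<close>

definition bistellar_step :: "'a::linorder list \<Rightarrow> 'a list \<Rightarrow> 'a list list \<Rightarrow> 'a list list option" where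
  "bistellar_step A B F =
     (let S = sort (A @ B); D = omit_each S B
      in if distinct S \<and> A \<noteq> [] \<and> B \<noteq> []
         then map_option ((@) (omit_each S A)) (off_star A B D F) else None)"

lemma mem_list_iff [simp]: "mem_list x ys \<longleftrightarrow> x \<in> set ys"
  by (induction ys) auto

lemma sub_list_iff: "sub_list xs ys \<longleftrightarrow> set xs \<subseteq> set ys"
  by (induction xs) auto

lemma off_star_SomeD:
  "distinct D \<Longrightarrow> off_star A B D F = Some K \<Longrightarrow> set K = {t \<in> set F. \<not> set A \<subseteq> set t}
     \<and> (\<forall>t\<in>set K. \<not> set B \<subseteq> set t) \<and> set D = {t \<in> set F. set A \<subseteq> set t}"
proof (induction F arbitrary: D K)
  case Nil
  then show ?case by (cases D) auto
next
  case (Cons t F)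
  show ?case
  proof (cases "set A \<subseteq> set t")
    case True
    then have t: "t \<in> set D" "off_star A B (remove1 t D) F = Some K"
      using Cons.prems(2) by (auto simp only: off_star.simps sub_list_iff mem_list_iff if_True split: if_splits)
    have "set K = {t \<in> set F. \<not> set A \<subseteq> set t} \<and> (\<forall>t\<in>set K. \<not> set B \<subseteq> set t)
        \<and> set (remove1 t D) = {t \<in> set F. set A \<subseteq> set t}"
      using Cons.prems(1) by (intro Cons.IH t(2)) simp
    moreover have "set D = insert t (set (remove1 t D))"
      using t(1) Cons.prems(1) by (auto simp: set_remove1_eq)
    ultimately show ?thesis using True by auto
  next
    case False
    then obtain L where "\<not> set B \<subseteq> set t" "off_star A B D F = Some L" "K = t # L"
      using Cons.prems(2) by (auto simp only: off_star.simps sub_list_iff if_False map_option_eq_Some split: if_splits)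
    then show ?thesis using Cons.IH[of D L] Cons.prems(1) False by auto
  qed
qed

lemma omit_each_eq: "omit_each S cs = map (\<lambda>c. remove1 c S) cs"
  by (induction cs) auto

text \<open>Before and after the step the facets are the same list \<open>K\<close> together with
  the two complementary parts of the boundary of the simplex on \<open>A\<close> and
  \<open>B\<close>. Since no member of \<open>K\<close> contains \<open>A\<close> or
  \<open>B\<close>, the conditions for both directions are immediate.\<close>

lemma bistellar_step_homeomorphic:
  assumes "bistellar_step A B F = Some F'"
  shows "facet_body F homeomorphic facet_body F'"
proof -
  define S where "S = sort (A @ B)"
  define D where "D = omit_each S B"
  have *: "distinct S" "A \<noteq> []" "B \<noteq> []" "map_option ((@) (omit_each S A)) (off_star A B D F) = Some F'"
    using assms unfolding bistellar_step_def Let_def S_def[symmetric] D_def[symmetric] by (simp_all split: if_splits)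
  obtain K where K: "off_star A B D F = Some K" "F' = omit_each S A @ K"
    using *(4) by auto
  have AB: "distinct (A @ B)" using *(1) by (simp add: S_def)
  then have disj: "set A \<inter> set B = {}" by simp
  have rem: "set (remove1 c S) = set A \<union> set B - {c}" for c
    using *(1) by (simp add: S_def set_remove1_eq)
  have "c = c'" if "remove1 c S = remove1 c' S" "c \<in> set B" "c' \<in> set B" for c c'
    using rem[of c] rem[of c'] that by auto
  then have "distinct D" using AB by (auto simp: D_def omit_each_eq distinct_map inj_on_def)
  note K' = off_star_SomeD[OF this K(1)]
  let ?F = "set ` set F" and ?F' = "set ` set F'"
  have D: "set ` set D = (\<lambda>b. set A \<union> set B - {b}) ` set B"
    by (simp add: D_def omit_each_eq image_image rem)
  have FDK: "set F = set D \<union> set K" using K' by auto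
  have F: "?F = (\<lambda>b. set A \<union> set B - {b}) ` set B \<union> set ` set K"
    unfolding FDK image_Un D ..
  have F': "?F' = (\<lambda>a. set A \<union> set B - {a}) ` set A \<union> set ` set K"
    unfolding K(2) by (simp add: omit_each_eq image_Un image_image rem)
  have KA: "\<not> set A \<subseteq> t" and KB: "\<not> set B \<subseteq> t" if "t \<in> set ` set K" for t
    using that K' by auto
  have A1: "set A \<subseteq> set A \<union> set B - {b}" "\<not> set B \<subseteq> set A \<union> set B - {b}" if "b \<in> set B" for b
    using that disj by auto
  have B1: "set B \<subseteq> set A \<union> set B - {a}" "\<not> set A \<subseteq> set A \<union> set B - {a}" if "a \<in> set A" for a
    using that disj by auto
  have "bistellar_pair (set A) (set B) ?F ?F'"
    unfolding bistellar_pair_def F F' using A1 KA KB by auto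
  moreover have "bistellar_pair (set B) (set A) ?F' ?F"
    unfolding bistellar_pair_def F F' using B1 KA KB by (auto simp: Un_commute)
  ultimately have "(\<Union>t\<in>?F. std_simplex t) homeomorphic (\<Union>t\<in>?F'. std_simplex t)"
    using *(2,3) disj by (intro bistellar_move_homeomorphic[of "set A" "set B"]) auto
  then show ?thesis by (simp add: facet_body_def)
qed

primrec bistellar_run :: "('a::linorder list \<times> 'a list) list \<Rightarrow> 'a list list \<Rightarrow> 'a list list option" where
  "bistellar_run [] F = Some F"
| "bistellar_run (m # ms) F = Option.bind (bistellar_step (fst m) (snd m) F) (bistellar_run ms)"

lemma bistellar_run_homeomorphic:
  "bistellar_run ms F = Some F' \<Longrightarrow> facet_body F homeomorphic facet_body F'"
proof (induction ms arbitrary: F)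
  case (Cons m ms)
  then obtain G where "bistellar_step (fst m) (snd m) F = Some G" "bistellar_run ms G = Some F'"
    by (auto simp: bind_eq_Some_conv)
  then show ?case using Cons.IH bistellar_step_homeomorphic homeomorphic_trans by blast
qed (simp add: homeomorphic_refl)

definition polygon_facet_lists :: "nat \<Rightarrow> nat list list" where
  "polygon_facet_lists g = concat (map (\<lambda>i. map sort
     [[12 * g, i, next_index g i], [i, next_index g i, bdry_label g i],
      [next_index g i, bdry_label g i, bdry_label g (next_index g i)]]) [0..<12 * g])"

lemma set_polygon_facet_lists: "set ` set (polygon_facet_lists g) = polygon_facets g"
proof -
  have *: "set ` set (concat (map f xs)) = (\<Union>i\<in>set xs. set ` set (f i))" for f :: "nat \<Rightarrow> nat list list" and xs
    by auto
  show ?thesis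
    unfolding polygon_facet_lists_def polygon_facets_def * set_upt atLeast0LessThan set_map image_comp
    by (simp only: comp_def set_sort list.set image_insert image_empty)
qed

section \<open>Certificates\<close>

type_synonym int_point = "int \<times> int \<times> int"

text \<open>The pairs are those of consecutive entries in \<open>orbit_points\<close>, a point and
  its image under the half-turn.\<close>

definition partner :: "nat \<Rightarrow> nat" where
  "partner v = (if even v then Suc v else v - 1)"

definition partner_facet :: "nat list \<Rightarrow> nat list" where
  "partner_facet t = sort (map partner t)"

primrec orbit_facets :: "(nat list \<times> 'a) list \<Rightarrow> nat list list" where
  "orbit_facets [] = []"
| "orbit_facets (r # R) = fst r # partner_facet (fst r) # orbit_facets R"

primrec orbit_points :: "int_point list \<Rightarrow> int_point list" where
  "orbit_points [] = []"
| "orbit_points (p # C) = p # (- fst p, - fst (snd p), snd (snd p)) # orbit_points C"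

text \<open>
  Two facets are certified by a plane through three vertices and no others that separates them weakly:
  a common point of their images lies in that plane, hence is a convex combination of these three affinely
  independent points in both facets. A facet is paired with itself by its own plane.
\<close>

fun plane_through :: "int_point \<Rightarrow> int_point \<Rightarrow> int_point \<Rightarrow> int_point" where
  "plane_through (a1, a2, a3) (b1, b2, b3) (c1, c2, c3) =
     ((b2 - a2) * (c3 - a3) - (b3 - a3) * (c2 - a2),
      (b3 - a3) * (c1 - a1) - (b1 - a1) * (c3 - a3),
      (b1 - a1) * (c2 - a2) - (b2 - a2) * (c1 - a1))"

fun dot_int :: "int_point \<Rightarrow> int_point \<Rightarrow> int" where
  "dot_int (a1, a2, a3) (b1, b2, b3) = a1 * b1 + a2 * b2 + a3 * b3"

primrec heights :: "int_point \<Rightarrow> int \<Rightarrow> int_point list \<Rightarrow> int list" where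
  "heights n d [] = []"
| "heights n d (p # P) = (dot_int n p - d) # heights n d P"

definition heights_from :: "int_point \<Rightarrow> int_point \<Rightarrow> int_point list \<Rightarrow> int list" where
  "heights_from n a P = heights n (dot_int n a) P"

fun triple_heights :: "int_point list \<Rightarrow> nat list \<Rightarrow> int list" where
  "triple_heights P [a, b, c] = heights_from (plane_through (P ! a) (P ! b) (P ! c)) (P ! a) P"
| "triple_heights P _ = []"

primrec all_heights :: "int_point list \<Rightarrow> nat list list \<Rightarrow> int list list" where
  "all_heights P [] = []"
| "all_heights P (q # qs) = triple_heights P q # all_heights P qs"

text \<open>The number \<open>i\<close> is the index of the head. Passing the test on twelve points
  also proves that \<open>q\<close> spans a plane: a vertex outside \<open>q\<close> then has
  nonzero height, so the normal vector is not 0.\<close>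

primrec zeros_within :: "nat list \<Rightarrow> nat \<Rightarrow> int list \<Rightarrow> bool" where
  "zeros_within q i [] = True"
| "zeros_within q i (h # hs) =
     (if h = 0 then if mem_list i q then zeros_within q (Suc i) hs else False else zeros_within q (Suc i) hs)"

primrec all_zeros_within :: "nat list list \<Rightarrow> int list list \<Rightarrow> bool" where
  "all_zeros_within [] H = True"
| "all_zeros_within (q # qs) H = (if zeros_within q 0 (hd H) then all_zeros_within qs (tl H) else False)"

primrec nonneg_on :: "int list \<Rightarrow> nat list \<Rightarrow> bool" where
  "nonneg_on h [] = True"
| "nonneg_on h (v # t) = (if 0 \<le> h ! v then nonneg_on h t else False)"

primrec nonpos_on :: "int list \<Rightarrow> nat list \<Rightarrow> bool" where
  "nonpos_on h [] = True"
| "nonpos_on h (v # t) = (if h ! v \<le> 0 then nonpos_on h t else False)"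

primrec separated :: "int list list \<Rightarrow> nat list \<Rightarrow> nat list \<Rightarrow> bool" where
  "separated [] t u = False"
| "separated (h # H) t u =
     (if if nonneg_on h t then nonpos_on h u else False then True
      else if if nonpos_on h t then nonneg_on h u else False then True else separated H t u)"

primrec separated_all :: "int list list \<Rightarrow> nat list \<Rightarrow> nat list list \<Rightarrow> bool" where
  "separated_all H t [] = True"
| "separated_all H t (u # us) = (if separated H t u then separated_all H t us else False)"

text \<open>The heights are an argument, so that they are computed once for a facet and shared by
  all comparisons with other facets.\<close>

definition facet_check :: "nat list \<Rightarrow> nat list list \<Rightarrow> int list list \<Rightarrow> nat list list \<Rightarrow> bool" where
  "facet_check t qs H us \<longleftrightarrow> (if all_zeros_within qs H then separated_all H t us else False)"

primrec embedding_check :: "int_point list \<Rightarrow> (nat list \<times> nat list list) list \<Rightarrow> bool" where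
  "embedding_check P [] = True"
| "embedding_check P (r # R) =
     (if facet_check (fst r) (fst r # snd r) (all_heights P (fst r # snd r)) (partner_facet (fst r) # orbit_facets R)
      then embedding_check P R else False)"

primrec count_facets :: "nat \<Rightarrow> nat list list \<Rightarrow> int" where
  "count_facets v [] = 0"
| "count_facets v (t # F) = (if mem_list v t then count_facets v F + 1 else count_facets v F)"

primrec weight_prod :: "int list \<Rightarrow> nat list \<Rightarrow> int" where
  "weight_prod w [] = 1"
| "weight_prod w (v # t) = w ! v * weight_prod w t"

primrec list_diff :: "'a list \<Rightarrow> 'a list \<Rightarrow> 'a list" where
  "list_diff [] u = []"
| "list_diff (v # t) u = (if mem_list v u then list_diff t u else v # list_diff t u)"

primrec neighbour_sum :: "int list \<Rightarrow> nat list \<Rightarrow> nat list list \<Rightarrow> int" where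
  "neighbour_sum w t [] = 0"
| "neighbour_sum w t (u # F) = neighbour_sum w t F +
     (case list_diff u t of [] \<Rightarrow> 0 | v # vs \<Rightarrow> (case vs of [] \<Rightarrow> w ! v | _ # _ \<Rightarrow> 0))"

primrec pair_sum :: "int list \<Rightarrow> nat list list \<Rightarrow> nat list list \<Rightarrow> int" where
  "pair_sum w G [] = 0"
| "pair_sum w G (t # F) = pair_sum w G F + weight_prod w t * neighbour_sum w t G"

definition degree_list :: "nat list list \<Rightarrow> int list" where
  "degree_list F = [count_facets 0 F, count_facets 1 F, count_facets 2 F, count_facets 3 F, count_facets 4 F,
     count_facets 5 F, count_facets 6 F, count_facets 7 F, count_facets 8 F, count_facets 9 F,
     count_facets 10 F, count_facets 11 F]"

definition list_invariant :: "nat list list \<Rightarrow> int" where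
  "list_invariant F = pair_sum (degree_list F) F F"

section \<open>An isomorphism invariant made from vertex degrees\<close>

definition facets :: "'v set set \<Rightarrow> 'v set set" where
  "facets \<Delta> = {\<sigma> \<in> \<Delta>. card \<sigma> = 3}"

definition facet_degree :: "'v set set \<Rightarrow> 'v \<Rightarrow> int" where
  "facet_degree \<Delta> v = int (card {\<sigma> \<in> facets \<Delta>. v \<in> \<sigma>})"

text \<open>Two facets with \<open>card (\<tau> - \<sigma>) = 1\<close> share an edge. On a closed
  surface the value is therefore twice the sum, over all edges, of the product of the degrees of the
  four vertices in the two facets at that edge.\<close>

definition degree_invariant :: "'v set set \<Rightarrow> int" where
  "degree_invariant \<Delta> = (\<Sum>\<sigma>\<in>facets \<Delta>. \<Sum>\<tau>\<in>facets \<Delta>.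
     if card (\<tau> - \<sigma>) = 1 then \<Prod>v\<in>\<sigma> \<union> \<tau>. facet_degree \<Delta> v else 0)"

lemma degree_invariant_iso:
  assumes iso: "simplicial_iso \<Delta> \<Gamma> f"
  shows "degree_invariant \<Gamma> = degree_invariant \<Delta>"
proof -
  have inj: "inj_on f (vertices \<Delta>)" and img: "\<Gamma> = (`) f ` \<Delta>"
    using iso by (auto simp: simplicial_iso_def bij_betw_def)
  have sub: "\<sigma> \<subseteq> vertices \<Delta>" if "\<sigma> \<in> facets \<Delta>" for \<sigma>
    using that by (auto simp: vertices_def facets_def)
  have sub': "\<sigma> \<subseteq> vertices \<Delta>" if "\<sigma> \<in> \<Delta>" for \<sigma>
    using that by (auto simp: vertices_def)
  have card: "card (f ` S) = card S" if "S \<subseteq> vertices \<Delta>" for S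
    using card_image inj_on_subset[OF inj that] by blast
  have fac: "facets \<Gamma> = (`) f ` facets \<Delta>"
    using card sub' unfolding facets_def img by auto
  have inji: "inj_on ((`) f) (facets \<Delta>)"
    using inj_on_image_eq_iff[OF inj] sub by (auto simp: inj_on_def)
  have deg: "facet_degree \<Gamma> (f v) = facet_degree \<Delta> v" if "v \<in> vertices \<Delta>" for v
  proof -
    have "{\<sigma> \<in> facets \<Gamma>. f v \<in> \<sigma>} = (`) f ` {\<sigma> \<in> facets \<Delta>. v \<in> \<sigma>}"
      unfolding fac using inj_on_image_mem_iff[OF inj that] sub by auto
    moreover have "card ((`) f ` {\<sigma> \<in> facets \<Delta>. v \<in> \<sigma>}) = card {\<sigma> \<in> facets \<Delta>. v \<in> \<sigma>}"
      by (rule card_image) (rule inj_on_subset[OF inji], auto)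
    ultimately show ?thesis by (simp add: facet_degree_def)
  qed
  have "degree_invariant \<Gamma> = (\<Sum>\<sigma>\<in>facets \<Delta>. \<Sum>\<tau>\<in>facets \<Delta>.
     if card (f ` \<tau> - f ` \<sigma>) = 1 then \<Prod>v\<in>f ` \<sigma> \<union> f ` \<tau>. facet_degree \<Gamma> v else 0)"
    unfolding degree_invariant_def fac by (simp add: sum.reindex[OF inji])
  also have "\<dots> = degree_invariant \<Delta>"
    unfolding degree_invariant_def
  proof (intro sum.cong refl)
    fix \<sigma> \<tau> assume st: "\<sigma> \<in> facets \<Delta>" "\<tau> \<in> facets \<Delta>"
    have "f ` \<tau> - f ` \<sigma> = f ` (\<tau> - \<sigma>)"
      using inj_on_image_set_diff[OF inj, of \<tau> \<sigma>] sub st by auto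
    then have 1: "card (f ` \<tau> - f ` \<sigma>) = card (\<tau> - \<sigma>)"
      using card[of "\<tau> - \<sigma>"] sub[OF st(2)] by auto
    have "inj_on f (\<sigma> \<union> \<tau>)" using inj_on_subset[OF inj] sub st by simp
    then have "(\<Prod>v\<in>f ` (\<sigma> \<union> \<tau>). facet_degree \<Gamma> v) = (\<Prod>v\<in>\<sigma> \<union> \<tau>. facet_degree \<Gamma> (f v))"
      by (simp add: prod.reindex)
    also have "\<dots> = (\<Prod>v\<in>\<sigma> \<union> \<tau>. facet_degree \<Delta> v)"
      using deg sub[OF st(1)] sub[OF st(2)] by (intro prod.cong refl) blast
    finally show "(if card (f ` \<tau> - f ` \<sigma>) = 1 then \<Prod>v\<in>f ` \<sigma> \<union> f ` \<tau>. facet_degree \<Gamma> v else 0)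
        = (if card (\<tau> - \<sigma>) = 1 then \<Prod>v\<in>\<sigma> \<union> \<tau>. facet_degree \<Delta> v else 0)"
      unfolding 1 by (simp add: image_Un)
  qed
  finally show ?thesis .
qed

section \<open>Complexes given by lists of facets\<close>

definition list_complex :: "nat list list \<Rightarrow> nat set set" where
  "list_complex F = generated_complex (set ` set F)"

text \<open>Sorted entries make \<open>set\<close> injective on the list, so that sums over the list
  count each facet once. The last clause fixes the vertex set as the numbers below 12.\<close>

definition triangle_list :: "nat list list \<Rightarrow> bool" where
  "triangle_list F \<longleftrightarrow> distinct F \<and> list_all (\<lambda>t. sorted t \<and> distinct t \<and> length t = 3 \<and> list_all (\<lambda>v. v < 12) t) F
     \<and> list_all (\<lambda>v. list_ex (mem_list v) F) [0,1,2,3,4,5,6,7,8,9,10,11]"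

lemma triangle_listD:
  assumes "triangle_list F"
  shows "distinct F" "inj_on set (set F)" "\<And>t. t \<in> set F \<Longrightarrow> card (set t) = 3"
    "\<And>t. t \<in> set F \<Longrightarrow> distinct t \<and> length t = 3" "\<And>t. t \<in> set F \<Longrightarrow> set t \<subseteq> {..<12}" "\<Union>(set ` set F) = {..<12}"
proof -
  have *: "sorted t" "distinct t" "length t = 3" "set t \<subseteq> {..<12}" if "t \<in> set F" for t
    using assms that by (auto simp: triangle_list_def list_all_iff)
  show "distinct F" using assms by (simp add: triangle_list_def)
  show "inj_on set (set F)" using * by (intro inj_onI sorted_distinct_set_unique) auto
  show "card (set t) = 3" if "t \<in> set F" for t using *[OF that] by (simp add: distinct_card)
  show "distinct t \<and> length t = 3" if "t \<in> set F" for t using *[OF that] by simp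
  show "set t \<subseteq> {..<12}" if "t \<in> set F" for t using *[OF that] by simp
  have "v \<in> \<Union>(set ` set F)" if "v < 12" for v
    using assms less_12_cases[OF that] by (auto simp: triangle_list_def list_ex_iff)
  then show "\<Union>(set ` set F) = {..<12}" using *(4) by fastforce
qed

lemma facets_list_complex:
  assumes "triangle_list F"
  shows "facets (list_complex F) = set ` set F"
proof -
  note F = triangle_listD[OF assms]
  have "\<sigma> = set t" if "\<sigma> \<subseteq> set t" "t \<in> set F" "card \<sigma> = 3" for \<sigma> t
    using that F(3)[OF that(2)] card_subset_eq[of "set t" \<sigma>] by simp
  moreover have "set t \<noteq> {}" if "t \<in> set F" for t using F(3)[OF that] by auto
  ultimately show ?thesis using F(3)
    by (auto simp: facets_def list_complex_def generated_complex_def)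
qed

lemma vertices_list_complex:
  assumes "triangle_list F"
  shows "vertices (list_complex F) = {..<12}"
proof -
  have "vertices (list_complex F) = \<Union>(set ` set F)"
    unfolding vertices_def list_complex_def generated_complex_def
  proof (intro equalityI subsetI)
    fix v assume "v \<in> \<Union>(set ` set F)"
    then obtain t where "t \<in> set F" "v \<in> set t" by blast
    then show "v \<in> \<Union>{\<sigma>. \<sigma> \<noteq> {} \<and> (\<exists>t\<in>set ` set F. \<sigma> \<subseteq> t)}"
      by (intro UnionI[of "set t"]) auto
  qed auto
  then show ?thesis using triangle_listD(6)[OF assms] by simp
qed

lemma underlying_space_list_complex: "underlying_space (list_complex F) = facet_body F"
  unfolding list_complex_def facet_body_def by (subst underlying_space_generated) auto

lemma fin_complex_list_complex: "fin_complex (list_complex F)"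
proof -
  have "list_complex F \<subseteq> (\<Union>t\<in>set F. Pow (set t))" by (auto simp: list_complex_def generated_complex_def)
  then have "finite (list_complex F)" by (rule finite_subset) simp
  moreover have "finite \<sigma>" if "\<sigma> \<in> list_complex F" for \<sigma>
    using that finite_subset by (auto simp: list_complex_def generated_complex_def)
  moreover have "\<tau> \<in> list_complex F" if "\<sigma> \<in> list_complex F" "\<tau> \<subseteq> \<sigma>" "\<tau> \<noteq> {}" for \<sigma> \<tau>
    using that unfolding list_complex_def generated_complex_def by (blast intro: subset_trans)
  moreover have "{} \<notin> list_complex F" by (simp add: list_complex_def generated_complex_def)
  ultimately show ?thesis unfolding fin_complex_def by blast
qed

lemma two_dimensional_list_complex:
  assumes "triangle_list F"
  shows "two_dimensional (list_complex F)"
proof -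
  note F = triangle_listD[OF assms]
  have "card \<sigma> \<le> 3" if s: "\<sigma> \<in> list_complex F" for \<sigma>
  proof -
    obtain t where "t \<in> set F" "\<sigma> \<subseteq> set t"
      using s by (auto simp: list_complex_def generated_complex_def)
    then show ?thesis using card_mono[of "set t" \<sigma>] F(3) by simp
  qed
  moreover have "set F \<noteq> {}"
  proof
    assume "set F = {}"
    then have "0 \<notin> \<Union>(set ` set F)" by simp
    then show False unfolding F(6) by simp
  qed
  moreover have "set t \<in> list_complex F \<and> card (set t) = 3" if "t \<in> set F" for t
    using F(3)[OF that] that by (auto simp: list_complex_def generated_complex_def)
  ultimately show ?thesis unfolding two_dimensional_def by (meson ex_in_conv)
qed

lemma count_facets_eq: "distinct F \<Longrightarrow> count_facets v F = int (card {t \<in> set F. v \<in> set t})"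
proof (induction F)
  case (Cons t F)
  have "{s \<in> set (t # F). v \<in> set s} = (if v \<in> set t then insert t {s \<in> set F. v \<in> set s} else {s \<in> set F. v \<in> set s})"
    by auto
  then show ?case using Cons by (simp split: if_splits)
qed simp

lemma facet_degree_list_complex:
  assumes "triangle_list F" "v < 12"
  shows "degree_list F ! v = facet_degree (list_complex F) v"
proof -
  note F = triangle_listD[OF assms(1)]
  have "{\<sigma> \<in> facets (list_complex F). v \<in> \<sigma>} = set ` {t \<in> set F. v \<in> set t}"
    unfolding facets_list_complex[OF assms(1)] by auto
  then have "facet_degree (list_complex F) v = int (card {t \<in> set F. v \<in> set t})"
    using card_image[OF inj_on_subset[OF F(2)], of "{t \<in> set F. v \<in> set t}"] by (simp add: facet_degree_def)
  moreover have "degree_list F ! v = count_facets v F"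
    using less_12_cases[OF assms(2)] unfolding degree_list_def by (elim insertE emptyE) simp_all
  ultimately show ?thesis using count_facets_eq[OF F(1)] by simp
qed

lemma list_diff_eq: "list_diff u t = filter (\<lambda>v. v \<notin> set t) u"
  by (induction u) auto

lemma weight_prod_eq: "distinct t \<Longrightarrow> weight_prod w t = (\<Prod>v\<in>set t. w ! v)"
  by (induction t) auto

lemma neighbour_sum_eq:
  "distinct F \<Longrightarrow> (\<And>u. u \<in> set F \<Longrightarrow> distinct u) \<Longrightarrow>
   neighbour_sum w t F = (\<Sum>u\<in>set F. if card (set u - set t) = 1 then \<Prod>v\<in>set u - set t. w ! v else 0)"
proof (induction F)
  case (Cons u F)
  let ?d = "list_diff u t"
  have d: "distinct ?d" "set ?d = set u - set t" using Cons.prems by (auto simp: list_diff_eq)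
  have "(case ?d of [] \<Rightarrow> 0 | v # vs \<Rightarrow> (case vs of [] \<Rightarrow> w ! v | _ # _ \<Rightarrow> 0))
      = (if card (set u - set t) = 1 then \<Prod>v\<in>set u - set t. w ! v else 0)"
    unfolding d(2)[symmetric] distinct_card[OF d(1)] by (cases ?d; cases "tl ?d") auto
  then show ?case using Cons by simp
qed simp

lemma pair_sum_eq: "distinct F \<Longrightarrow> pair_sum w G F = (\<Sum>t\<in>set F. weight_prod w t * neighbour_sum w t G)"
  by (induction F) auto

text \<open>For adjacent facets the union consists of \<open>t\<close> and one further vertex of
  \<open>u\<close>, so the product over \<open>t\<close> can be taken out of the inner sum, which
  leaves a sum of single degrees.\<close>

lemma list_invariant_eq:
  assumes "triangle_list F"
  shows "list_invariant F = degree_invariant (list_complex F)"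
proof -
  note F = triangle_listD[OF assms]
  let ?w = "\<lambda>v. degree_list F ! v" and ?d = "facet_degree (list_complex F)"
  have "degree_invariant (list_complex F) = (\<Sum>t\<in>set F. \<Sum>u\<in>set F.
     if card (set u - set t) = 1 then \<Prod>v\<in>set t \<union> set u. ?d v else 0)"
    unfolding degree_invariant_def facets_list_complex[OF assms] by (simp add: sum.reindex[OF F(2)])
  also have "\<dots> = (\<Sum>t\<in>set F. weight_prod (degree_list F) t * neighbour_sum (degree_list F) t F)"
  proof (intro sum.cong refl)
    fix t assume t: "t \<in> set F"
    have eq: "?w v = ?d v" if "v \<in> set u" "u \<in> set F" for u v
      using facet_degree_list_complex[OF assms] F(5) that by blast
    have 1: "weight_prod (degree_list F) t = (\<Prod>v\<in>set t. ?d v)"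
      using F(4)[OF t] eq[OF _ t] by (simp add: weight_prod_eq)
    have 2: "neighbour_sum (degree_list F) t F
        = (\<Sum>u\<in>set F. if card (set u - set t) = 1 then \<Prod>v\<in>set u - set t. ?d v else 0)"
      using F(1,4) eq by (subst neighbour_sum_eq) (auto intro!: sum.cong prod.cong)
    have 3: "(\<Prod>v\<in>set t \<union> set u. ?d v) = (\<Prod>v\<in>set t. ?d v) * (\<Prod>v\<in>set u - set t. ?d v)" for u
      using prod.union_disjoint[of "set t" "set u - set t" ?d] by (simp add: Un_Diff_cancel)
    show "(\<Sum>u\<in>set F. if card (set u - set t) = 1 then \<Prod>v\<in>set t \<union> set u. ?d v else 0)
        = weight_prod (degree_list F) t * neighbour_sum (degree_list F) t F"
      unfolding 1 2 3 sum_distrib_left by (intro sum.cong refl) simp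
  qed
  finally show ?thesis by (simp add: list_invariant_def pair_sum_eq[OF F(1)])
qed

section \<open>Relabelling of vertices and checking of runs of moves\<close>

lemma facet_body_relabel:
  fixes f :: "'a \<Rightarrow> 'b"
  assumes "inj_on f (\<Union>(set ` set F))"
  shows "facet_body F homeomorphic facet_body (map (map f) F)"
proof -
  define V where "V = \<Union>(set ` set F)"
  define g where "g = inv_into V f"
  define \<Phi> where "\<Phi> x = (\<lambda>w. if w \<in> f ` V then x (g w) else (0::real))" for x :: "'a \<Rightarrow> real"
  define \<Psi> where "\<Psi> y = (\<lambda>v. if v \<in> V then y (f v) else (0::real))" for y :: "'b \<Rightarrow> real"
  have inj: "inj_on f V" using assms by (simp add: V_def)
  have gf: "g (f v) = v" if "v \<in> V" for v using inj that by (simp add: g_def)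
  have V: "set t \<subseteq> V" if "t \<in> set F" for t using that by (auto simp: V_def)
  have 1: "\<Phi> x \<in> std_simplex (f ` set t)" if "t \<in> set F" "x \<in> std_simplex (set t)" for x t
  proof -
    have z: "x v = 0" if "v \<notin> set t" for v using \<open>x \<in> _\<close> that by (simp add: std_simplex_def)
    have "(\<Sum>w\<in>f ` set t. \<Phi> x w) = (\<Sum>v\<in>set t. \<Phi> x (f v))"
      using inj_on_subset[OF inj V[OF that(1)]] by (simp add: sum.reindex)
    also have "\<dots> = (\<Sum>v\<in>set t. x v)"
      using V[OF that(1)] by (intro sum.cong refl) (simp add: \<Phi>_def gf subsetD)
    finally have "(\<Sum>w\<in>f ` set t. \<Phi> x w) = 1" using that by (simp add: std_simplex_def)
    moreover have "\<Phi> x w = 0" if w: "w \<notin> f ` set t" for w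
    proof (cases "w \<in> f ` V")
      case True
      then obtain v where "v \<in> V" "w = f v" by blast
      then show ?thesis using w z gf by (auto simp: \<Phi>_def)
    qed (simp add: \<Phi>_def)
    ultimately show ?thesis using that by (auto simp: std_simplex_def \<Phi>_def)
  qed
  have 2: "\<Psi> y \<in> std_simplex (set t)" if "t \<in> set F" "y \<in> std_simplex (f ` set t)" for y t
  proof -
    have z: "y w = 0" if "w \<notin> f ` set t" for w using \<open>y \<in> _\<close> that by (simp add: std_simplex_def)
    have "(\<Sum>w\<in>f ` set t. y w) = (\<Sum>v\<in>set t. y (f v))"
      using inj_on_subset[OF inj V[OF that(1)]] by (simp add: sum.reindex)
    also have "\<dots> = (\<Sum>v\<in>set t. \<Psi> y v)"
      using V[OF that(1)] by (intro sum.cong) (auto simp: \<Psi>_def)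
    finally have "(\<Sum>v\<in>set t. \<Psi> y v) = 1" using that by (simp add: std_simplex_def)
    moreover have "\<Psi> y v = 0" if v: "v \<notin> set t" for v
    proof (cases "v \<in> V")
      case True
      then have "f v \<notin> f ` set t" using inj_on_image_mem_iff[OF inj True V[OF \<open>t \<in> set F\<close>]] v by simp
      then show ?thesis using z by (simp add: \<Psi>_def)
    qed (simp add: \<Psi>_def)
    ultimately show ?thesis using that by (auto simp: std_simplex_def \<Psi>_def)
  qed
  have 3: "\<Psi> (\<Phi> x) = x" if "t \<in> set F" "x \<in> std_simplex (set t)" for x t
    using that V[OF that(1)] gf by (fastforce simp: \<Psi>_def \<Phi>_def std_simplex_def fun_eq_iff)
  have 4: "\<Phi> (\<Psi> y) = y" if "t \<in> set F" "y \<in> std_simplex (f ` set t)" for y t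
  proof
    fix w show "\<Phi> (\<Psi> y) w = y w"
    proof (cases "w \<in> f ` V")
      case True
      then show ?thesis using gf by (auto simp: \<Psi>_def \<Phi>_def)
    next
      case False
      then have "w \<notin> f ` set t" using V[OF that(1)] by blast
      then show ?thesis using that False by (simp add: \<Phi>_def std_simplex_def)
    qed
  qed
  have c\<Phi>: "continuous_on S \<Phi>" for S
    unfolding \<Phi>_def
  proof (intro continuous_on_coordinatewise_then_product)
    show "continuous_on S (\<lambda>x. if i \<in> f ` V then x (g i) else (0::real))" for i
      by (cases "i \<in> f ` V") (simp_all add: continuous_on_subset[OF continuous_on_product_coordinates])
  qed
  have c\<Psi>: "continuous_on S \<Psi>" for S
    unfolding \<Psi>_def
  proof (intro continuous_on_coordinatewise_then_product)
    show "continuous_on S (\<lambda>x. if i \<in> V then x (f i) else (0::real))" for i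
      by (cases "i \<in> V") (simp_all add: continuous_on_subset[OF continuous_on_product_coordinates])
  qed
  have "homeomorphism (facet_body F) (facet_body (map (map f) F)) \<Phi> \<Psi>"
    by (intro homeomorphismI c\<Phi> c\<Psi>) (auto simp: facet_body_def dest: 1 2 3 4)
  then show ?thesis by (auto simp: homeomorphic_def)
qed

primrec relabel :: "int list \<Rightarrow> nat list list \<Rightarrow> int list list" where
  "relabel p [] = []"
| "relabel p (t # F) = sort (map ((!) p) t) # relabel p F"

text \<open>The runs work on integers, which are evaluated as binary numerals. \<open>p\<close>
  sends a vertex of the target to its label at the end of the run; the two lists of facets may
  differ in order, hence the two inclusions.\<close>

definition flip_check :: "int list list \<Rightarrow> (int list \<times> int list) list \<Rightarrow> int list \<Rightarrow> nat list list \<Rightarrow> bool" where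
  "flip_check F ms p G \<longleftrightarrow> distinct p \<and> length p = 12 \<and>
     (case bistellar_run ms F of None \<Rightarrow> False
      | Some F' \<Rightarrow> if sub_list F' (relabel p G) then sub_list (relabel p G) F' else False)"

lemma flip_check_homeomorphic:
  assumes "flip_check F ms p G" "triangle_list G"
  shows "facet_body F homeomorphic facet_body G"
proof -
  obtain F' where F': "bistellar_run ms F = Some F'" "set F' = set (relabel p G)" and p: "distinct p" "length p = 12"
    using assms(1) by (auto simp: flip_check_def sub_list_iff split: option.splits if_splits)
  have "set ` set (relabel p G) = set ` set (map (map ((!) p)) G)"
    by (induction G) auto
  then have *: "set ` set F' = set ` set (map (map ((!) p)) G)" by (simp only: F'(2))
  have fb: "facet_body F = (\<Union>t\<in>set ` set F. std_simplex t)" for F :: "int list list"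
    by (simp add: facet_body_def)
  have "facet_body F' = facet_body (map (map ((!) p)) G)"
    by (simp only: fb *)
  moreover have "inj_on ((!) p) (\<Union>(set ` set G))"
    using p triangle_listD(6)[OF assms(2)] by (auto simp: inj_on_def nth_eq_iff_index_eq)
  then have "facet_body G homeomorphic facet_body (map (map ((!) p)) G)" by (rule facet_body_relabel)
  ultimately show ?thesis
    using bistellar_run_homeomorphic[OF F'(1)] homeomorphic_sym homeomorphic_trans by metis
qed

lemma polygon_facet_lists_homeomorphic:
  assumes "0 < g"
  shows "top_of_set (facet_body (polygon_facet_lists g)) homeomorphic_space orientable_surface g"
proof -
  interpret surface_polygon g by (unfold_locales) (rule assms)
  have "facet_body (polygon_facet_lists g) = (\<Union>t\<in>polygon_facets g. std_simplex t)"
    unfolding facet_body_def set_polygon_facet_lists[symmetric] by simp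
  then show ?thesis using polygon_facets_homeomorphic by simp
qed

section \<open>Separating planes and injectivity\<close>

definition real_point :: "int_point \<Rightarrow> real^3" where
  "real_point p = vector [real_of_int (fst p), real_of_int (fst (snd p)), real_of_int (snd (snd p))]"

definition point_map :: "int_point list \<Rightarrow> (nat \<Rightarrow> real) \<Rightarrow> real^3" where
  "point_map P x = (\<Sum>v<12. x v *\<^sub>R real_point (P ! v))"

lemma real_point_nth [simp]:
  "real_point p $ 1 = real_of_int (fst p)" "real_point p $ 2 = real_of_int (fst (snd p))"
  "real_point p $ 3 = real_of_int (snd (snd p))"
  by (simp_all add: real_point_def vector_3)

lemma point_map_nth [simp]:
  "point_map P x $ 1 = (\<Sum>v<12. x v * real_of_int (fst (P ! v)))"
  "point_map P x $ 2 = (\<Sum>v<12. x v * real_of_int (fst (snd (P ! v))))"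
  "point_map P x $ 3 = (\<Sum>v<12. x v * real_of_int (snd (snd (P ! v))))"
  by (simp_all add: point_map_def sum_component)

lemma length_orbit_points [simp]: "length (orbit_points C) = 2 * length C"
  by (induction C) auto

definition int_rot :: "int_point \<Rightarrow> int_point" where
  "int_rot p = (- fst p, - fst (snd p), snd (snd p))"

lemma int_rot_int_rot [simp]: "int_rot (int_rot p) = p"
  by (simp add: int_rot_def)

lemma partner_partner [simp]: "partner (partner v) = v"
  by (auto simp: partner_def)

lemma partner_less_12: "v < 12 \<Longrightarrow> partner v < 12"
  by (auto simp: partner_def elim: oddE)

lemma inj_partner: "inj_on partner A"
  by (metis inj_on_def partner_partner)

lemma partner_image_12: "partner ` {..<12} = {..<12}"
proof (intro equalityI subsetI)
  fix v assume "v \<in> {..<12::nat}"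
  then show "v \<in> partner ` {..<12}"
    by (intro image_eqI[of _ _ "partner v"]) (auto simp: partner_less_12)
qed (auto simp: partner_less_12)

lemma nth_orbit_points:
  "i < length C \<Longrightarrow> orbit_points C ! (2 * i) = C ! i \<and> orbit_points C ! Suc (2 * i) = int_rot (C ! i)"
proof (induction C arbitrary: i)
  case (Cons p C)
  then show ?case by (cases i) (auto simp: int_rot_def)
qed simp

lemma nth_orbit_points_partner:
  assumes "v < 2 * length C"
  shows "orbit_points C ! partner v = int_rot (orbit_points C ! v)"
proof (cases "even v")
  case True
  then obtain i where "v = 2 * i" by blast
  then show ?thesis using assms nth_orbit_points[of i C] by (simp add: partner_def)
next
  case False
  then obtain i where "v = Suc (2 * i)" by (auto elim: oddE)
  then show ?thesis using assms nth_orbit_points[of i C] by (simp add: partner_def)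
qed

lemma set_partner_facet: "set (partner_facet t) = partner ` set t"
  by (simp add: partner_facet_def)

lemma partner_facet_partner_facet: "set (partner_facet (partner_facet t)) = set t"
  by (simp add: set_partner_facet image_image)

lemma length_heights [simp]: "length (heights n d P) = length P"
  by (induction P) auto

lemma nth_heights: "v < length P \<Longrightarrow> heights n d P ! v = dot_int n (P ! v) - d"
  by (induction P arbitrary: v) (auto simp: nth_Cons split: nat.splits)

lemma dot_int_alt: "dot_int n p = fst n * fst p + fst (snd n) * fst (snd p) + snd (snd n) * snd (snd p)"
  by (cases n; cases p) simp

lemma nth_triple_heights:
  assumes "v < length P"
  shows "triple_heights P [a, b, c] ! v
     = dot_int (plane_through (P ! a) (P ! b) (P ! c)) (P ! v) - dot_int (plane_through (P ! a) (P ! b) (P ! c)) (P ! a)"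
  using assms by (simp add: heights_from_def nth_heights)

lemma zeros_within_iff: "zeros_within q i hs \<longleftrightarrow> (\<forall>j<length hs. hs ! j = 0 \<longrightarrow> i + j \<in> set q)"
proof (induction hs arbitrary: i)
  case (Cons h hs)
  have "(\<forall>j<length (h # hs). (h # hs) ! j = 0 \<longrightarrow> i + j \<in> set q) \<longleftrightarrow>
      (h = 0 \<longrightarrow> i \<in> set q) \<and> (\<forall>j<length hs. hs ! j = 0 \<longrightarrow> Suc i + j \<in> set q)"
    by (auto simp: nth_Cons less_Suc_eq_0_disj split: nat.splits)
  then show ?case using Cons by simp
qed simp

lemma nonneg_on_iff: "nonneg_on h t \<longleftrightarrow> (\<forall>v\<in>set t. 0 \<le> h ! v)"
  by (induction t) auto

lemma nonpos_on_iff: "nonpos_on h t \<longleftrightarrow> (\<forall>v\<in>set t. h ! v \<le> 0)"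
  by (induction t) auto

lemma separated_iff:
  "separated H t u \<longleftrightarrow> (\<exists>h\<in>set H. (nonneg_on h t \<and> nonpos_on h u) \<or> (nonpos_on h t \<and> nonneg_on h u))"
  by (induction H) auto

lemma separated_all_iff: "separated_all H t us \<longleftrightarrow> (\<forall>u\<in>set us. separated H t u)"
  by (induction us) auto

lemma set_all_heights: "set (all_heights P qs) = triple_heights P ` set qs"
  by (induction qs) auto

lemma all_zeros_within_iff:
  "all_zeros_within qs (all_heights P qs) \<longleftrightarrow> (\<forall>q\<in>set qs. zeros_within q 0 (triple_heights P q))"
  by (induction qs) auto

definition disjoint_images :: "int_point list \<Rightarrow> nat set \<Rightarrow> nat set \<Rightarrow> bool" where
  "disjoint_images P s t \<longleftrightarrow>
     (\<forall>x\<in>std_simplex s. \<forall>y\<in>std_simplex t. point_map P x = point_map P y \<longrightarrow> x = y)"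

lemma disjoint_images_sym: "disjoint_images P s t \<Longrightarrow> disjoint_images P t s"
  unfolding disjoint_images_def by metis

lemma sum_std_simplex:
  fixes s :: "nat set"
  assumes "x \<in> std_simplex s" "s \<subseteq> {..<12}"
  shows "(\<Sum>v<12. x v) = 1"
proof -
  have "(\<Sum>v<12. x v) = (\<Sum>v\<in>s. x v)"
    using assms by (intro sum.mono_neutral_right) (auto simp: std_simplex_def)
  then show ?thesis using assms by (simp add: std_simplex_def)
qed

text \<open>The height of \<open>w\<close> is the determinant of \<open>b - a\<close>,
  \<open>c - a\<close> and \<open>w - a\<close>. If it is not 0, the three points are affinely
  independent, and an affine relation supported on them is trivial. It is applied to the difference
  of two systems of barycentric coordinates.\<close>

lemma affine_independent_triple:
  fixes P :: "int_point list"
  assumes abc: "a < 12" "b < 12" "c < 12" and w: "w < 12" "length P = 12" "triple_heights P [a, b, c] ! w \<noteq> 0"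
    and d: "\<And>v. v \<notin> {a, b, c} \<Longrightarrow> d v = (0::real)" "(\<Sum>v<12. d v) = 0" "point_map P d = 0"
  shows "d = (\<lambda>v. 0)"
proof -
  obtain a1 a2 a3 where A: "P ! a = (a1, a2, a3)" by (cases "P ! a")
  obtain b1 b2 b3 where B: "P ! b = (b1, b2, b3)" by (cases "P ! b")
  obtain c1 c2 c3 where C: "P ! c = (c1, c2, c3)" by (cases "P ! c")
  obtain w1 w2 w3 where W: "P ! w = (w1, w2, w3)" by (cases "P ! w")
  let ?n1 = "(b2 - a2) * (c3 - a3) - (b3 - a3) * (c2 - a2)"
  let ?n2 = "(b3 - a3) * (c1 - a1) - (b1 - a1) * (c3 - a3)"
  let ?n3 = "(b1 - a1) * (c2 - a2) - (b2 - a2) * (c1 - a1)"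
  txt \<open>Cramer's rule with the determinant \<open>D\<close> of \<open>b - a\<close>, \<open>c - a\<close>, \<open>w - a\<close>\<close>
  define D where "D = ?n1 * (w1 - a1) + ?n2 * (w2 - a2) + ?n3 * (w3 - a3)"
  have D: "D \<noteq> 0"
    using w(3) nth_triple_heights[of w P a b c] w(1,2) by (simp add: A B C W D_def algebra_simps)
  have dist: "a \<noteq> b" "a \<noteq> c" "b \<noteq> c"
    using D A B C by (auto simp: D_def)
  have S: "(\<Sum>v<12. d v * f v) = d a * f a + (d b * f b + d c * f c)" for f
  proof -
    have "(\<Sum>v<12. d v * f v) = (\<Sum>v\<in>{a, b, c}. d v * f v)"
      using abc d(1) by (intro sum.mono_neutral_right) auto
    then show ?thesis using dist by simp
  qed
  have e0: "d a + d b + d c = 0" using S[of "\<lambda>_. 1"] d(2) by simp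
  have e: "d a * a1 + (d b * b1 + d c * c1) = 0" "d a * a2 + (d b * b2 + d c * c2) = 0" "d a * a3 + (d b * b3 + d c * c3) = 0"
    using S[of "\<lambda>v. real_of_int (fst (P ! v))"] S[of "\<lambda>v. real_of_int (fst (snd (P ! v)))"]
      S[of "\<lambda>v. real_of_int (snd (snd (P ! v)))"] point_map_nth[of P d] by (auto simp: A B C d(3))
  have da: "d a = - d b - d c" using e0 by simp
  have f: "d b * (b1 - a1) + d c * (c1 - a1) = 0" "d b * (b2 - a2) + d c * (c2 - a2) = 0" "d b * (b3 - a3) + d c * (c3 - a3) = 0"
    using e unfolding da by (simp_all add: algebra_simps)
  define p1 p2 p3 q1 q2 q3 r1 r2 r3 :: real where
    pq: "p1 = b1 - a1" "p2 = b2 - a2" "p3 = b3 - a3" "q1 = c1 - a1" "q2 = c2 - a2" "q3 = c3 - a3"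
      "r1 = w1 - a1" "r2 = w2 - a2" "r3 = w3 - a3"
  have DR: "real_of_int D = (p2 * q3 - p3 * q2) * r1 + (p3 * q1 - p1 * q3) * r2 + (p1 * q2 - p2 * q1) * r3"
    by (simp add: D_def pq)
  have f': "d b * p1 + d c * q1 = 0" "d b * p2 + d c * q2 = 0" "d b * p3 + d c * q3 = 0"
    using f by (simp_all add: pq)
  \<comment> \<open>The relation between the vectors \<open>p\<close> and \<open>q\<close> is
    multiplied by the cross product of \<open>q\<close> and \<open>r\<close>, which annihilates
    \<open>q\<close> and turns \<open>p\<close> into \<open>D\<close>; for \<open>d c\<close> below,
    the cross product of \<open>r\<close> and \<open>p\<close> is used.\<close>
  have "d b * real_of_int D = (d b * p1 + d c * q1) * (q2 * r3 - q3 * r2) + (d b * p2 + d c * q2) * (q3 * r1 - q1 * r3)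
      + (d b * p3 + d c * q3) * (q1 * r2 - q2 * r1)"
    unfolding DR by (simp add: algebra_simps)
  then have b0: "d b = 0" using D by (simp add: f')
  have "d c * real_of_int D = (d b * p1 + d c * q1) * (r2 * p3 - r3 * p2) + (d b * p2 + d c * q2) * (r3 * p1 - r1 * p3)
      + (d b * p3 + d c * q3) * (r1 * p2 - r2 * p1)"
    unfolding DR by (simp add: algebra_simps)
  then have c0: "d c = 0" using D by (simp add: f')
  have "d a = 0" using da b0 c0 by simp
  then show ?thesis using b0 c0 d(1) by (metis insertE empty_iff)
qed

lemma separated_disjoint_images:
  assumes P: "length P = 12" and q: "h = triple_heights P q" "length q = 3" "set q \<subseteq> {..<12}" "zeros_within q 0 h"
    and t: "set t \<subseteq> {..<12}" "nonneg_on h t" and u: "set u \<subseteq> {..<12}" "nonpos_on h u"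
  shows "disjoint_images P (set t) (set u)"
  unfolding disjoint_images_def
proof (intro ballI impI)
  fix x y assume x: "x \<in> std_simplex (set t)" and y: "y \<in> std_simplex (set u)" and eq: "point_map P x = point_map P y"
  obtain a b c where abc: "q = [a, b, c]" using q(2) by (auto simp: numeral_3_eq_3 length_Suc_conv)
  have lt: "a < 12" "b < 12" "c < 12" using q(3) by (auto simp: abc)
  have lh: "length h = 12" using q(1) P by (simp add: abc heights_from_def)
  define n where "n = plane_through (P ! a) (P ! b) (P ! c)"
  define H where "H v = real_of_int (h ! v)" for v
  have hv: "H v = real_of_int (fst n) * real_of_int (fst (P ! v)) + real_of_int (fst (snd n)) * real_of_int (fst (snd (P ! v)))
      + real_of_int (snd (snd n)) * real_of_int (snd (snd (P ! v))) - real_of_int (dot_int n (P ! a))" if "v < 12" for v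
    using nth_triple_heights[of v P a b c] that P by (simp add: H_def q(1) abc n_def dot_int_alt)
  have lin: "(\<Sum>v<12. z v * H v) = real_of_int (fst n) * point_map P z $ 1 + real_of_int (fst (snd n)) * point_map P z $ 2
      + real_of_int (snd (snd n)) * point_map P z $ 3 - real_of_int (dot_int n (P ! a)) * (\<Sum>v<12. z v)" for z
  proof -
    have "(\<Sum>v<12. z v * H v) = (\<Sum>v<12. real_of_int (fst n) * (z v * real_of_int (fst (P ! v)))
      + real_of_int (fst (snd n)) * (z v * real_of_int (fst (snd (P ! v))))
      + real_of_int (snd (snd n)) * (z v * real_of_int (snd (snd (P ! v)))) - real_of_int (dot_int n (P ! a)) * z v)"
      by (intro sum.cong refl) (simp add: hv algebra_simps)
    then show ?thesis by (simp add: sum.distrib sum_subtractf sum_distrib_left)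
  qed
  have sx: "(\<Sum>v<12. x v) = 1" "(\<Sum>v<12. y v) = 1" using sum_std_simplex x y t(1) u(1) by auto
  \<comment> \<open>The height is an affine function, so its mean for the weights \<open>x\<close>
    and for the weights \<open>y\<close> is its value at the common image point. The signs force
    both means to be 0, and then every vertex with positive weight has height 0.\<close>
  have S: "(\<Sum>v<12. x v * H v) = (\<Sum>v<12. y v * H v)"
    unfolding lin eq sx ..
  have xn: "0 \<le> x v * H v" for v
    using x t(2) by (cases "v \<in> set t") (auto simp: std_simplex_def nonneg_on_iff H_def)
  have yn: "0 \<le> y v * (- H v)" for v
    using y u(2) by (cases "v \<in> set u") (auto simp: std_simplex_def nonpos_on_iff H_def mult_nonneg_nonpos)
  have "0 \<le> (\<Sum>v<12. x v * H v)" "0 \<le> (\<Sum>v<12. y v * (- H v))" by (intro sum_nonneg xn yn)+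
  moreover have "(\<Sum>v<12. y v * (- H v)) = - (\<Sum>v<12. y v * H v)" by (simp add: sum_negf)
  ultimately have "(\<Sum>v<12. x v * H v) = 0" "(\<Sum>v<12. y v * (- H v)) = 0" using S by linarith+
  then have zero: "x v * H v = 0" "y v * (- H v) = 0" if "v < 12" for v
    using that xn yn by (auto simp: sum_nonneg_eq_0_iff simp del: mult_eq_0_iff mult_minus_right)
  have z: "v \<in> {a, b, c}" if "v < 12" "H v = 0" for v
    using that q(4) lh unfolding zeros_within_iff by (auto simp: abc H_def)
  have off: "x v = 0 \<and> y v = 0" if "v \<notin> {a, b, c}" for v
  proof (cases "v < 12")
    case True
    then show ?thesis using zero[OF True] z[OF True] that by auto
  next
    case False
    then show ?thesis using x y t(1) u(1) by (auto simp: std_simplex_def)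
  qed
  \<comment> \<open>A vertex outside the triple exists by counting, and its height is not 0 because
    all zeros lie in the triple; this is the \<open>w\<close> that proves affine
    independence.\<close>
  have "\<not> {..<12} \<subseteq> {a, b, c}"
  proof
    assume "{..<12} \<subseteq> {a, b, c}"
    then have "card {..<12::nat} \<le> card {a, b, c}" by (intro card_mono) auto
    also have "\<dots> \<le> 3" by (simp add: card_insert_if)
    finally show False by simp
  qed
  then obtain w where w: "w < 12" "w \<notin> {a, b, c}" by blast
  then have "h ! w \<noteq> 0" using z[of w] by (auto simp: H_def)
  moreover have "point_map P (\<lambda>v. x v - y v) = point_map P x - point_map P y"
    by (simp add: point_map_def scaleR_diff_left sum_subtractf)
  ultimately have "(\<lambda>v. x v - y v) = (\<lambda>v. 0)"
    using off sx eq w(1) P lt by (intro affine_independent_triple[of a b c w P]) (auto simp: sum_subtractf q(1) abc)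
  then show "x = y" by (simp add: fun_eq_iff)
qed

section \<open>The half-turn and its action on coordinates\<close>

lemma std_simplex_partner:
  assumes "x \<in> std_simplex (partner ` s)"
  shows "(\<lambda>v. x (partner v)) \<in> std_simplex s"
proof -
  have "(\<Sum>v\<in>s. x (partner v)) = (\<Sum>v\<in>partner ` s. x v)"
    by (simp add: sum.reindex inj_partner)
  moreover have "x (partner v) = 0" if "v \<notin> s" for v
    using assms that by (auto simp: std_simplex_def image_iff) (metis partner_partner)
  ultimately show ?thesis using assms by (auto simp: std_simplex_def)
qed

definition half_turn :: "real^3 \<Rightarrow> real^3" where
  "half_turn q = vector [- q $ 1, - q $ 2, q $ 3]"

lemma half_turn_nth [simp]: "half_turn q $ 1 = - q $ 1" "half_turn q $ 2 = - q $ 2" "half_turn q $ 3 = q $ 3"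
  by (simp_all add: half_turn_def vector_3)

lemma half_turn_half_turn [simp]: "half_turn (half_turn q) = q"
  by (simp add: vec_eq_iff forall_3)

lemma real_point_int_rot: "real_point (int_rot p) = half_turn (real_point p)"
  by (simp add: vec_eq_iff forall_3 int_rot_def)

lemma half_turn_sum: "half_turn (\<Sum>v\<in>S. x v *\<^sub>R f v) = (\<Sum>v\<in>S. x v *\<^sub>R half_turn (f v))"
  by (simp add: vec_eq_iff forall_3 sum_component sum_negf)

lemma point_map_partner:
  assumes "\<And>v. v < 12 \<Longrightarrow> P ! partner v = int_rot (P ! v)"
  shows "point_map P (\<lambda>v. x (partner v)) = half_turn (point_map P x)"
proof -
  have "point_map P (\<lambda>v. x (partner v)) = (\<Sum>v\<in>partner ` {..<12}. x (partner v) *\<^sub>R real_point (P ! v))"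
    by (simp add: point_map_def partner_image_12)
  also have "\<dots> = (\<Sum>v<12. x v *\<^sub>R real_point (P ! partner v))"
    by (simp add: sum.reindex inj_partner)
  also have "\<dots> = half_turn (point_map P x)"
    using assms by (simp add: point_map_def half_turn_sum real_point_int_rot)
  finally show ?thesis .
qed

lemma disjoint_images_partner:
  assumes P: "\<And>v. v < 12 \<Longrightarrow> P ! partner v = int_rot (P ! v)" and st: "disjoint_images P s t"
  shows "disjoint_images P (partner ` s) (partner ` t)"
  unfolding disjoint_images_def
proof (intro ballI impI)
  fix x y assume xy: "x \<in> std_simplex (partner ` s)" "y \<in> std_simplex (partner ` t)" "point_map P x = point_map P y"
  then have "(\<lambda>v. x (partner v)) = (\<lambda>v. y (partner v))"
    using st std_simplex_partner[of x s] std_simplex_partner[of y t] point_map_partner[of P x] point_map_partner[of P y] P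
    unfolding disjoint_images_def by metis
  then show "x = y" by (metis partner_partner ext)
qed

lemma set_orbit_facets: "set (orbit_facets R) = (\<Union>r\<in>set R. {fst r, partner_facet (fst r)})"
  by (induction R) auto

definition realization_data :: "int_point list \<Rightarrow> (nat list \<times> nat list list) list \<Rightarrow> bool" where
  "realization_data C R \<longleftrightarrow> length C = 6 \<and>
     list_all (\<lambda>r. list_all (\<lambda>q. length q = 3 \<and> list_all (\<lambda>v. v < 12) q) (snd r)) R \<and>
     triangle_list (orbit_facets R) \<and> embedding_check (orbit_points C) R"

text \<open>Only the representative \<open>s\<close> is tested against the later facets. The
  comparison of its partner with a later facet \<open>v\<close> is the half-turn of the comparison
  of \<open>s\<close> with the partner of \<open>v\<close>, which also belongs to a later
  orbit.\<close>

lemma embedding_check_disjoint_images: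
  assumes P: "length P = 12" "\<And>v. v < 12 \<Longrightarrow> P ! partner v = int_rot (P ! v)"
    and R: "\<And>r. r \<in> set R \<Longrightarrow> length (fst r) = 3 \<and> set (fst r) \<subseteq> {..<12} \<and> (\<forall>q\<in>set (snd r). length q = 3 \<and> set q \<subseteq> {..<12})"
    and chk: "embedding_check P R"
    and tu: "t \<in> set (orbit_facets R)" "u \<in> set (orbit_facets R)"
  shows "disjoint_images P (set t) (set u)"
  using R chk tu
proof (induction R arbitrary: t u)
  case (Cons r R)
  define s where "s = fst r"
  define s' where "s' = partner_facet s"
  define H where "H = all_heights P (s # snd r)"
  have R: "length s = 3" "set s \<subseteq> {..<12}" "\<forall>q\<in>set (s # snd r). length q = 3 \<and> set q \<subseteq> {..<12}"
    using Cons.prems(1)[of r] by (auto simp: s_def)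
  have R12: "set v \<subseteq> {..<12}" if v: "v \<in> set (orbit_facets R)" for v
  proof -
    obtain x where x: "x \<in> set R" "v = fst x \<or> v = partner_facet (fst x)"
      using v by (auto simp: set_orbit_facets)
    then have "set (fst x) \<subseteq> {..<12}" using Cons.prems(1)[of x] by simp
    then have "set (fst x) \<subseteq> {..<12}" "partner ` set (fst x) \<subseteq> {..<12}"
      using image_mono[of "set (fst x)" "{..<12}" partner] unfolding partner_image_12 by simp_all
    then show ?thesis using x(2) set_partner_facet by metis
  qed
  have s'12: "set s' \<subseteq> {..<12}" using R(2) partner_less_12 by (auto simp: s'_def set_partner_facet)
  have chk: "all_zeros_within (s # snd r) H" "separated_all H s (s' # orbit_facets R)" "embedding_check P R"
    using Cons.prems(2) by (auto simp: facet_check_def s_def s'_def H_def simp del: all_zeros_within.simps separated_all.simps all_heights.simps split: if_splits)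
  have one: "disjoint_images P (set s) (set v)" if sep: "separated H s v" and v: "set v \<subseteq> {..<12}" for v
  proof -
    obtain h where h: "h \<in> set H" "(nonneg_on h s \<and> nonpos_on h v) \<or> (nonpos_on h s \<and> nonneg_on h v)"
      using sep by (auto simp: separated_iff)
    then obtain q where q: "q \<in> set (s # snd r)" "h = triple_heights P q" by (auto simp: H_def set_all_heights)
    have z: "zeros_within q 0 h" using chk(1) q unfolding H_def all_zeros_within_iff by auto
    have q': "length q = 3" "set q \<subseteq> {..<12}" using R(3) q(1) by auto
    from h(2) show ?thesis
    proof (elim disjE conjE)
      assume "nonneg_on h s" "nonpos_on h v"
      then show ?thesis using separated_disjoint_images[OF P(1) q(2) q' z] R(2) v by simp
    next
      assume "nonpos_on h s" "nonneg_on h v"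
      then have "disjoint_images P (set v) (set s)"
        using separated_disjoint_images[OF P(1) q(2) q' z] R(2) v by simp
      then show ?thesis by (rule disjoint_images_sym)
    qed
  qed
  \<comment> \<open>A facet has height 0 over its own plane, so it satisfies both sign conditions
    against itself; this yields injectivity on a single facet.\<close>
  have self: "disjoint_images P (set s) (set s)"
  proof -
    obtain a b c where abc: "s = [a, b, c]" using R(1) by (auto simp: numeral_3_eq_3 length_Suc_conv)
    let ?h = "triple_heights P s"
    have z: "zeros_within s 0 ?h" using chk(1) unfolding H_def all_zeros_within_iff by auto
    have "a < length P" "b < length P" "c < length P" using R(2) P(1) by (auto simp: abc)
    then have "?h ! a = 0" "?h ! b = 0" "?h ! c = 0"
      unfolding abc by (simp_all only: nth_triple_heights) (cases "P ! a"; cases "P ! b"; cases "P ! c"; simp add: algebra_simps)+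
    then have "nonneg_on ?h s" "nonpos_on ?h s" by (simp_all add: nonneg_on_iff nonpos_on_iff abc)
    then show ?thesis using separated_disjoint_images[OF P(1) refl R(1,2) z R(2) _ R(2)] by simp
  qed
  have part: "disjoint_images P (set (partner_facet v)) (set (partner_facet w))" if "disjoint_images P (set v) (set w)" for v w
    unfolding set_partner_facet by (rule disjoint_images_partner[OF P(2) that])
  have tail: "disjoint_images P (set s) (set v)" if "v \<in> set (orbit_facets R)" for v
    using that chk(2) R12 by (intro one) (auto simp: separated_all_iff)
  \<comment> \<open>Equality is asserted for sets of vertices, because applying
    \<open>partner_facet\<close> twice returns the facet in sorted order.\<close>
  have closed: "\<exists>w\<in>set (orbit_facets R). set w = set (partner_facet v)" if "v \<in> set (orbit_facets R)" for v
    using that partner_facet_partner_facet unfolding set_orbit_facets by auto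
  have tail': "disjoint_images P (set s') (set v)" if v: "v \<in> set (orbit_facets R)" for v
  proof -
    obtain w where "w \<in> set (orbit_facets R)" "set w = set (partner_facet v)" using closed[OF v] by blast
    then have "disjoint_images P (set s) (set (partner_facet v))" using tail by metis
    from part[OF this] show ?thesis by (simp add: s'_def partner_facet_partner_facet)
  qed
  have ss': "disjoint_images P (set s) (set s')" "disjoint_images P (set s') (set s')"
    using one[of s'] chk(2) s'12 part[OF self] by (auto simp: s'_def separated_all_iff)
  have t: "t \<in> {s, s'} \<or> t \<in> set (orbit_facets R)" and u: "u \<in> {s, s'} \<or> u \<in> set (orbit_facets R)"
    using Cons.prems(3,4) by (auto simp: s_def s'_def)
  have IH: "disjoint_images P (set t) (set u)" if "t \<in> set (orbit_facets R)" "u \<in> set (orbit_facets R)"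
    by (rule Cons.IH[OF Cons.prems(1) chk(3) that]) simp
  show ?case
    using t u
  proof (elim disjE)
    assume "t \<in> {s, s'}" "u \<in> {s, s'}"
    then show ?thesis using self ss' disjoint_images_sym[OF ss'(1)] by blast
  next
    assume "t \<in> {s, s'}" "u \<in> set (orbit_facets R)"
    then show ?thesis using tail tail' by blast
  next
    assume "t \<in> set (orbit_facets R)" "u \<in> {s, s'}"
    then show ?thesis using tail tail' disjoint_images_sym by blast
  next
    assume "t \<in> set (orbit_facets R)" "u \<in> set (orbit_facets R)"
    then show ?thesis by (rule IH)
  qed
qed simp

lemma realization_dataD:
  assumes "realization_data C R"
  shows "length (orbit_points C) = 12" "\<And>v. v < 12 \<Longrightarrow> orbit_points C ! partner v = int_rot (orbit_points C ! v)"
    "triangle_list (orbit_facets R)"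
    "\<And>t u. t \<in> set (orbit_facets R) \<Longrightarrow> u \<in> set (orbit_facets R) \<Longrightarrow> disjoint_images (orbit_points C) (set t) (set u)"
proof -
  have C: "length C = 6" and tri: "triangle_list (orbit_facets R)" and chk: "embedding_check (orbit_points C) R"
    and q: "\<And>r q. r \<in> set R \<Longrightarrow> q \<in> set (snd r) \<Longrightarrow> length q = 3 \<and> set q \<subseteq> {..<12}"
    using assms by (auto simp: realization_data_def list_all_iff)
  show len: "length (orbit_points C) = 12" using C by simp
  show rot: "orbit_points C ! partner v = int_rot (orbit_points C ! v)" if "v < 12" for v
    using nth_orbit_points_partner[of v C] C that by simp
  show "triangle_list (orbit_facets R)" by (rule tri)
  have "length (fst r) = 3 \<and> set (fst r) \<subseteq> {..<12}" if "r \<in> set R" for r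
    using triangle_listD(4,5)[OF tri] that by (auto simp: set_orbit_facets)
  then show "disjoint_images (orbit_points C) (set t) (set u)"
    if "t \<in> set (orbit_facets R)" "u \<in> set (orbit_facets R)" for t u
    using embedding_check_disjoint_images[OF len rot _ chk that] q by simp
qed

lemma simplexwise_linear_list_complex:
  assumes "triangle_list F"
  shows "simplexwise_linear (list_complex F) (\<lambda>v. real_point (P ! v)) x = point_map P x"
  by (simp add: simplexwise_linear_def point_map_def vertices_list_complex[OF assms])

lemma realization_data_polyhedral:
  assumes "realization_data C R"
  shows "polyhedral_realization (list_complex (orbit_facets R)) (\<lambda>v. real_point (orbit_points C ! v))"
  unfolding polyhedral_realization_def underlying_space_list_complex
    simplexwise_linear_list_complex[OF realization_dataD(3)[OF assms]]
proof (rule inj_onI)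
  fix x y assume "x \<in> facet_body (orbit_facets R)" "y \<in> facet_body (orbit_facets R)"
    and eq: "point_map (orbit_points C) x = point_map (orbit_points C) y"
  then obtain t u where "t \<in> set (orbit_facets R)" "x \<in> std_simplex (set t)"
      "u \<in> set (orbit_facets R)" "y \<in> std_simplex (set u)"
    by (auto simp: facet_body_def)
  then show "x = y" using realization_dataD(4)[OF assms] eq unfolding disjoint_images_def by blast
qed

lemma simplicial_auto_partner:
  assumes "triangle_list (orbit_facets R)"
  shows "simplicial_auto (list_complex (orbit_facets R)) partner"
proof -
  have sub: "(`) partner \<sigma> \<in> list_complex (orbit_facets R)" if s: "\<sigma> \<in> list_complex (orbit_facets R)" for \<sigma>
  proof -
    obtain r where r: "r \<in> set R" "\<sigma> \<subseteq> set (fst r) \<or> \<sigma> \<subseteq> partner ` set (fst r)" "\<sigma> \<noteq> {}"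
      using s by (auto simp: list_complex_def generated_complex_def set_orbit_facets set_partner_facet)
    have "partner ` \<sigma> \<subseteq> partner ` set (fst r) \<or> partner ` \<sigma> \<subseteq> set (fst r)"
      using r(2)
    proof
      assume "\<sigma> \<subseteq> partner ` set (fst r)"
      then have "partner ` \<sigma> \<subseteq> partner ` partner ` set (fst r)" by (rule image_mono)
      then show ?thesis by (simp add: image_image)
    qed (auto intro: image_mono)
    then show ?thesis using r
      unfolding list_complex_def generated_complex_def set_orbit_facets
      by (auto simp: set_partner_facet intro!: bexI[of _ r])
  qed
  have "(`) partner ` list_complex (orbit_facets R) = list_complex (orbit_facets R)"
  proof (intro equalityI subsetI)
    fix \<sigma> assume "\<sigma> \<in> list_complex (orbit_facets R)"
    then show "\<sigma> \<in> (`) partner ` list_complex (orbit_facets R)"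
      using sub by (intro image_eqI[of _ _ "partner ` \<sigma>"]) (auto simp: image_image)
  qed (use sub in auto)
  then show ?thesis
    using inj_partner partner_image_12 vertices_list_complex[OF assms] by (simp add: simplicial_iso_def bij_betw_def)
qed

lemma induced_map_partner:
  assumes "triangle_list F" "x \<in> underlying_space (list_complex F)"
  shows "induced_map (list_complex F) partner x = (\<lambda>v. x (partner v))"
proof
  fix w
  have "{v. v \<in> {..<12} \<and> partner v = w} = (if w < 12 then {partner w} else {})"
    using partner_less_12 by auto
  \<comment> \<open>As 12 is even, \<open>partner\<close> also preserves the indices from 12
    onwards, where \<open>x\<close> vanishes and the sum in \<open>induced_map\<close> is
    empty.\<close>
  moreover have "x (partner w) = 0" if "\<not> w < 12"
  proof -
    have "\<not> partner w < 12" using that partner_less_12[of "partner w"] by auto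
    then show ?thesis using assms(2) triangle_listD(5)[OF assms(1)]
      unfolding underlying_space_list_complex facet_body_def by (auto simp: std_simplex_def)
  qed
  ultimately show "induced_map (list_complex F) partner x w = x (partner w)"
    unfolding induced_map_def vertices_list_complex[OF assms(1)] by auto
qed

lemma twofold_rotation_half_turn: "twofold_rotation half_turn"
proof -
  define A :: "real^3^3" where "A = vector [vector [-1, 0, 0], vector [0, -1, 0], vector [0, 0, 1]]"
  have A: "A *v q = half_turn q" for q
    by (simp add: vec_eq_iff forall_3 A_def matrix_vector_mult_def sum_3 vector_3)
  have "transpose A ** A = mat 1"
    by (simp add: vec_eq_iff forall_3 A_def matrix_matrix_mult_def transpose_def mat_def sum_3 vector_3)
  moreover have "A ** transpose A = mat 1"
    by (simp add: vec_eq_iff forall_3 A_def matrix_matrix_mult_def transpose_def mat_def sum_3 vector_3)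
  moreover have "det A = 1" by (simp add: det_3 A_def vector_3)
  ultimately have rot: "rotation_matrix A" by (simp add: rotation_matrix_def orthogonal_matrix_def)
  define u :: "real^3" where "u = vector [0, 0, 1]"
  have "u $ 3 = 1" by (simp add: u_def vector_3)
  then have u: "u \<noteq> 0" "A *v u = u"
    unfolding A by (auto simp: vec_eq_iff forall_3 u_def vector_3)
  have "rotation_about_line 0 u half_turn"
    unfolding rotation_about_line_def using rot u A by auto
  moreover have "half_turn \<noteq> id"
  proof
    assume "half_turn = id"
    then have "half_turn (vector [1, 0, 0]) $ 1 = (vector [1, 0, 0] :: real^3) $ 1" by (simp only: id_apply)
    then show False by (simp add: vector_3)
  qed
  moreover have "half_turn \<circ> half_turn = id" by (simp add: fun_eq_iff)
  ultimately show ?thesis unfolding twofold_rotation_def by blast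
qed

lemma dist_half_turn: "dist (half_turn x) (half_turn y) = dist x y"
  by (simp add: dist_vec_def L2_set_def sum_3 dist_real_def power2_abs power2_commute)

lemma realization_data_symmetric:
  assumes "realization_data C R"
  shows "twofold_rotational_symmetry (list_complex (orbit_facets R)) (\<lambda>v. real_point (orbit_points C ! v))"
proof -
  note D = realization_dataD[OF assms]
  let ?\<Delta> = "list_complex (orbit_facets R)"
  let ?f = "simplexwise_linear ?\<Delta> (\<lambda>v. real_point (orbit_points C ! v))"
  have f: "?f = point_map (orbit_points C)"
    using simplexwise_linear_list_complex[OF D(3)] by (simp add: fun_eq_iff)
  have com: "half_turn (?f x) = ?f (induced_map ?\<Delta> partner x)" if "x \<in> underlying_space ?\<Delta>" for x
    unfolding f induced_map_partner[OF D(3) that] using point_map_partner[of "orbit_points C" x] D(2) by simp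
  have stable: "(\<lambda>v. x (partner v)) \<in> underlying_space ?\<Delta>" if x: "x \<in> underlying_space ?\<Delta>" for x
  proof -
    obtain t where t: "t \<in> set (orbit_facets R)" "x \<in> std_simplex (set t)"
      using x by (auto simp: underlying_space_list_complex facet_body_def)
    then have "x \<in> std_simplex (partner ` set (partner_facet t))" by (simp add: set_partner_facet image_image)
    then have "(\<lambda>v. x (partner v)) \<in> std_simplex (set (partner_facet t))" by (rule std_simplex_partner)
    moreover obtain w where "w \<in> set (orbit_facets R)" "set w = set (partner_facet t)"
      using t(1) partner_facet_partner_facet unfolding set_orbit_facets by auto
    ultimately show ?thesis
      unfolding underlying_space_list_complex facet_body_def by (intro UN_I[of w]) simp_all
  qed
  have sub: "half_turn ` ?f ` underlying_space ?\<Delta> \<subseteq> ?f ` underlying_space ?\<Delta>"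
    using com stable induced_map_partner[OF D(3)] by auto
  have "half_turn ` ?f ` underlying_space ?\<Delta> = ?f ` underlying_space ?\<Delta>"
  proof (rule antisym[OF sub])
    have "half_turn ` half_turn ` ?f ` underlying_space ?\<Delta> \<subseteq> half_turn ` ?f ` underlying_space ?\<Delta>"
      by (rule image_mono[OF sub])
    then show "?f ` underlying_space ?\<Delta> \<subseteq> half_turn ` ?f ` underlying_space ?\<Delta>" by (simp add: image_image)
  qed
  then have "geometric_symmetry ?\<Delta> (\<lambda>v. real_point (orbit_points C ! v)) half_turn"
    unfolding geometric_symmetry_def using com dist_half_turn simplicial_auto_partner[OF D(3)] by blast
  then show ?thesis
    unfolding twofold_rotational_symmetry_def using twofold_rotation_half_turn by blast
qed

section \<open>The realizations\<close>

text \<open>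
  A realization consists of bistellar moves leading to the surface from another one, the labels of its
  vertices \<open>0, \<dots>, 11\<close> in the result of the moves, one point of each pair \<open>2 i\<close>, \<open>2 i + 1\<close> of vertices
  exchanged by the half-turn, and one facet of each orbit. A facet comes with triples of vertices whose
  planes, together with its own plane, separate it from the later orbits.
\<close>

type_synonym realization =
  "(int list \<times> int list) list \<times> int list \<times> int_point list \<times> (nat list \<times> nat list list) list"

fun surface_facets :: "realization \<Rightarrow> nat list list" where
  "surface_facets (ms, p, C, R) = orbit_facets R"

fun certified :: "int list list \<Rightarrow> realization \<Rightarrow> int \<Rightarrow> bool" where
  "certified F (ms, p, C, R) v \<longleftrightarrow>
     (if realization_data C R then if flip_check F ms p (orbit_facets R) then list_invariant (orbit_facets R) = v
      else False else False)"

primrec int_facets :: "nat list list \<Rightarrow> int list list" where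
  "int_facets [] = []"
| "int_facets (t # F) = map int t # int_facets F"

text \<open>What remains of a certificate once it has been checked: moves, labels and coordinates
  are forgotten, so the surface can serve as a starting point for others without being evaluated
  again.\<close>

definition realized :: "realization \<Rightarrow> int \<Rightarrow> bool" where
  "realized d v \<longleftrightarrow> triangle_list (surface_facets d) \<and> list_invariant (surface_facets d) = v \<and>
     facet_body (surface_facets d) homeomorphic facet_body (polygon_facet_lists 5) \<and>
     (\<exists>\<psi>. polyhedral_realization (list_complex (surface_facets d)) \<psi> \<and>
        twofold_rotational_symmetry (list_complex (surface_facets d)) \<psi>)"

lemma homeomorphic_imp_homeomorphic_space:
  assumes "S homeomorphic T"
  shows "top_of_set S homeomorphic_space top_of_set T"
proof -
  obtain f h where "homeomorphism S T f h" using assms by (auto simp: homeomorphic_def)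
  then have "homeomorphic_maps (top_of_set S) (top_of_set T) f h"
    unfolding homeomorphism_def homeomorphic_maps_def continuous_map_subtopology_eu
    by (simp add: image_subset_iff_funcset[symmetric])
  then show ?thesis by (auto simp: homeomorphic_space_def)
qed

lemma facet_body_int_facets: "facet_body (int_facets F) homeomorphic facet_body F"
proof -
  have "int_facets F = map (map int) F" by (induction F) auto
  then show ?thesis
    using facet_body_relabel[of int F] homeomorphic_sym by (metis inj_on_of_nat)
qed

lemma certified_realized:
  assumes "certified (int_facets F) d v" "facet_body F homeomorphic facet_body (polygon_facet_lists 5)"
  shows "realized d v"
proof -
  obtain ms p C R where d: "d = (ms, p, C, R)" by (cases d)
  have data: "realization_data C R" and flip: "flip_check (int_facets F) ms p (orbit_facets R)"
    and v: "list_invariant (orbit_facets R) = v"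
    using assms(1) by (auto simp: d split: if_splits)
  have tri: "triangle_list (orbit_facets R)" by (rule realization_dataD(3)[OF data])
  have "facet_body (orbit_facets R) homeomorphic facet_body (polygon_facet_lists 5)"
    using flip_check_homeomorphic[OF flip tri] facet_body_int_facets[of F] assms(2) homeomorphic_sym homeomorphic_trans
    by metis
  then show ?thesis
    using tri v realization_data_polyhedral[OF data] realization_data_symmetric[OF data]
    by (auto simp: realized_def d)
qed

lemmas realized_from_polygon = certified_realized[OF _ homeomorphic_refl]

text \<open>Since homeomorphisms compose, the certificates may form a tree with the polygon at its
  root, and each of them contains only the moves from its predecessor.\<close>

lemma realized_from_surface:
  assumes "realized e w" "certified (int_facets (surface_facets e)) d v"
  shows "realized d v"
  using assms certified_realized by (auto simp: realized_def)

text \<open>This is the only run that starts from the polygon and changes the number of vertices. A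
  move whose first list is a single vertex removes a vertex of degree three; the edge flips in
  between prepare such vertices.\<close>

definition surface_0 :: realization where
  "surface_0 =
    ([([9,10],[60,61]), ([10,67],[11,61]), ([10],[11,60,61]), ([9,63],[8,61]), ([9],[8,60,61]), ([16,17],[60,78]),
    ([17,18],[60,79]), ([17],[60,78,79]), ([50,51],[60,112]), ([49,50],[60,111]), ([50],[60,111,112]),
    ([25,87],[26,61]), ([0,59],[60,114]), ([59,114],[60,115]), ([59],[58,60,115]), ([40,102],[41,61]),
    ([52,114],[53,61]), ([26,27],[60,88]), ([22,79],[23,61]), ([19,76],[20,61]), ([31,88],[32,61]),
    ([37,38],[60,99]), ([38,39],[60,100]), ([38],[60,99,100]), ([34,35],[60,91]), ([35,91],[60,90]),
    ([35],[36,60,90]), ([1,63],[2,61]), ([57,111],[56,61]), ([34,60],[33,91]), ([34],[33,61,91]), ([63,64],[2,8]),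
    ([63],[2,8,61]), ([46,103],[47,61]), ([14,15],[60,76]), ([13,14],[60,75]), ([14],[60,75,76]), ([4,66],[5,61]),
    ([26,88],[60,87]), ([49,60],[48,111]), ([49],[48,61,111]), ([22,60],[21,23]), ([22],[21,23,61]), ([4,61],[3,5]),
    ([4],[3,5,60]), ([30,91],[29,61]), ([7,8],[60,64]), ([27,60],[28,88]), ([27],[28,61,88]), ([45,99],[44,61]),
    ([13,61],[12,75]), ([13],[12,60,75]), ([7,61],[6,64]), ([7],[6,60,64]), ([5,6],[60,67]), ([6,61],[64,67]),
    ([6],[60,64,67]), ([5,67],[60,66]), ([47,48],[60,102]), ([41,42],[60,103]), ([42,60],[43,103]),
    ([42],[43,61,103]), ([5,61],[3,66]), ([5],[3,60,66]), ([48,60],[102,111]), ([48],[61,102,111]),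
    ([19,60],[18,20]), ([19],[18,20,61]), ([18,60],[20,79]), ([18],[20,61,79]), ([21,60],[20,23]), ([20,21],[23,75]),
    ([21],[23,61,75]), ([37,60],[36,99]), ([37],[36,61,99]), ([36,61],[90,99]), ([36],[60,90,99]), ([57,61],[56,58]),
    ([57],[56,58,60]), ([58,60],[56,115]), ([58],[56,61,115]), ([11,66],[12,67]), ([30,61],[29,31]),
    ([30],[29,31,60]), ([31,61],[29,32]), ([31],[29,32,60]), ([61,99],[44,90]), ([44,99],[90,100]),
    ([99],[60,90,100]), ([44,100],[43,90]), ([29,90],[28,91]), ([46,60],[45,47]), ([46],[45,47,61]),
    ([45,61],[44,47]), ([45],[44,47,60]), ([40,60],[39,41]), ([40],[39,41,61]), ([39,61],[41,100]),
    ([39],[41,60,100]), ([16,60],[15,78]), ([16],[15,61,78]), ([15,61],[76,78]), ([15],[60,76,78]),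
    ([61,100],[41,43]), ([43,100],[41,90]), ([100],[41,60,90]), ([52,61],[51,53]), ([52],[51,53,60]),
    ([51,61],[53,112]), ([51],[53,60,112]), ([25,60],[24,26]), ([25],[24,26,61]), ([26,60],[24,87]),
    ([26],[24,61,87]), ([0,60],[1,114]), ([0],[1,61,114]), ([1,61],[2,114]), ([1],[2,60,114]), ([61,102],[41,111]),
    ([102,103],[41,47]), ([41,102],[47,111]), ([102],[47,60,111]), ([60,115],[56,114]), ([53,54],[60,115]),
    ([54,61],[55,115]), ([54],[55,60,115]), ([61,103],[43,47]), ([29,60],[28,32]), ([28,29],[32,91]),
    ([29],[32,61,91]), ([60,66],[3,67]), ([61,66],[3,12]), ([66],[3,12,67]), ([56,60],[55,114]), ([24,60],[23,87]),
    ([24,61],[78,87]), ([24],[23,78,87]), ([61,76],[20,78]), ([20,76],[75,78]), ([76],[60,75,78]), ([60,88],[28,87]),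
    ([2,60],[3,114]), ([8,64],[2,60]), ([8],[2,60,61]), ([44,61],[47,90]), ([2,3],[64,114]), ([55,114],[56,60]),
    ([23,78],[79,87]), ([55,61],[112,115]), ([28,91],[32,90]), ([60,87],[23,28]), ([61,111],[41,56]),
    ([32,33],[60,87]), ([33,61],[87,91]), ([33],[60,87,91]), ([20,75],[23,78]), ([56,111],[41,112]),
    ([41,111],[47,112]), ([111],[47,60,112]), ([60,91],[87,90]), ([60,75],[12,78]), ([75,78],[12,23]),
    ([75],[12,23,61]), ([61,90],[28,47]), ([87,91],[61,90]), ([91],[32,61,90]), ([41,112],[47,56]), ([3,61],[12,64]),
    ([3,64],[12,114]), ([3,12],[67,114]), ([3],[60,67,114]), ([53,61],[112,114]), ([23,60],[20,28]),
    ([20,28],[23,60]), ([60,78],[12,79]), ([20,23],[60,78]), ([60,90],[41,87]), ([44,47],[60,90]), ([44],[43,60,90]),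
    ([41,90],[43,87]), ([78,79],[12,87]), ([20,60],[78,79]), ([20],[61,78,79]), ([60,87],[32,41]), ([43,90],[60,87]),
    ([47,61],[28,43]), ([28,43],[47,61]), ([47,56],[41,112]), ([41,112],[47,56]), ([56,61],[41,115]),
    ([47,60],[90,112]), ([41,103],[47,60]), ([103],[43,47,60]), ([60,90],[87,112]), ([47,56],[41,112]),
    ([61,87],[78,90]), ([32,88],[61,87]), ([88],[28,61,87]), ([47,112],[41,90]), ([61,90],[32,78]),
    ([32,90],[28,78]), ([61,78],[32,79]), ([32,78],[28,79]), ([12,23],[61,78]), ([41,115],[56,61]),
    ([28,79],[32,78]), ([56,61],[41,115]), ([23,87],[28,79]), ([43,60],[47,87]), ([32,60],[28,41]),
    ([41,115],[56,61]), ([41,112],[56,90]), ([28,60],[23,41]), ([28,41],[23,32]), ([41,60],[23,47]),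
    ([87,90],[78,112]), ([12,61],[64,78]), ([11,67],[12,61]), ([11],[12,60,61]), ([28,79],[23,87]),
    ([23,60],[47,78]), ([61,78],[23,64]), ([41,56],[61,90]), ([28,78],[32,90]), ([78,90],[32,112]),
    ([78,79],[32,60]), ([47,78],[23,60]), ([32,90],[28,112]), ([28,90],[47,112]), ([47,112],[28,90]),
    ([28,32],[23,112]), ([28,112],[23,90]), ([23,41],[32,47]), ([23,64],[61,78]), ([12,64],[78,114]),
    ([23,28],[87,90]), ([60,87],[47,112]), ([41,47],[32,90]), ([43,61],[41,47]), ([43],[41,47,87]),
    ([61,78],[23,64]), ([47,87],[41,112]), ([28,90],[47,87]), ([28],[47,61,87]), ([12,87],[78,79]),
    ([61,67],[12,64]), ([12,78],[79,114]), ([12,64],[61,67]), ([60,114],[56,67]), ([53,112],[60,114]),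
    ([53],[60,114,115]), ([47,112],[41,60]), ([60,79],[12,32]), ([78,114],[64,79]), ([79,114],[12,64]),
    ([12,64],[79,114]), ([64,79],[78,114]), ([61,67],[12,64]), ([67,114],[12,56]), ([60,67],[56,64]),
    ([67],[12,56,64]), ([23,32],[47,112]), ([78,87],[79,112]), ([23,60],[47,78]), ([64,78],[23,114]),
    ([56,61],[90,115]), ([41,112],[60,87]), ([87,112],[60,79]), ([61,90],[41,115]), ([90,115],[41,56]),
    ([47,78],[23,60]), ([56,90],[41,112]), ([60,87],[41,79]), ([41,60],[47,79]), ([41,115],[56,61]),
    ([47,87],[61,90]), ([23,87],[79,90]), ([90,112],[23,41]), ([32,112],[47,78]), ([56,61],[41,115]),
    ([23,41],[90,112]), ([79,90],[23,87]), ([41,79],[47,87]), ([41,112],[56,90]), ([32,47],[78,90]),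
    ([23,90],[87,112]), ([56,115],[41,114]), ([55,60],[56,115]), ([55],[56,112,115]), ([78,90],[32,47]),
    ([47,87],[41,79]), ([56,114],[12,41]), ([61,64],[12,23]), ([2,114],[61,64]), ([2],[60,61,64]), ([41,56],[12,90]),
    ([56,90],[12,112]), ([60,64],[56,61]), ([61,64],[56,114]), ([12,64],[23,56]), ([64],[23,56,114]),
    ([61,115],[41,112]), ([114,115],[41,60]), ([32,47],[78,90]), ([47,90],[61,78]), ([60,78],[23,32]),
    ([112,115],[41,56]), ([115],[41,56,60]), ([47,61],[41,78]), ([79,112],[60,78]), ([23,78],[32,114]),
    ([12,41],[90,114]), ([41,114],[60,90]), ([47,112],[23,78]), ([23,87],[79,112]), ([41,79],[47,87]),
    ([41,47],[78,87]), ([47,78],[23,87]), ([47,79],[60,87]), ([47],[23,60,87]), ([56,112],[12,41]),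
    ([12,56],[23,41]), ([23,56],[41,114]), ([90,112],[12,87]), ([60,114],[90,112]), ([41,56],[60,114]),
    ([56],[60,61,114]), ([12,114],[79,90]), ([23,41],[12,114]), ([78,87],[23,41]), ([61,90],[78,87]),
    ([87,90],[12,78]), ([32,41],[87,90]), ([32,87],[61,90]), ([23,60],[32,87]), ([78,112],[23,60]),
    ([41,61],[78,112]), ([87,90],[41,61]), ([12,78],[87,90]), ([61,90],[32,41]), ([78,87],[61,90])],
    [61,60,12,114,23,41,79,90,32,112,87,78], [(21,36,-29), (-9,-17,-19), (-11,-24,-3), (-14,-28,-10), (25,-35,-33),
    (-12,-17,20)], [([0,1,2],[[0,2,3], [1,2,3], [1,2,8]]), ([0,2,4],[[2,3,4], [0,3,4], [1,4,8]]), ([0,4,6],[[0,3,4],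
    [0,2,6], [1,6,8]]), ([0,6,8],[[0,1,6], [1,6,8]]), ([0,5,8],[[3,5,8], [0,4,5], [0,5,9]]), ([0,7,11],[[0,5,7],
    [1,4,11]]), ([0,9,11],[]), ([0,3,9],[[3,7,9]]), ([4,6,9],[[2,4,9]]), ([0,5,10],[[0,3,10], [0,5,7], [0,5,9]]),
    ([0,7,10],[[0,3,10], [2,3,5], [5,7,9]]), ([6,9,10],[]), ([2,6,8],[]), ([3,6,11],[[1,4,11], [2,3,4], [4,6,8]]),
    ([3,6,7],[[0,5,6], [1,4,7], [2,3,4]]), ([2,9,10],[[2,4,10]]), ([2,5,9],[[2,3,5]]), ([4,8,10],[]), ([2,3,5],[]),
    ([4,5,10],[])])"

lemma surface_0: "realized surface_0 1213640"
  by (rule realized_from_polygon) code_simp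

text \<open>Here and in all later certificates both lists of a move have two entries: an edge is
  replaced by the other diagonal of its quadrilateral, and the twelve vertices are kept.\<close>

definition surface_1 :: realization where
  "surface_1 =
    ([([0,8],[5,6]), ([7,11],[0,8]), ([3,6],[7,11]), ([4,5],[10,11]), ([1,9],[4,7]), ([6,10],[1,9]), ([2,7],[6,10])],
    [0,1,3,2,9,8,11,10,7,6,5,4], [(-30,-45,32), (33,22,46), (25,37,24), (24,21,25), (2,41,-33), (-49,23,20)],
    [([0,1,2],[[0,1,3], [0,1,10], [0,2,3]]), ([0,5,8],[[0,6,8], [3,5,8], [0,1,4]]), ([0,7,10],[[0,2,7], [0,3,7],
    [1,4,10]]), ([0,9,10],[]), ([0,9,11],[]), ([0,7,8],[[0,7,10], [0,3,7], [0,5,8]]), ([0,3,11],[]),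
    ([3,4,7],[[4,6,7], [0,2,4], [1,2,3]]), ([6,8,9],[[1,4,6], [1,6,7]]), ([2,6,8],[[2,6,10], [1,2,4], [2,4,8]]),
    ([4,6,10],[[1,6,7], [2,3,6], [2,4,6]]), ([6,7,10],[[1,6,7], [2,4,6], [2,3,7]]), ([0,2,4],[[0,1,4], [0,3,4],
    [0,2,3]]), ([4,8,11],[[1,2,4]]), ([2,4,8],[[2,3,6], [1,2,4]]), ([0,5,6],[[0,1,2], [0,1,6], [1,4,6]]),
    ([3,4,10],[[1,3,4]]), ([0,4,6],[[0,1,2], [0,1,4], [0,1,6]]), ([4,9,11],[[0,1,4]]), ([2,3,10],[])])"

lemma surface_1: "realized surface_1 1213362"
  by (rule realized_from_surface[OF surface_0]) code_simp

definition surface_2 :: realization where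
  "surface_2 =
    ([([4,10],[3,6]), ([5,11],[2,7]), ([6,7],[10,11])], [0,1,2,3,4,5,6,7,8,9,10,11], [(6,22,18), (20,-15,2),
    (2,-20,8), (5,-14,-1), (14,-19,-19), (21,-17,-10)], [([0,1,2],[]), ([0,2,4],[[0,1,4], [1,2,4]]),
    ([0,4,6],[[0,2,6], [1,2,4], [1,4,6]]), ([0,5,8],[[0,7,8], [2,5,8], [0,3,5]]), ([0,7,10],[[2,7,10], [0,2,7],
    [0,1,7]]), ([0,9,10],[]), ([0,9,11],[]), ([0,5,6],[[2,5,6], [4,6,7], [0,1,6]]), ([0,3,11],[]), ([3,4,7],[[5,6,7],
    [0,3,5], [1,3,4]]), ([2,6,8],[[4,6,8]]), ([6,8,9],[[1,6,9], [0,1,8]]), ([3,4,6],[[0,3,6], [0,4,6]]),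
    ([0,7,8],[[0,5,8], [4,5,7], [6,7,8]]), ([2,3,10],[[1,3,10], [0,3,10]]), ([2,4,8],[[2,6,8]]), ([3,6,10],[[0,3,10],
    [1,4,6], [2,3,10]]), ([6,10,11],[[0,7,10], [1,6,11]]), ([4,8,11],[]), ([5,8,10],[[2,5,8]])])"

lemma surface_2: "realized surface_2 1212200"
  by (rule realized_from_surface[OF surface_1]) code_simp

definition surface_3 :: realization where
  "surface_3 =
    ([([2,3],[10,11]), ([6,8],[2,9]), ([1,11],[6,8]), ([7,9],[3,8]), ([0,10],[7,9]), ([4,6],[0,10])],
    [10,9,7,5,6,3,0,8,4,2,11,1], [(44,-32,4), (13,-9,9), (-19,35,21), (52,30,8), (-12,-12,43), (22,50,47)],
    [([0,1,2],[[1,2,6], [0,2,6]]), ([0,6,8],[[0,4,8], [6,7,8], [2,6,8]]), ([0,5,8],[[0,7,8], [5,6,8], [0,5,9]]),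
    ([0,5,10],[[5,6,10], [0,1,5]]), ([0,9,10],[]), ([0,9,11],[]), ([0,4,6],[[0,3,4], [0,1,2], [1,4,6]]),
    ([0,7,11],[]), ([0,3,7],[[0,1,2], [1,3,5]]), ([3,4,9],[[3,6,9], [4,7,9], [2,5,9]]), ([2,8,11],[[2,7,8], [2,3,11],
    [0,1,2]]), ([2,4,10],[[2,6,10], [2,4,6], [0,1,2]]), ([2,3,11],[[3,7,11], [0,2,11], [2,3,6]]), ([0,2,4],[[0,4,6],
    [0,2,6], [0,1,2]]), ([2,6,7],[]), ([2,5,7],[]), ([6,8,9],[[0,4,5], [5,6,9]]), ([5,6,10],[]),
    ([4,7,10],[[2,6,8]]), ([6,9,11],[])])"

lemma surface_3: "realized surface_3 1225214"
  by (rule realized_from_surface[OF surface_1]) code_simp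

definition surface_4 :: realization where
  "surface_4 =
    ([([2,11],[3,8]), ([3,10],[2,9])], [0,1,2,3,4,5,6,7,8,9,10,11], [(-18,30,-4), (-8,7,2), (-15,-23,13), (-37,2,1),
    (20,10,21), (-38,-24,23)], [([0,1,2],[[1,2,6], [0,2,6]]), ([0,6,8],[[2,6,8], [0,4,8]]), ([0,5,8],[[0,7,8],
    [4,5,8], [0,1,5]]), ([0,5,10],[[5,6,10], [0,1,5]]), ([0,9,10],[[0,6,9]]), ([0,9,11],[[0,5,9]]),
    ([0,4,6],[[0,3,4], [0,1,2], [1,4,6]]), ([0,7,11],[]), ([0,2,4],[[1,2,4], [0,4,6], [0,2,6]]), ([0,3,7],[[0,1,2]]),
    ([3,4,9],[[3,6,9], [1,4,7], [2,5,9]]), ([2,9,10],[[2,4,6], [2,6,9], [0,1,2]]), ([7,8,10],[[0,2,10], [4,7,8]]),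
    ([2,6,7],[]), ([2,3,8],[[0,5,6], [3,7,8], [3,4,8]]), ([6,8,9],[[0,4,5], [5,6,9]]), ([3,4,6],[]),
    ([2,4,10],[[2,6,10]]), ([5,6,10],[]), ([4,7,10],[[2,6,8]])])"

lemma surface_4: "realized surface_4 1226644"
  by (rule realized_from_surface[OF surface_3]) code_simp

definition surface_5 :: realization where
  "surface_5 =
    ([([4,7],[10,11]), ([1,9],[4,7]), ([1,7],[4,5]), ([8,10],[1,7]), ([2,11],[3,8]), ([2,3],[8,10])],
    [10,7,11,1,4,8,2,9,3,5,0,6], [(22,-9,17), (-5,1,11), (-6,-23,-18), (11,-8,-11), (-12,8,3), (1,2,-13)],
    [([0,1,2],[[0,2,4], [1,2,4]]), ([0,2,4],[[1,2,4], [0,1,2]]), ([0,4,6],[]), ([0,5,6],[]), ([0,5,8],[[0,1,8]]),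
    ([0,7,8],[[0,4,7], [0,2,8]]), ([0,7,10],[[0,2,7], [0,4,10], [5,7,10]]), ([0,9,10],[[0,5,10], [3,6,10]]),
    ([0,9,11],[[0,2,11], [0,3,11], [4,6,11]]), ([4,7,8],[[1,4,8]]), ([0,3,11],[[2,3,11], [0,4,11], [3,8,11]]),
    ([4,8,11],[[2,8,11]]), ([2,5,8],[]), ([2,3,5],[]), ([4,6,10],[[0,5,10]]), ([4,10,11],[[0,10,11]]),
    ([2,7,10],[[2,3,10], [2,8,9]]), ([3,6,10],[[3,6,7]]), ([2,9,11],[]), ([2,8,9],[])])"

lemma surface_5: "realized surface_5 1236720"
  by (rule realized_from_surface[OF surface_3]) code_simp

definition surface_6 :: realization where
  "surface_6 =
    ([([0,10],[7,9]), ([1,11],[6,8])], [9,8,2,3,11,10,0,1,7,6,5,4], [(-12,-13,-1), (-11,-6,19), (-1,-3,-14),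
    (24,13,21), (-7,-11,-20), (6,24,-26)], [([0,6,8],[[4,6,8], [0,3,6], [0,7,8]]), ([0,5,10],[[0,2,5], [1,3,5],
    [0,7,10]]), ([0,9,10],[[0,2,9], [0,7,10], [0,4,5]]), ([0,7,9],[[0,2,9], [2,7,9], [0,5,9]]), ([0,2,4],[[2,3,5],
    [3,4,5], [0,4,7]]), ([0,7,11],[[0,6,7], [0,2,11]]), ([0,3,11],[[0,3,7], [2,3,11], [0,4,11]]), ([4,8,10],[[0,4,9],
    [1,7,8], [4,5,10]]), ([0,5,8],[[0,5,6], [3,4,5], [0,7,8]]), ([2,4,8],[[2,3,5], [3,4,5], [0,7,8]]),
    ([3,4,6],[[0,3,4], [2,4,5], [1,4,6]]), ([4,5,10],[[1,4,7], [0,5,10]]), ([7,8,11],[]), ([0,1,2],[[1,2,3],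
    [0,1,3]]), ([0,4,6],[[0,2,4], [0,3,6], [1,4,6]]), ([3,4,9],[[0,2,3], [2,4,5]]), ([7,8,10],[]),
    ([3,7,10],[[2,3,7]]), ([2,6,7],[[1,2,3]]), ([2,3,10],[])])"

lemma surface_6: "realized surface_6 1212560"
  by (rule realized_from_surface[OF surface_5]) code_simp

definition surface_7 :: realization where
  "surface_7 =
    ([([4,5],[10,11]), ([3,6],[4,7]), ([2,7],[5,6]), ([6,7],[4,5])], [0,1,2,3,4,5,6,7,8,9,10,11], [(5,0,14), (6,3,7),
    (-7,11,20), (19,11,-5), (9,8,5), (10,6,-13)], [([0,2,4],[[1,2,4], [0,2,5], [0,4,5]]), ([0,4,6],[[0,5,6],
    [0,2,4]]), ([0,6,8],[[0,4,8], [0,2,4], [0,4,6]]), ([0,5,8],[[2,4,8], [0,2,5], [1,5,6]]), ([0,5,10],[[0,6,10],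
    [0,4,5]]), ([3,4,9],[[1,3,4], [0,5,9], [1,4,7]]), ([2,4,8],[[0,2,4], [0,2,3], [0,4,6]]), ([0,7,9],[[0,1,7],
    [0,4,5], [1,4,7]]), ([4,8,10],[[1,6,10], [0,4,6]]), ([3,4,7],[[1,3,4], [0,2,7]]), ([0,1,2],[[1,2,4], [0,4,5],
    [1,4,5]]), ([0,9,10],[[0,4,5], [1,4,7], [5,7,10]]), ([0,7,11],[[0,6,11], [0,3,7], [0,4,5]]), ([4,5,7],[]),
    ([0,3,11],[[0,6,11], [3,7,11]]), ([4,10,11],[]), ([7,8,11],[]), ([2,3,10],[[2,6,10], [1,7,10]]), ([2,6,11],[]),
    ([6,9,11],[[2,6,10]])])"

lemma surface_7: "realized surface_7 1236048"
  by (rule realized_from_surface[OF surface_6]) code_simp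

definition surface_8 :: realization where
  "surface_8 =
    ([([7,10],[3,8]), ([0,9],[7,10]), ([6,11],[2,9]), ([4,5],[6,7]), ([1,8],[6,11])], [10,11,4,5,8,9,3,2,1,0,6,7],
    [(-172,199,-123), (-13,-48,79), (153,-214,253), (-6,-8,68), (-136,30,69), (-153,-193,205)], [([0,1,2],[[0,2,9],
    [1,2,3]]), ([0,8,10],[[0,1,8], [1,2,10]]), ([0,5,10],[]), ([0,6,7],[[6,7,8], [0,1,7], [0,1,4]]),
    ([0,7,8],[[3,7,8], [0,1,7]]), ([0,5,11],[]), ([0,9,11],[[0,1,3]]), ([0,3,9],[[3,7,9], [0,1,3]]),
    ([4,9,10],[[1,2,3]]), ([2,9,10],[[1,2,3]]), ([0,2,4],[[0,1,4], [0,4,7], [0,4,8]]), ([2,10,11],[[0,2,11],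
    [2,5,9]]), ([2,5,8],[[0,2,5], [2,5,7]]), ([2,7,9],[[0,2,4], [1,3,7]]), ([6,8,9],[[2,7,8], [0,6,8], [1,7,8]]),
    ([0,4,6],[[4,6,7], [0,1,6], [0,2,4]]), ([4,6,11],[[6,7,10], [0,2,4]]), ([2,6,11],[[3,4,6], [6,7,10]]),
    ([2,4,7],[]), ([2,5,6],[])])"

lemma surface_8: "realized surface_8 1212760"
  by (rule realized_from_surface[OF surface_7]) code_simp

definition surface_9 :: realization where
  "surface_9 =
    ([([0,1],[2,3]), ([3,10],[7,11]), ([2,11],[6,10]), ([6,7],[0,1]), ([10,11],[6,7])], [6,7,10,11,2,3,5,4,8,9,1,0],
    [(4,8,1), (-20,-4,-3), (21,28,-41), (-36,-43,-29), (-19,-21,-14), (-36,23,8)], [([0,1,2],[[0,2,3], [0,1,10],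
    [1,2,6]]), ([0,9,10],[[2,3,9], [0,3,7], [1,7,10]]), ([0,10,11],[[0,1,11], [0,1,10]]), ([0,7,11],[[0,3,7]]),
    ([0,2,4],[[0,4,7], [2,4,8], [0,3,4]]), ([0,8,9],[[1,8,9], [0,3,9], [1,2,8]]), ([0,3,7],[[3,7,9]]), ([4,7,11],[]),
    ([4,6,8],[[4,8,10], [2,4,5], [2,6,8]]), ([3,6,8],[[1,3,5], [3,5,9], [2,6,8]]), ([2,6,11],[[1,2,8]]),
    ([3,6,11],[[1,3,6]]), ([2,4,9],[[2,4,8], [1,4,7], [0,3,9]]), ([0,5,8],[[0,1,5], [0,2,8], [0,3,4]]),
    ([0,4,6],[[0,2,6], [0,3,4], [2,4,5]]), ([4,8,10],[[0,4,6]]), ([0,5,6],[[0,1,5], [0,6,10], [0,3,4]]),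
    ([2,8,10],[]), ([4,5,11],[]), ([2,8,11],[])])"

lemma surface_9: "realized surface_9 1226488"
  by (rule realized_from_surface[OF surface_8]) code_simp

definition surface_10 :: realization where
  "surface_10 =
    ([([9,11],[5,6]), ([2,3],[10,11]), ([1,4],[9,11]), ([6,7],[2,3]), ([8,10],[4,7]), ([0,5],[8,10])],
    [11,10,2,3,6,7,5,4,9,8,1,0], [(36,2,-7), (-14,-7,-28), (-11,-24,-6), (23,15,-32), (12,-38,23), (-1,5,11)],
    [([0,4,6],[[4,6,7], [0,1,4], [2,4,6]]), ([0,6,7],[]), ([0,2,4],[[0,2,3], [0,1,4], [2,4,5]]), ([0,7,8],[]),
    ([0,8,10],[[0,4,10], [8,9,10]]), ([0,9,10],[[0,5,10], [1,4,9]]), ([0,5,9],[]), ([0,5,11],[[5,6,11], [0,1,6]]),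
    ([4,6,8],[[4,6,7], [0,3,4]]), ([3,7,8],[[0,2,3]]), ([2,5,6],[[0,2,5], [1,2,3]]), ([0,3,11],[[3,4,11], [0,5,11],
    [0,3,4]]), ([2,3,5],[[0,2,5], [3,4,5]]), ([2,10,11],[[3,10,11], [0,1,2]]), ([2,7,11],[[0,2,10], [0,5,11],
    [4,7,11]]), ([2,7,9],[[2,4,9]]), ([0,1,2],[[0,1,4], [0,1,3]]), ([5,6,10],[[2,9,10]]), ([4,9,11],[[8,9,11]]),
    ([4,9,10],[[2,4,10]])])"

lemma surface_10: "realized surface_10 1212840"
  by (rule realized_from_surface[OF surface_6]) code_simp

definition surface_11 :: realization where
  "surface_11 =
    ([([3,4],[6,7]), ([6,8],[2,9]), ([1,11],[6,8]), ([4,9],[1,11]), ([2,8],[4,9]), ([1,10],[2,8]), ([1,7],[4,5]),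
    ([1,4],[5,11]), ([0,2],[1,4]), ([0,1],[3,4]), ([9,11],[0,1])], [6,5,0,2,4,7,3,11,10,1,8,9], [(15,38,-14),
    (47,-28,-37), (52,31,-12), (-53,-61,2), (-54,-37,-10), (-49,-16,-48)], [([0,5,6],[[3,5,8], [0,6,7], [0,1,3]]),
    ([0,7,8],[[0,3,8], [3,7,8], [0,5,6]]), ([0,9,11],[[0,7,9], [0,1,3]]), ([0,3,11],[[0,7,9], [0,1,3]]),
    ([2,8,11],[[1,8,11], [4,5,11]]), ([2,9,11],[]), ([0,7,10],[[5,7,10], [0,1,7], [2,3,4]]), ([0,9,10],[[0,1,3],
    [4,5,10], [3,4,9]]), ([5,6,11],[[0,1,6], [0,5,6], [4,5,11]]), ([0,1,2],[[0,1,3], [0,2,4], [0,1,4]]),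
    ([0,2,4],[[0,1,3], [1,2,4], [0,1,2]]), ([0,6,8],[[0,1,6], [0,1,3], [0,5,8]]), ([4,10,11],[[1,3,4], [1,2,4]]),
    ([2,5,10],[[0,2,5], [0,3,5]]), ([2,5,8],[[1,3,5], [0,3,8]]), ([0,4,5],[[0,3,5], [1,2,4]]), ([2,7,9],[]),
    ([2,4,6],[[0,5,6]]), ([4,6,9],[[2,6,7]]), ([2,6,7],[])])"

lemma surface_11: "realized surface_11 1213600"
  by (rule realized_from_surface[OF surface_2]) code_simp

definition surface_12 :: realization where
  "surface_12 =
    ([([0,1],[2,3]), ([4,5],[0,1])], [0,1,4,5,2,3,11,10,9,8,7,6], [(-30,25,7), (30,-37,-37), (8,-7,24),
    (-57,-10,-15), (-37,10,40), (36,-11,43)], [([0,5,6],[[2,5,6], [0,5,7], [0,3,6]]), ([0,6,8],[[0,2,8], [0,3,6],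
    [1,6,8]]), ([0,7,8],[[6,7,8], [3,5,7], [0,6,8]]), ([0,7,10],[[0,9,10]]), ([0,9,10],[[0,7,9], [1,7,10]]),
    ([0,9,11],[[3,9,11], [0,7,9], [1,7,9]]), ([0,4,5],[[3,4,6], [4,5,7], [0,1,3]]), ([0,3,11],[]), ([2,5,6],[[0,2,5],
    [5,6,7]]), ([2,5,8],[[0,2,5], [2,4,8], [0,6,8]]), ([2,4,11],[[1,2,4], [2,5,11], [0,4,11]]), ([4,10,11],[[1,4,11],
    [3,4,10]]), ([2,8,11],[[1,2,11], [0,2,6], [0,6,11]]), ([4,8,10],[[0,4,6], [1,4,10], [0,6,8]]), ([4,6,8],[[1,2,4],
    [0,6,8]]), ([4,6,9],[[2,4,6], [1,4,6], [1,7,9]]), ([0,1,2],[[0,2,6], [0,1,3], [0,2,3]]), ([0,2,4],[[0,2,6],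
    [0,1,4], [0,2,3]]), ([2,7,10],[]), ([2,6,7],[])])"

lemma surface_12: "realized surface_12 1224756"
  by (rule realized_from_surface[OF surface_11]) code_simp

definition surface_13 :: realization where
  "surface_13 =
    ([([5,9],[7,11]), ([4,8],[6,10]), ([3,10],[5,9]), ([2,11],[4,8])], [0,1,2,3,4,5,6,7,8,9,10,11], [(-4,10,7),
    (-9,13,12), (5,-1,-15), (10,14,11), (0,7,2), (1,-4,3)], [([0,2,4],[[0,4,6], [2,4,5], [0,2,6]]),
    ([0,4,5],[[0,4,6], [0,1,6], [0,2,5]]), ([0,5,6],[[0,2,5], [0,1,6]]), ([0,6,8],[[0,3,8], [1,3,6], [0,1,6]]),
    ([0,7,8],[[5,7,8], [0,2,7], [0,2,4]]), ([2,5,6],[]), ([0,1,2],[[0,1,3], [1,2,6]]), ([0,7,10],[[0,1,10], [1,6,9],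
    [0,2,6]]), ([0,9,10],[[0,1,10], [0,2,9], [1,6,9]]), ([0,9,11],[[1,9,11], [0,7,9], [0,7,8]]), ([0,3,11],[[1,3,11],
    [0,7,8], [0,3,6]]), ([2,5,8],[[4,6,8], [0,2,6]]), ([2,4,8],[[4,6,8], [0,2,6]]), ([4,8,11],[[0,1,11], [0,1,6]]),
    ([5,7,8],[[0,2,7]]), ([4,10,11],[[0,1,6]]), ([4,6,10],[[6,9,10]]), ([2,7,10],[[0,1,10]]), ([6,8,10],[[0,8,9]]),
    ([2,6,7],[])])"

lemma surface_13: "realized surface_13 1247290"
  by (rule realized_from_surface[OF surface_12]) code_simp

definition surface_14 :: realization where
  "surface_14 =
    ([([0,1],[2,3]), ([0,3],[2,11]), ([1,2],[3,10]), ([4,5],[0,1]), ([0,4],[1,2]), ([10,11],[4,5]), ([1,5],[0,3]),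
    ([2,3],[10,11]), ([0,1],[2,3])], [7,6,3,2,4,5,1,0,9,8,11,10], [(-9,6,13), (-2,-3,2), (11,-9,15), (-2,-13,-1),
    (-10,-5,-7), (-12,-17,-13)], [([0,2,4],[[1,2,4], [0,2,3], [0,4,5]]), ([0,8,10],[[0,4,8], [0,1,10]]),
    ([0,5,10],[[0,4,10], [0,2,5]]), ([4,5,11],[]), ([0,1,2],[[1,2,4], [0,2,3]]), ([0,6,8],[[1,6,8], [0,1,8],
    [4,6,9]]), ([0,5,9],[[0,1,9], [0,3,9], [1,4,5]]), ([2,4,8],[[0,1,2], [0,2,8], [0,4,5]]), ([0,7,9],[[0,1,9],
    [0,2,7], [5,7,8]]), ([0,7,11],[[0,4,11], [0,2,7], [5,7,11]]), ([4,9,10],[]), ([0,4,6],[[0,3,6], [0,1,2],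
    [0,1,6]]), ([0,3,11],[[1,3,11], [0,2,7]]), ([3,4,9],[[3,5,9]]), ([3,4,6],[[0,3,6]]), ([7,8,11],[]),
    ([7,8,10],[[0,7,10]]), ([3,7,10],[[2,3,10]]), ([2,3,6],[]), ([2,10,11],[])])"

lemma surface_14: "realized surface_14 1225704"
  by (rule realized_from_surface[OF surface_13]) code_simp

definition surface_15 :: realization where
  "surface_15 =
    ([([6,7],[2,3]), ([2,7],[3,10]), ([5,8],[2,7]), ([0,6],[5,8]), ([3,6],[2,11]), ([4,9],[3,6]), ([1,7],[4,9])],
    [4,5,1,0,9,8,7,6,3,2,10,11], [(2,1,36), (32,-24,-26), (-2,-14,20), (-37,-26,37), (5,-35,-13), (7,-19,-6)],
    [([0,1,2],[[1,2,4], [0,2,4]]), ([0,2,4],[[1,2,4], [0,1,2], [0,4,6]]), ([0,4,6],[[0,1,4], [1,4,6]]),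
    ([0,6,8],[[0,4,8]]), ([0,7,8],[[0,2,8]]), ([0,5,11],[[0,2,11], [2,9,11], [2,3,11]]), ([0,5,9],[[0,1,9]]),
    ([0,3,9],[[0,1,3], [0,5,9]]), ([0,7,10],[[0,5,10], [2,7,10], [2,3,6]]), ([0,10,11],[[2,10,11], [0,2,4],
    [0,3,6]]), ([3,4,10],[[3,8,10], [3,4,6], [0,2,4]]), ([2,7,11],[[2,3,11], [2,9,11], [0,3,7]]),
    ([5,7,10],[[0,5,10], [0,2,7], [2,3,6]]), ([2,4,7],[[1,2,4]]), ([4,7,8],[[1,2,8]]), ([3,4,11],[[0,4,11], [2,3,4],
    [2,3,7]]), ([6,8,10],[[0,2,10], [2,3,8]]), ([8,9,10],[[2,8,9]]), ([2,3,8],[]), ([2,9,10],[[0,8,9]])])"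

lemma surface_15: "realized surface_15 1225242"
  by (rule realized_from_surface[OF surface_13]) code_simp

definition surface_16 :: realization where
  "surface_16 =
    ([([4,10],[7,11]), ([3,9],[4,10]), ([0,11],[3,9]), ([7,10],[0,11]), ([5,11],[6,10]), ([2,8],[5,11]),
    ([1,10],[2,8]), ([6,11],[1,10])], [0,1,2,3,4,5,6,7,8,9,11,10], [(-2,-1,2), (11,20,1), (-12,2,0), (12,1,-5),
    (14,0,-4), (-7,12,21)], [([0,2,4],[[0,2,3], [0,4,7], [2,4,9]]), ([0,10,11],[[0,1,2], [0,1,10], [0,1,11]]),
    ([0,9,11],[[0,7,9], [0,2,11], [3,9,11]]), ([0,3,9],[[0,7,9], [0,2,3]]), ([5,6,11],[[2,6,10], [0,5,6], [3,5,11]]),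
    ([4,6,9],[[0,2,6], [2,6,9], [2,4,9]]), ([4,9,11],[[0,1,11], [4,7,10], [2,4,9]]), ([3,4,11],[[4,7,10], [2,4,9],
    [3,4,9]]), ([3,4,10],[[0,3,4], [2,4,10]]), ([0,7,10],[[0,1,7], [1,7,10], [0,2,10]]), ([2,4,6],[[4,6,9],
    [2,4,9]]), ([3,6,8],[]), ([2,6,7],[]), ([0,7,8],[[0,4,8], [0,1,3], [0,3,7]]), ([2,9,10],[]), ([0,1,2],[[0,3,7],
    [1,2,6]]), ([0,4,5],[[1,4,5], [0,4,7], [1,5,6]]), ([0,5,6],[[0,1,6], [0,3,7], [1,5,6]]), ([0,6,8],[[0,1,6],
    [0,3,7]]), ([2,8,11],[])])"

lemma surface_16: "realized surface_16 1212960"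
  by (rule realized_from_surface[OF surface_11]) code_simp

definition surface_17 :: realization where
  "surface_17 =
    ([([0,1],[2,3])], [2,3,0,1,4,5,6,7,9,8,10,11], [(-36,-31,10), (11,4,11), (9,-20,20), (-24,8,39), (13,-19,25),
    (-16,-32,-16)], [([0,1,2],[[0,1,6], [1,2,7], [0,2,7]]), ([0,2,4],[[0,1,6], [2,4,7], [0,4,8]]), ([0,4,6],[[3,4,8],
    [3,4,6], [0,4,8]]), ([0,6,7],[]), ([0,7,8],[]), ([0,8,10],[]), ([0,5,10],[[5,6,10], [0,5,9]]),
    ([0,5,11],[[0,5,9]]), ([0,9,11],[]), ([0,3,9],[[3,6,9], [0,1,7]]), ([4,8,11],[[4,7,11]]), ([2,8,11],[[2,7,8]]),
    ([4,7,10],[[0,2,10], [3,4,7]]), ([2,7,10],[[3,4,7], [0,1,10]]), ([2,10,11],[[0,1,2]]), ([2,7,9],[[2,5,6]]),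
    ([2,6,9],[[2,3,6], [2,5,9]]), ([2,5,6],[[2,3,6]]), ([4,6,8],[]), ([2,4,5],[])])"

lemma surface_17: "realized surface_17 1212320"
  by (rule realized_from_surface[OF surface_16]) code_simp

definition surface_18 :: realization where
  "surface_18 =
    ([([3,11],[4,8]), ([0,9],[3,11]), ([2,10],[5,9]), ([1,8],[2,10])], [5,4,0,1,6,7,11,10,2,3,9,8], [(-24,-4,11),
    (-10,10,12), (2,-14,-17), (8,-11,20), (16,-14,17), (15,-21,21)], [([0,1,2],[[0,1,5], [0,2,4], [1,2,5]]),
    ([0,2,4],[[0,1,2], [2,4,5]]), ([0,4,6],[[2,4,6], [4,5,6], [0,6,9]]), ([0,8,10],[[0,4,8], [1,4,10]]),
    ([0,7,10],[[0,7,8], [4,6,7]]), ([0,7,11],[[0,7,9], [1,7,11]]), ([0,6,8],[[0,5,8], [0,6,9], [1,4,8]]),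
    ([0,5,11],[]), ([0,5,9],[[4,5,9]]), ([3,4,10],[[0,3,5], [0,1,4]]), ([2,4,11],[[1,2,4], [4,5,9]]),
    ([4,9,11],[[2,4,5], [0,4,9]]), ([0,3,9],[[2,3,9], [0,3,4], [1,3,5]]), ([3,4,6],[[2,3,6], [0,6,9], [3,4,5]]),
    ([4,5,9],[]), ([6,8,11],[[4,6,7]]), ([7,8,11],[[2,3,7]]), ([3,7,8],[[2,3,7]]), ([2,6,7],[[2,3,6]]),
    ([2,3,8],[])])"

lemma surface_18: "realized surface_18 1212640"
  by (rule realized_from_surface[OF surface_16]) code_simp

definition surface_19 :: realization where
  "surface_19 =
    ([([2,3],[8,9]), ([0,1],[2,3])], [8,9,3,2,7,6,11,10,0,1,5,4], [(-17,-25,-13), (-8,-9,-20), (1,-7,15),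
    (-20,24,22), (-21,11,12), (16,14,-24)], [([0,4,6],[[0,4,5], [0,5,6]]), ([0,5,6],[[0,4,5], [0,4,6], [1,5,6]]),
    ([0,5,8],[[0,4,5], [1,2,8], [1,5,6]]), ([0,7,8],[]), ([0,2,4],[[2,4,10], [0,2,9], [1,4,8]]), ([0,7,10],[]),
    ([0,10,11],[]), ([0,9,11],[[2,4,9], [0,1,9], [2,7,11]]), ([0,3,9],[[0,2,3], [3,4,9], [0,1,9]]),
    ([4,7,8],[[0,4,8], [0,1,7]]), ([0,1,2],[[1,2,8], [0,1,3], [0,2,9]]), ([4,6,8],[[0,4,5]]), ([6,8,10],[[5,8,10]]),
    ([3,6,10],[[3,5,8], [1,2,10]]), ([2,7,10],[[0,2,3]]), ([2,3,8],[[1,2,3], [2,5,8]]), ([2,9,10],[[0,2,3]]),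
    ([5,8,11],[[0,2,5]]), ([2,5,11],[[0,1,5]]), ([2,4,5],[])])"

lemma surface_19: "realized surface_19 1213200"
  by (rule realized_from_surface[OF surface_18]) code_simp

definition surface_20 :: realization where
  "surface_20 =
    ([([3,6],[4,7]), ([2,7],[5,6]), ([2,9],[3,6]), ([3,8],[2,7]), ([4,11],[2,9]), ([5,10],[3,8])],
    [7,6,4,5,3,2,8,9,11,10,0,1], [(9,23,-15), (27,-29,-74), (54,-18,-14), (8,68,-11), (-34,-68,30), (-40,-69,38)],
    [([0,1,2],[[0,1,4], [1,2,3], [0,2,3]]), ([0,2,4],[[0,3,7], [0,1,4], [0,2,3]]), ([0,4,5],[[3,4,5], [0,2,4],
    [1,4,5]]), ([0,5,6],[[0,3,5], [0,3,6]]), ([0,7,11],[[0,4,11], [0,2,7], [4,7,11]]), ([0,3,11],[[3,4,11], [0,2,11],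
    [0,1,3]]), ([5,6,11],[]), ([0,8,10],[[0,1,8], [0,2,3], [0,3,10]]), ([0,9,10],[[0,6,10], [0,6,9], [5,9,10]]),
    ([4,10,11],[]), ([0,6,8],[[0,1,8], [0,3,6], [1,7,8]]), ([0,7,9],[[0,6,9], [0,2,7], [1,7,9]]), ([2,5,10],[[0,2,3],
    [0,2,8]]), ([2,6,11],[]), ([2,9,11],[[2,4,9]]), ([7,8,11],[[0,4,9]]), ([2,5,7],[[0,2,3], [3,5,7]]),
    ([4,6,9],[[0,2,6]]), ([2,3,7],[]), ([2,4,9],[])])"

lemma surface_20: "realized surface_20 1238256"
  by (rule realized_from_surface[OF surface_18]) code_simp

definition surface_21 :: realization where
  "surface_21 =
    ([([3,6],[4,7]), ([2,7],[5,6]), ([2,9],[3,6]), ([3,8],[2,7]), ([1,6],[10,11]), ([4,11],[2,9]), ([1,10],[4,11]),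
    ([3,5],[1,10]), ([0,9],[3,5]), ([2,4],[0,9]), ([1,8],[2,4]), ([5,10],[1,8]), ([1,10],[3,8]), ([4,11],[1,10]),
    ([10,11],[1,6])], [7,6,4,5,3,2,8,9,11,10,0,1], [(-98,-128,-1071), (-938,901,-119), (-501,1509,-1072),
    (-171,-422,-1076), (362,430,-1259), (1022,-99,-1802)], [([0,2,4],[[0,3,7], [0,2,3], [0,1,4]]), ([2,5,6],[[0,5,6],
    [2,3,6], [0,1,2]]), ([2,5,11],[]), ([0,1,2],[[0,1,4], [0,1,3], [1,2,3]]), ([0,4,5],[[1,4,5], [0,3,4], [1,2,5]]),
    ([0,5,6],[[0,2,5], [0,1,2], [0,3,6]]), ([0,8,10],[[0,1,8], [0,3,4], [0,3,10]]), ([0,9,10],[[0,6,10], [0,3,9],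
    [5,9,10]]), ([0,7,11],[[0,4,11], [0,2,7], [4,7,11]]), ([0,3,11],[[3,4,11], [0,2,3], [0,2,11]]), ([4,10,11],[]),
    ([0,6,8],[[0,1,8], [1,2,8], [0,3,6]]), ([0,7,9],[[0,3,9], [0,2,7], [1,7,9]]), ([2,7,10],[[5,7,10], [0,2,3]]),
    ([2,9,11],[[0,2,4]]), ([2,4,9],[[4,6,9]]), ([4,6,9],[[0,2,6]]), ([4,6,11],[[0,2,6], [0,3,6]]),
    ([7,8,11],[[0,2,7]]), ([2,3,7],[])])"

lemma surface_21: "realized surface_21 1237056"
  by (rule realized_from_surface[OF surface_18]) code_simp

definition surface_22 :: realization where
  "surface_22 =
    ([([2,3],[6,7])], [0,1,2,3,4,5,6,7,8,9,10,11], [(12,-2,9), (0,-10,-4), (-4,-8,-13), (2,-6,-1), (-5,-2,2),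
    (-3,-4,-3)], [([0,1,2],[]), ([0,2,4],[]), ([0,4,5],[]), ([0,5,6],[[2,5,6]]), ([0,6,8],[[2,6,8], [0,1,8],
    [1,6,8]]), ([0,8,10],[[0,2,10], [1,8,10]]), ([0,7,9],[[3,7,9], [0,1,5]]), ([0,7,11],[[3,7,11]]),
    ([0,3,11],[[1,3,11]]), ([0,9,10],[[4,9,10], [6,7,10]]), ([2,5,6],[]), ([2,5,11],[[2,4,11]]),
    ([4,10,11],[[2,7,10], [3,6,11]]), ([2,7,10],[[2,4,7], [5,7,10], [1,2,7]]), ([2,9,11],[[1,2,8]]),
    ([2,4,9],[[4,5,9], [4,6,9]]), ([4,6,9],[[4,5,9], [2,3,6]]), ([4,6,11],[[0,3,6], [2,3,6], [4,5,10]]),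
    ([7,8,11],[[4,8,9]]), ([2,6,7],[])])"

lemma surface_22: "realized surface_22 1246124"
  by (rule realized_from_surface[OF surface_21]) code_simp

definition surface_23 :: realization where
  "surface_23 =
    ([([3,10],[4,8]), ([2,7],[3,10]), ([2,11],[5,9]), ([3,6],[2,11])], [0,1,2,3,4,5,6,7,8,9,10,11], [(31,-17,8),
    (-26,-31,-10), (-22,-12,-28), (-2,-19,-2), (-15,7,-1), (-15,-6,-11)], [([0,1,2],[]), ([0,2,4],[]), ([0,4,5],[]),
    ([0,5,6],[[2,5,6]]), ([0,6,8],[[0,2,6], [0,1,8], [1,6,8]]), ([0,8,10],[[0,6,10], [0,1,8], [0,2,10]]),
    ([0,7,9],[[1,3,7], [0,2,9]]), ([0,7,11],[[2,7,11], [0,1,11]]), ([0,3,11],[[5,7,11], [1,3,8]]),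
    ([0,9,10],[[1,8,10], [2,3,10]]), ([2,5,6],[]), ([2,5,9],[[2,4,9]]), ([4,8,10],[[2,4,10]]), ([2,4,9],[[4,5,9]]),
    ([4,6,9],[[2,4,6], [4,5,9]]), ([4,6,11],[[4,5,11], [0,6,9]]), ([4,10,11],[[2,10,11]]), ([6,9,10],[[2,3,10],
    [0,5,8]]), ([2,3,10],[[1,2,3]]), ([2,6,11],[])])"

lemma surface_23: "realized surface_23 1235080"
  by (rule realized_from_surface[OF surface_21]) code_simp

definition surface_24 :: realization where
  "surface_24 =
    ([([0,7],[10,11]), ([5,8],[0,7]), ([7,10],[2,11]), ([0,5],[7,10]), ([1,3],[0,5]), ([1,9],[4,7]), ([6,11],[1,3]),
    ([1,6],[3,10]), ([2,8],[1,6]), ([7,11],[2,8]), ([1,4],[7,11]), ([0,2],[1,4])], [7,3,6,9,2,0,8,5,10,4,1,11],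
    [(10,12,13), (8,-9,12), (-11,-15,25), (5,-30,18), (-16,8,2), (32,-17,-6)], [([0,4,6],[[0,1,4], [0,2,6],
    [0,5,7]]), ([0,5,6],[[0,4,6], [0,5,7]]), ([0,7,10],[[0,5,10]]), ([0,10,11],[[0,7,11], [0,5,10]]),
    ([0,5,8],[[5,6,8], [0,7,8], [0,5,7]]), ([0,7,8],[[0,5,8], [5,7,8], [0,5,7]]), ([0,9,11],[[8,9,10], [0,1,9],
    [0,5,7]]), ([3,4,7],[[0,3,4], [3,5,7]]), ([2,6,10],[[1,2,10], [0,2,4]]), ([2,4,10],[[1,2,10], [4,6,10]]),
    ([3,4,8],[[2,5,8], [1,4,6]]), ([2,3,8],[[0,2,3], [2,4,8], [2,5,8]]), ([4,9,10],[[1,2,9]]), ([0,3,9],[[2,8,9],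
    [0,1,9], [0,5,7]]), ([4,8,11],[[1,4,8], [2,5,11]]), ([0,2,4],[[2,3,4], [0,1,4], [0,5,7]]), ([4,6,11],[]),
    ([0,1,2],[[0,1,7], [1,2,6]]), ([6,8,10],[[8,9,10]]), ([6,8,9],[])])"

lemma surface_24: "realized surface_24 1223562"
  by (rule realized_from_surface[OF surface_0]) code_simp

definition surface_25 :: realization where
  "surface_25 =
    ([([8,9],[6,7]), ([2,3],[8,9])], [0,1,2,3,4,5,6,7,8,9,10,11], [(-170,-175,57), (-196,146,58), (-52,182,-108),
    (-40,2,-55), (134,-25,43), (-63,-69,-3)], [([0,1,2],[[0,1,3]]), ([0,2,4],[]), ([0,4,6],[[0,2,6]]),
    ([0,5,6],[[0,4,6]]), ([0,5,8],[[3,5,8], [0,3,8]]), ([0,7,8],[[5,7,8], [0,5,7], [0,3,8]]), ([0,7,10],[[3,7,10],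
    [0,5,10], [0,5,7]]), ([0,10,11],[[4,10,11], [5,10,11], [0,3,8]]), ([0,9,11],[[0,4,11], [0,2,9], [0,1,10]]),
    ([0,3,9],[[2,3,9]]), ([3,4,7],[[3,5,7]]), ([2,6,10],[[0,5,10], [2,5,10]]), ([2,4,10],[[1,4,10], [2,5,10],
    [4,6,9]]), ([3,4,8],[]), ([2,8,9],[]), ([5,8,11],[[0,5,11]]), ([4,8,11],[]), ([4,6,11],[[2,6,11]]), ([6,7,9],[]),
    ([6,8,10],[[6,7,8]])])"

lemma surface_25: "realized surface_25 1237920"
  by (rule realized_from_surface[OF surface_24]) code_simp

definition surface_26 :: realization where
  "surface_26 =
    ([([2,11],[7,9]), ([2,3],[4,5]), ([0,1],[2,3]), ([3,10],[6,8]), ([0,3],[2,11]), ([3,11],[2,6]), ([1,2],[3,10]),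
    ([6,11],[1,2]), ([4,10],[6,11]), ([2,10],[3,7]), ([7,10],[0,3]), ([5,11],[7,10]), ([10,11],[6,7])],
    [7,6,10,11,5,4,1,0,8,9,3,2], [(-14,16,-16), (-14,-7,17), (2,-4,-5), (-3,-4,13), (8,-2,8), (-4,-1,15)],
    [([0,1,2],[]), ([0,2,4],[[1,4,5], [1,2,4]]), ([0,5,8],[[1,5,8], [0,2,8]]), ([0,7,8],[[2,7,8], [0,3,7], [0,3,8]]),
    ([0,7,10],[[0,2,10], [0,3,7]]), ([0,10,11],[[0,4,11], [0,7,10], [0,3,11]]), ([0,3,9],[[2,3,9]]),
    ([2,6,10],[[6,9,10]]), ([4,5,11],[[4,8,11], [0,2,9], [1,6,11]]), ([2,7,10],[[3,7,9]]), ([2,4,9],[[0,4,9],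
    [0,1,4]]), ([0,5,6],[[4,5,6], [0,2,6], [1,2,6]]), ([2,6,8],[[3,6,8]]), ([0,4,6],[[0,5,6], [1,4,6], [0,2,6]]),
    ([4,7,8],[[4,5,7], [1,3,8], [1,4,8]]), ([4,6,10],[[4,8,10], [0,7,9]]), ([0,9,11],[[5,8,9], [0,2,9], [0,3,6]]),
    ([8,9,10],[[0,7,9], [1,3,8], [4,8,9]]), ([4,8,11],[[2,3,4], [1,6,8]]), ([2,7,9],[[0,3,6]])])"

lemma surface_26: "realized surface_26 1240280"
  by (rule realized_from_surface[OF surface_5]) code_simp

definition surface_27 :: realization where
  "surface_27 =
    ([([3,11],[6,7]), ([0,9],[3,11]), ([5,6],[0,9]), ([4,10],[5,6]), ([6,10],[2,5]), ([1,11],[6,10]), ([5,7],[1,11]),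
    ([2,10],[5,7]), ([0,1],[2,3]), ([0,11],[3,10]), ([6,9],[0,1])], [7,1,11,4,6,9,3,0,2,10,5,8], [(-59,-8,-17),
    (5,3,-16), (62,9,-41), (95,14,-62), (53,-32,-71), (-76,-84,72)], [([0,8,10],[[0,3,8], [0,7,10]]),
    ([0,9,10],[[2,9,10], [0,7,10]]), ([0,7,9],[[0,9,10], [0,7,10]]), ([0,7,11],[[0,7,9], [0,5,11]]),
    ([0,3,11],[[2,3,11], [0,3,9], [0,7,11]]), ([4,6,11],[[4,8,11], [0,3,6]]), ([2,4,9],[[1,2,4], [2,7,9], [4,6,8]]),
    ([2,3,10],[[0,2,3], [2,8,10]]), ([2,6,9],[[1,2,6], [2,7,9], [2,3,6]]), ([6,7,8],[[4,5,9]]), ([6,10,11],[]),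
    ([0,1,2],[[0,1,9], [0,2,8]]), ([0,5,8],[[3,5,7], [0,4,8], [0,5,9]]), ([0,2,4],[[0,1,4], [0,4,9], [1,4,8]]),
    ([0,5,6],[[4,5,6], [0,4,8], [0,5,9]]), ([3,4,7],[[4,5,6], [1,4,8], [2,3,5]]), ([3,4,10],[[1,3,4], [1,4,8]]),
    ([4,8,10],[[0,2,4], [1,3,4]]), ([0,4,6],[[0,1,4], [0,4,8], [0,5,9]]), ([4,8,11],[])])"

lemma surface_27: "realized surface_27 1225808"
  by (rule realized_from_surface[OF surface_26]) code_simp

definition surface_28 :: realization where
  "surface_28 =
    ([([1,11],[8,9]), ([0,3],[1,11]), ([8,10],[0,3]), ([5,7],[8,10]), ([1,4],[5,7]), ([0,2],[1,4]), ([2,11],[5,9]),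
    ([5,6],[0,2]), ([0,6],[2,8]), ([9,10],[0,6]), ([5,11],[9,10]), ([0,9],[6,7]), ([3,6],[2,11])],
    [2,10,7,1,3,6,11,0,8,4,5,9], [(-143,102,20), (0,-126,111), (75,-73,35), (11,-54,68), (126,3,94), (-1,10,91)],
    [([0,1,2],[]), ([0,2,4],[[1,2,4]]), ([0,4,6],[[0,2,6], [1,4,6], [1,2,3]]), ([0,5,6],[[2,4,6], [0,1,6]]),
    ([0,5,8],[[0,3,8]]), ([0,7,8],[[3,7,8], [0,1,8], [0,2,3]]), ([0,9,11],[[0,3,11], [0,2,7], [2,9,11]]),
    ([0,3,9],[]), ([4,7,8],[[3,5,7], [1,4,8], [0,1,8]]), ([3,4,6],[[2,3,6], [0,3,4], [0,4,6]]), ([3,5,8],[[0,1,7]]),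
    ([0,7,10],[[2,3,10], [0,5,10], [3,6,7]]), ([2,5,11],[[3,5,11], [0,7,10]]), ([4,8,10],[[2,4,10], [3,8,10],
    [3,4,6]]), ([0,10,11],[[0,2,7], [0,7,10], [3,7,11]]), ([2,6,8],[]), ([6,8,11],[[0,2,11], [2,6,7]]),
    ([3,8,11],[[2,3,10], [1,2,7]]), ([2,3,11],[[0,2,7], [0,3,6]]), ([2,6,7],[])])"

lemma surface_28: "realized surface_28 1225086"
  by (rule realized_from_surface[OF surface_21]) code_simp

definition surface_29 :: realization where
  "surface_29 =
    ([([3,4],[6,10]), ([2,5],[7,11])], [0,1,2,3,4,5,6,7,8,9,10,11], [(-21,-19,-29), (31,11,38), (6,5,-27), (10,0,25),
    (27,31,5), (-20,-23,15)], [([0,1,2],[]), ([0,2,4],[[1,2,4]]), ([0,5,8],[[0,2,8]]), ([0,7,8],[[0,2,7], [2,3,8],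
    [0,1,8]]), ([0,4,6],[[0,5,6], [1,2,6], [2,3,6]]), ([0,7,10],[[0,9,10], [3,7,10], [0,3,7]]),
    ([0,10,11],[[6,10,11], [0,4,11], [0,7,10]]), ([0,9,11],[[2,9,11], [0,4,11], [8,9,10]]), ([0,3,9],[]),
    ([4,7,8],[[2,4,7], [2,3,8], [4,5,7]]), ([4,6,10],[[4,9,10], [1,2,6], [2,3,10]]), ([3,6,10],[[0,3,6], [1,2,10]]),
    ([3,5,8],[[0,1,7]]), ([0,5,6],[[2,4,6], [2,3,6], [4,5,6]]), ([4,8,10],[[2,8,10], [0,2,10], [8,9,10]]),
    ([2,3,11],[]), ([2,6,8],[[0,6,7]]), ([2,6,7],[[0,3,7]]), ([2,9,10],[]), ([6,8,11],[])])"

lemma surface_29: "realized surface_29 1236616"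
  by (rule realized_from_surface[OF surface_28]) code_simp

definition surface_30 :: realization where
  "surface_30 =
    ([([0,10],[7,11]), ([1,11],[6,10])], [6,7,3,2,4,5,0,1,9,8,10,11], [(7,-1,-2), (-15,-6,-17), (7,-7,5), (-9,15,10),
    (6,16,-16), (-1,0,-14)], [([0,1,2],[[0,2,4], [0,3,5], [1,2,4]]), ([0,4,6],[[0,3,6], [0,2,7], [4,6,7]]),
    ([0,5,6],[[0,1,3], [0,6,7], [2,5,6]]), ([0,9,11],[[1,2,11], [0,3,5], [0,7,9]]), ([0,3,9],[[0,7,9], [0,3,5]]),
    ([4,7,8],[[3,7,8], [0,4,8], [0,4,7]]), ([3,4,6],[[3,4,7], [0,4,6]]), ([3,4,8],[[0,4,8], [0,4,6], [3,4,6]]),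
    ([2,6,8],[]), ([0,10,11],[[0,2,6], [0,3,5], [2,10,11]]), ([2,9,11],[[3,7,11], [1,2,10]]), ([6,8,11],[[0,6,10],
    [3,8,11], [1,3,5]]), ([0,7,8],[[0,4,7], [0,3,8], [3,4,7]]), ([0,2,4],[[0,1,2], [1,2,4], [3,4,6]]),
    ([2,3,11],[[2,9,10], [0,3,5]]), ([0,7,10],[[0,1,10], [4,7,10], [0,3,7]]), ([0,5,8],[[0,1,3], [0,3,6], [2,5,6]]),
    ([5,8,11],[[0,1,10], [0,3,6], [2,5,6]]), ([2,4,10],[[0,1,10], [1,2,4], [3,4,6]]), ([2,6,7],[])])"

lemma surface_30: "realized surface_30 1224690"
  by (rule realized_from_surface[OF surface_28]) code_simp

definition surface_31 :: realization where
  "surface_31 =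
    ([([8,11],[4,5]), ([1,10],[8,11]), ([1,8],[2,11]), ([5,7],[1,10]), ([3,11],[5,7]), ([2,8],[3,11]),
    ([8,11],[3,10]), ([4,5],[8,11]), ([9,10],[4,5]), ([6,8],[9,10]), ([4,11],[6,8]), ([4,8],[3,6]), ([6,11],[1,8])],
    [1,3,5,0,10,9,7,2,4,11,6,8], [(-24,1,14), (-1,7,-28), (15,45,-41), (16,15,-13), (-32,10,13), (-50,46,44)],
    [([0,4,6],[[0,1,6], [0,3,4], [1,3,4]]), ([0,5,8],[[0,7,8], [1,5,8]]), ([0,5,10],[]), ([0,6,8],[[0,1,6], [3,7,8],
    [1,3,4]]), ([0,10,11],[]), ([0,1,2],[[1,2,4], [0,2,3], [0,2,4]]), ([0,9,11],[[0,1,5]]), ([0,7,9],[[6,7,9],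
    [0,2,5], [1,5,7]]), ([0,2,4],[[0,2,5], [0,2,3], [1,2,4]]), ([0,3,7],[[0,2,3], [0,2,7], [1,3,4]]),
    ([3,4,9],[[3,5,9], [0,2,4]]), ([2,4,8],[[0,2,5], [1,2,4], [4,5,8]]), ([4,7,8],[[1,2,4], [2,4,7], [4,5,8]]),
    ([3,4,6],[[2,3,6], [0,2,4]]), ([4,7,10],[[1,2,4], [3,7,10]]), ([4,5,10],[]), ([2,6,9],[[0,2,3]]),
    ([2,9,11],[[0,2,3]]), ([2,3,11],[]), ([2,7,10],[])])"

lemma surface_31: "realized surface_31 1237632"
  by (rule realized_from_surface[OF surface_24]) code_simp

definition surface_32 :: realization where
  "surface_32 =
    ([([0,10],[7,9]), ([10,11],[4,5]), ([4,6],[0,10]), ([1,8],[10,11]), ([4,7],[1,8]), ([5,11],[4,7]), ([1,9],[4,6]),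
    ([1,4],[6,8]), ([5,7],[1,4]), ([0,8],[5,7]), ([0,5],[6,7]), ([4,10],[0,5]), ([8,11],[4,10]), ([2,9],[8,11])],
    [10,4,11,8,1,6,2,9,7,3,5,0], [(-11,8,-16), (-1,1,-11), (5,-2,0), (5,1,7), (-1,15,-13), (9,12,16)],
    [([0,6,8],[[0,1,6], [2,6,8], [1,6,10]]), ([0,7,8],[[7,8,10], [0,7,10]]), ([0,1,2],[[1,2,8], [0,2,9]]),
    ([0,7,10],[[0,7,8], [1,4,10]]), ([0,10,11],[]), ([0,4,6],[[0,1,4], [0,5,8], [4,6,9]]), ([0,5,11],[[2,8,11]]),
    ([0,5,9],[[2,5,9]]), ([0,3,9],[[0,3,8], [1,2,3]]), ([4,9,10],[[1,4,9]]), ([4,9,11],[[1,4,5], [0,4,7]]),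
    ([4,6,11],[[1,4,11], [4,6,9]]), ([3,4,8],[[0,1,3]]), ([2,4,5],[[2,3,4], [0,5,8], [1,4,9]]), ([7,8,11],[[0,4,8]]),
    ([0,2,4],[[2,3,4], [0,1,2]]), ([2,6,8],[[0,1,2]]), ([3,8,10],[]), ([3,6,10],[]), ([2,3,6],[])])"

lemma surface_32: "realized surface_32 1213440"
  by (rule realized_from_surface[OF surface_5]) code_simp

definition surface_33 :: realization where
  "surface_33 =
    ([([0,10],[5,9]), ([2,3],[10,11]), ([2,4],[0,10]), ([6,7],[2,3]), ([3,6],[2,4]), ([3,4],[2,9]), ([1,11],[4,8]),
    ([5,11],[3,6]), ([2,8],[5,11]), ([8,11],[4,5]), ([6,9],[8,11]), ([2,4],[6,9]), ([0,10],[2,4]), ([2,4],[0,10]),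
    ([5,11],[2,4]), ([4,5],[2,8]), ([3,6],[5,11]), ([3,5],[1,11]), ([9,10],[3,5]), ([7,8],[9,10]), ([2,5],[7,8]),
    ([3,9],[2,5]), ([2,7],[3,8]), ([2,8],[3,4]), ([2,3],[4,5]), ([10,11],[2,3]), ([8,9],[10,11])],
    [5,4,2,3,9,8,0,1,7,6,11,10], [(-85,-120,-42), (33,-87,-31), (64,-31,83), (22,-51,16), (-28,81,-15), (-9,24,-18)],
    [([0,1,2],[]), ([0,2,4],[]), ([0,4,6],[[0,5,6], [1,4,6]]), ([0,5,6],[[4,6,7]]), ([0,5,8],[[0,3,8]]),
    ([0,7,8],[[0,5,7], [0,3,8]]), ([0,9,10],[[2,9,10], [0,3,10], [5,9,10]]), ([0,9,11],[[0,1,11], [2,9,11],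
    [0,2,10]]), ([0,3,11],[[1,2,11], [2,3,10], [0,9,10]]), ([0,7,10],[[3,6,10], [3,4,7], [3,6,7]]),
    ([4,7,8],[[5,7,8]]), ([4,8,11],[[2,4,11], [3,8,9], [0,8,10]]), ([3,5,8],[]), ([4,10,11],[[3,4,10], [2,4,11]]),
    ([4,6,10],[[2,3,10], [2,6,7]]), ([2,3,10],[[0,2,10], [0,3,6]]), ([2,6,11],[[0,1,6]]), ([6,8,10],[[2,6,10]]),
    ([2,6,7],[]), ([2,7,9],[[2,3,6]])])"

lemma surface_33: "realized surface_33 1233144"
  by (rule realized_from_surface[OF surface_3]) code_simp

text \<open>In this triangulation all vertices have degree 10, so each of the 60 edges contributes
  twice the fourth power of 10, which gives the value 1200000.\<close>

definition surface_34 :: realization where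
  "surface_34 =
    ([([1,10],[2,8]), ([0,11],[3,9]), ([10,11],[4,5]), ([2,3],[10,11]), ([6,7],[2,3])], [6,7,3,2,11,10,1,0,9,8,5,4],
    [(-31,10,-12), (4,-17,-5), (8,-36,-4), (-36,-14,-27), (9,23,-11), (31,12,-29)], [([0,2,3],[[0,2,4], [0,3,5],
    [1,2,3]]), ([0,3,4],[[0,3,5], [2,3,4]]), ([0,4,6],[]), ([0,6,8],[[3,6,8], [0,1,5]]), ([0,8,10],[[0,1,5],
    [0,5,10], [1,5,8]]), ([0,7,10],[[0,5,7], [0,5,10], [0,7,8]]), ([0,7,11],[[6,7,11], [0,5,7], [0,7,8]]),
    ([0,5,11],[]), ([0,5,9],[[3,4,9]]), ([0,2,9],[[2,4,9], [0,2,3]]), ([2,9,10],[[2,3,7], [1,9,10], [2,7,10]]),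
    ([6,8,11],[[0,1,5], [0,8,11]]), ([2,6,10],[[2,3,6], [6,7,10], [2,3,7]]), ([5,8,10],[[0,7,8]]), ([4,10,11],[]),
    ([2,6,7],[[2,3,6], [2,3,7]]), ([3,4,5],[]), ([4,6,9],[]), ([2,7,8],[]), ([2,4,8],[[2,4,5]])])"

lemma surface_34: "realized surface_34 1200000"
  by (rule realized_from_surface[OF surface_33]) code_simp

theorem theorem6p4:
  shows "\<exists>\<T> :: nat set set set.
    card \<T> = 35 \<and>
    pairwise (\<lambda>\<Delta> \<Gamma>. \<not> isomorphic_complexes \<Delta> \<Gamma>) \<T> \<and>
    (\<forall>\<Delta>\<in>\<T>. triangulates \<Delta> (orientable_surface 5) \<and> card (vertices \<Delta>) = 12 \<and>
      (\<exists>\<psi>. polyhedral_realization \<Delta> \<psi> \<and> twofold_rotational_symmetry \<Delta> \<psi>))"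
proof (intro exI conjI)
  define ds where "ds =
    [surface_0, surface_1, surface_2, surface_3, surface_4, surface_5, surface_6, surface_7, surface_8, surface_9,
    surface_10, surface_11, surface_12, surface_13, surface_14, surface_15, surface_16, surface_17, surface_18,
    surface_19, surface_20, surface_21, surface_22, surface_23, surface_24, surface_25, surface_26, surface_27,
    surface_28, surface_29, surface_30, surface_31, surface_32, surface_33, surface_34]"
  define vs :: "int list" where "vs =
    [1213640,1213362,1212200,1225214,1226644,1236720,1212560,1236048,1212760,1226488,1212840,1213600,1224756,1247290,1225704,1225242,1212960,1212320,1212640,1213200,1238256,1237056,1246124,1235080,1223562,1237920,1240280,1225808,1225086,1236616,1224690,1237632,1213440,1233144,1200000]"
  define \<C> where "\<C> = map (\<lambda>d. list_complex (surface_facets d)) ds"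
  have all: "list_all2 realized ds vs"
    unfolding ds_def vs_def by (intro list.rel_intros)
      (rule surface_0 surface_1 surface_2 surface_3 surface_4 surface_5 surface_6 surface_7 surface_8 surface_9 surface_10
    surface_11 surface_12 surface_13 surface_14 surface_15 surface_16 surface_17 surface_18 surface_19 surface_20
    surface_21 surface_22 surface_23 surface_24 surface_25 surface_26 surface_27 surface_28 surface_29 surface_30
    surface_31 surface_32 surface_33 surface_34)+
  have len: "length ds = 35" by (simp add: ds_def)
  have mem: "\<exists>v. realized d v" if "d \<in> set ds" for d
    using that all by (metis in_set_conv_nth list_all2_nthD)
  have "degree_invariant (list_complex (surface_facets d)) = list_invariant (surface_facets d)" if "d \<in> set ds" for d
    using mem[OF that] list_invariant_eq by (metis realized_def)
  then have "map degree_invariant \<C> = map (\<lambda>d. list_invariant (surface_facets d)) ds"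
    by (simp add: \<C>_def)
  also have "\<dots> = vs"
    using all by (intro nth_equalityI) (auto simp: list_all2_conv_all_nth realized_def)
  \<comment> \<open>The distinct values settle two things at once: the 35 list entries are different
    complexes, and no two of them are isomorphic.\<close>
  finally have "distinct (map degree_invariant \<C>)" by (simp add: vs_def)
  then have dist: "distinct \<C>" and inj: "inj_on degree_invariant (set \<C>)"
    by (simp_all add: distinct_map)
  show "card (set \<C>) = 35"
    using distinct_card[OF dist] len by (simp add: \<C>_def)
  show "pairwise (\<lambda>\<Delta> \<Gamma>. \<not> isomorphic_complexes \<Delta> \<Gamma>) (set \<C>)"
  proof (rule pairwiseI)
    fix \<Delta> \<Gamma> assume "\<Delta> \<in> set \<C>" "\<Gamma> \<in> set \<C>" "\<Delta> \<noteq> \<Gamma>"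
    then have "degree_invariant \<Delta> \<noteq> degree_invariant \<Gamma>" using inj by (auto simp: inj_on_def)
    then show "\<not> isomorphic_complexes \<Delta> \<Gamma>"
      using degree_invariant_iso unfolding isomorphic_complexes_def by metis
  qed
  show "\<forall>\<Delta>\<in>set \<C>. triangulates \<Delta> (orientable_surface 5) \<and> card (vertices \<Delta>) = 12 \<and>
      (\<exists>\<psi>. polyhedral_realization \<Delta> \<psi> \<and> twofold_rotational_symmetry \<Delta> \<psi>)"
  proof
    fix \<Delta> assume "\<Delta> \<in> set \<C>"
    then obtain e where e: "e \<in> set ds" "\<Delta> = list_complex (surface_facets e)"
      unfolding \<C>_def set_map by blast
    then obtain d v where \<Delta>: "\<Delta> = list_complex (surface_facets d)" and d: "realized d v"
      using mem by blast
    have tri: "triangle_list (surface_facets d)" using d by (simp add: realized_def)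
    have "top_of_set (underlying_space \<Delta>) homeomorphic_space top_of_set (facet_body (polygon_facet_lists 5))"
      using d by (simp add: \<Delta> underlying_space_list_complex realized_def homeomorphic_imp_homeomorphic_space)
    then have "top_of_set (underlying_space \<Delta>) homeomorphic_space orientable_surface 5"
      by (rule homeomorphic_space_trans) (rule polygon_facet_lists_homeomorphic, simp)
    then have "triangulates \<Delta> (orientable_surface 5)"
      using fin_complex_list_complex two_dimensional_list_complex[OF tri] by (simp add: triangulates_def \<Delta>)
    moreover have "card (vertices \<Delta>) = 12"
      using vertices_list_complex[OF tri] by (simp add: \<Delta>)
    moreover have "\<exists>\<psi>. polyhedral_realization \<Delta> \<psi> \<and> twofold_rotational_symmetry \<Delta> \<psi>"
      using d by (simp add: \<Delta> realized_def)
    ultimately show "triangulates \<Delta> (orientable_surface 5) \<and> card (vertices \<Delta>) = 12 \<and>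
      (\<exists>\<psi>. polyhedral_realization \<Delta> \<psi> \<and> twofold_rotational_symmetry \<Delta> \<psi>)" by blast
  qed
qed

end
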